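(* Let $\varphi$ be a free holomorphic self-map of the noncommutative ball $[B(\mathcal H)^n]_1$. If $C_\varphi$ is a Fredholm operator on $H^2_{\bf ball}$, then the scalar representation of $\varphi$ is a holomorphic automorphism of $\mathbb B_n$.
   Context: $n\ge1$; $\mathcal H$ is a separable infinite dimensional complex Hilbert space. $\mathbb F_n^+$ is the free semigroup with generators $g_1,\ldots,g_n$ and identity $g_0$; $|g_0|=0$, $|\alpha|=k$ if $\alpha=g_{i_1}\cdots g_{i_k}$; $X_\alpha:=X_{i_1}\cdots X_{i_k}$, $X_{g_0}:=I$. $[B(\mathcal H)^n]_1:=\{(X_1,\ldots,X_n)\in B(\mathcal H)^n:\ \|X_1X_1^*+\cdots+X_nX_n^*\|^{1/2}<1\}$. A free holomorphic function $f:[B(\mathcal H)^n]_1\to B(\mathcal H)$ is a map $f(X)=\sum_{k=0}^\infty\sum_{|\alpha|=k}a_\alpha X_\alpha$ (series over $k$ converging in operator norm) with $a_\alpha\in\mathbb C$ and $\limsup_{k\to\infty}(\sum_{|\alpha|=k}|a_\alpha|^2)^{1/2k}\le1$. A free holomorphic self-map $\varphi=(\varphi_1,\ldots,\varphi_n)$ of $[B(\mathcal H)^n]_1$ has each $\varphi_i$ free holomorphic and maps $[B(\mathcal H)^n]_1$ into itself. With $\varphi_\alpha:=\varphi_{i_1}\cdots\varphi_{i_k}$, the composition is $(f\circ\varphi)(X)=\sum_{k=0}^\infty\sum_{|\alpha|=k}a_\alpha\varphi_\alpha(X)$. $H^2_{\bf ball}$ is the Hilbert space of free holomorphic functions $f=\sum_\alpha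 a_\alpha X_\alpha$ on $[B(\mathcal H)^n]_1$ with $\|f\|_2^2:=\sum_\alpha|a_\alpha|^2<\infty$; $C_\varphi f:=f\circ\varphi$ is a bounded operator on $H^2_{\bf ball}$. $\mathbb B_n$ is the open Euclidean unit ball of $\mathbb C^n$; identifying $\lambda\in\mathbb B_n$ with $(\lambda_1I,\ldots,\lambda_nI)$, the scalar representation of $\varphi$ is the holomorphic map $\mathbb B_n\ni\lambda\mapsto\varphi(\lambda)\in\mathbb B_n$. *)

theory Defs
  imports "HOL-Analysis.Analysis" "HOL-Library.Function_Algebras"
begin

section \<open>Complex Hilbert spaces and their bounded operators\<close>

text \<open>The inner product is linear in the first argument.\<close>

class complex_hilbert = real_normed_vector + complete_space +
  fixes scaleC :: "complex \<Rightarrow> 'a \<Rightarrow> 'a"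
    and cinner :: "'a \<Rightarrow> 'a \<Rightarrow> complex"
  assumes scaleC_add_right: "scaleC c (x + y) = scaleC c x + scaleC c y"
    and scaleC_add_left: "scaleC (c + d) x = scaleC c x + scaleC d x"
    and scaleC_scaleC: "scaleC c (scaleC d x) = scaleC (c * d) x"
    and scaleC_of_real: "scaleC (of_real r) x = scaleR r x"
    and cinner_commute: "cinner x y = cnj (cinner y x)"
    and cinner_add_left: "cinner (x + y) z = cinner x z + cinner y z"
    and cinner_scaleC_left: "cinner (scaleC c x) y = c * cinner x y"
    and cinner_self: "cinner x x = of_real ((norm x)\<^sup>2)"

definition finite_dimensional_in :: "(complex \<Rightarrow> 'v \<Rightarrow> 'v) \<Rightarrow> 'v::ab_group_add set \<Rightarrow> bool" where
  "finite_dimensional_in smul S \<longleftrightarrow> (\<exists>B. finite B \<and> B \<subseteq> S \<and> S \<subseteq> module.span smul B)"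

lemma vector_space_scaleC: "vector_space (scaleC :: complex \<Rightarrow> 'h \<Rightarrow> 'h::complex_hilbert)"
  using scaleC_of_real[of 1]
  by unfold_locales (simp_all add: scaleC_add_right scaleC_add_left scaleC_scaleC)

lemma norm_scaleC: "norm (scaleC c x) = cmod c * norm (x :: 'h::complex_hilbert)"
proof -
  have "of_real ((norm (scaleC c x))\<^sup>2) = c * cnj c * cinner x x"
    by (metis cinner_commute cinner_scaleC_left cinner_self complex_cnj_mult mult.assoc)
  also have "\<dots> = (of_real ((cmod c * norm x)\<^sup>2) :: complex)"
    by (simp add: cinner_self power_mult_distrib flip: complex_norm_square)
  finally have "(norm (scaleC c x))\<^sup>2 = (cmod c * norm x)\<^sup>2"
    using of_real_eq_iff by blast
  then show ?thesis by simp
qed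

text \<open>Operators are real-linear bounded maps (type of the library, with the operator norm and
  its topology); Bop singles out the complex-linear ones.\<close>

definition Bop :: "('h::complex_hilbert \<Rightarrow>\<^sub>L 'h) set" where
  "Bop = {T. \<forall>c x. blinfun_apply T (scaleC c x) = scaleC c (blinfun_apply T x)}"

lift_definition scale_op :: "complex \<Rightarrow> ('h::complex_hilbert \<Rightarrow>\<^sub>L 'h) \<Rightarrow> ('h \<Rightarrow>\<^sub>L 'h)"
  is "\<lambda>c T x. scaleC c (T x)"
proof -
  fix c and T :: "'h \<Rightarrow> 'h"
  assume T: "bounded_linear T"
  have "bounded_linear (scaleC c :: 'h \<Rightarrow> 'h)"
  proof (rule bounded_linear_intro[where K = "cmod c"])
    fix r :: real and x y :: 'h
    show "scaleC c (x + y) = scaleC c x + scaleC c y" by (rule scaleC_add_right)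
    show "scaleC c (r *\<^sub>R x) = r *\<^sub>R scaleC c x"
      by (metis mult.commute scaleC_of_real scaleC_scaleC)
    show "norm (scaleC c x) \<le> norm x * cmod c" by (simp add: norm_scaleC)
  qed
  then show "bounded_linear (\<lambda>x. scaleC c (T x))"
    using T by (rule bounded_linear_compose)
qed

text \<open>The adjoint of an operator in Bop; it exists and is unique by the Riesz representation
  theorem.\<close>

definition adj_op :: "('h::complex_hilbert \<Rightarrow>\<^sub>L 'h) \<Rightarrow> ('h \<Rightarrow>\<^sub>L 'h)" where
  "adj_op T = (THE S. S \<in> Bop \<and>
     (\<forall>x y. cinner (blinfun_apply T x) y = cinner x (blinfun_apply S y)))"

section \<open>Free holomorphic functions on the noncommutative ball\<close>

text \<open>The number n of variables is the cardinality of the index type 'n. Elements of the free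
  semigroup are lists over 'n, with the empty list as identity.\<close>

definition ncball :: "('n::finite \<Rightarrow> 'h::complex_hilbert \<Rightarrow>\<^sub>L 'h) set" where
  "ncball = {X. (\<forall>i. X i \<in> Bop) \<and> sqrt (norm (\<Sum>i\<in>UNIV. X i o\<^sub>L adj_op (X i))) < 1}"

definition op_word :: "('n \<Rightarrow> 'h::complex_hilbert \<Rightarrow>\<^sub>L 'h) \<Rightarrow> 'n list \<Rightarrow> ('h \<Rightarrow>\<^sub>L 'h)" where
  "op_word X \<alpha> = foldr (\<lambda>i T. X i o\<^sub>L T) \<alpha> id_blinfun"

definition homog_term ::
    "('n::finite list \<Rightarrow> complex) \<Rightarrow> ('n \<Rightarrow> 'h::complex_hilbert \<Rightarrow>\<^sub>L 'h) \<Rightarrow> nat \<Rightarrow> ('h \<Rightarrow>\<^sub>L 'h)" where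
  "homog_term a X k = (\<Sum>\<alpha> | length \<alpha> = k. scale_op (a \<alpha>) (op_word X \<alpha>))"

definition free_coeffs :: "('n::finite list \<Rightarrow> complex) \<Rightarrow> bool" where
  "free_coeffs a \<longleftrightarrow>
     limsup (\<lambda>k. ereal (root (2 * k) (\<Sum>\<alpha> | length \<alpha> = k. (cmod (a \<alpha>))\<^sup>2))) \<le> 1"

definition has_free_expansion ::
    "(('n::finite \<Rightarrow> 'h::complex_hilbert \<Rightarrow>\<^sub>L 'h) \<Rightarrow> ('h \<Rightarrow>\<^sub>L 'h)) \<Rightarrow> ('n list \<Rightarrow> complex) \<Rightarrow> bool" where
  "has_free_expansion f a \<longleftrightarrow> free_coeffs a \<and> (\<forall>X\<in>ncball. homog_term a X sums f X)"

definition free_holomorphic ::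
    "(('n::finite \<Rightarrow> 'h::complex_hilbert \<Rightarrow>\<^sub>L 'h) \<Rightarrow> ('h \<Rightarrow>\<^sub>L 'h)) \<Rightarrow> bool" where
  "free_holomorphic f \<longleftrightarrow> (\<exists>a. has_free_expansion f a)"

text \<open>A tuple of functions is encoded as one function with values in tuples.\<close>

definition free_holomorphic_self_map ::
    "(('n::finite \<Rightarrow> 'h::complex_hilbert \<Rightarrow>\<^sub>L 'h) \<Rightarrow> ('n \<Rightarrow> 'h \<Rightarrow>\<^sub>L 'h)) \<Rightarrow> bool" where
  "free_holomorphic_self_map \<phi> \<longleftrightarrow>
     (\<forall>i. free_holomorphic (\<lambda>X. \<phi> X i)) \<and> (\<forall>X\<in>ncball. \<phi> X \<in> ncball)"

text \<open>The coefficients are uniquely determined by the function if the Hilbert space is infinite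
  dimensional.\<close>

definition free_coeff ::
    "(('n::finite \<Rightarrow> 'h::complex_hilbert \<Rightarrow>\<^sub>L 'h) \<Rightarrow> ('h \<Rightarrow>\<^sub>L 'h)) \<Rightarrow> 'n list \<Rightarrow> complex" where
  "free_coeff f = (THE a. has_free_expansion f a)"

section \<open>The Hardy space and composition operators\<close>

text \<open>A function on the ball is represented by its extension by zero, so that equality of functions
  on the ball is equality in HOL. Addition is pointwise (theory Function_Algebras).\<close>

definition scale_fun :: "complex \<Rightarrow> ('a \<Rightarrow> 'h::complex_hilbert \<Rightarrow>\<^sub>L 'h) \<Rightarrow> ('a \<Rightarrow> 'h \<Rightarrow>\<^sub>L 'h)" where
  "scale_fun c f = (\<lambda>X. scale_op c (f X))"

lemma vector_space_scale_fun:
  "vector_space (scale_fun :: complex \<Rightarrow> ('a \<Rightarrow> 'h::complex_hilbert \<Rightarrow>\<^sub>L 'h) \<Rightarrow> _)"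
proof -
  have [simp]: "scaleC 1 x = x" for x :: 'h
    using scaleC_of_real[of 1 x] by simp
  show ?thesis
    by unfold_locales
      (auto simp: fun_eq_iff scale_fun_def blinfun.add_left scale_op.rep_eq
        scaleC_add_right scaleC_add_left scaleC_scaleC intro!: blinfun_eqI)
qed

definition H2_ball :: "(('n::finite \<Rightarrow> 'h::complex_hilbert \<Rightarrow>\<^sub>L 'h) \<Rightarrow> ('h \<Rightarrow>\<^sub>L 'h)) set" where
  "H2_ball = {f. free_holomorphic f \<and> (\<forall>X. X \<notin> ncball \<longrightarrow> f X = 0) \<and>
     (\<lambda>\<alpha>. (cmod (free_coeff f \<alpha>))\<^sup>2) summable_on UNIV}"

definition H2_norm :: "(('n::finite \<Rightarrow> 'h::complex_hilbert \<Rightarrow>\<^sub>L 'h) \<Rightarrow> ('h \<Rightarrow>\<^sub>L 'h)) \<Rightarrow> real" where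
  "H2_norm f = sqrt (\<Sum>\<^sub>\<infinity>\<alpha>. (cmod (free_coeff f \<alpha>))\<^sup>2)"

definition comp_op ::
    "(('n::finite \<Rightarrow> 'h::complex_hilbert \<Rightarrow>\<^sub>L 'h) \<Rightarrow> ('n \<Rightarrow> 'h \<Rightarrow>\<^sub>L 'h)) \<Rightarrow>
     (('n \<Rightarrow> 'h \<Rightarrow>\<^sub>L 'h) \<Rightarrow> ('h \<Rightarrow>\<^sub>L 'h)) \<Rightarrow> (('n \<Rightarrow> 'h \<Rightarrow>\<^sub>L 'h) \<Rightarrow> ('h \<Rightarrow>\<^sub>L 'h))" where
  "comp_op \<phi> f = (\<lambda>X. if X \<in> ncball then (\<Sum>k. homog_term (free_coeff f) (\<phi> X) k) else 0)"

text \<open>Bounded and Fredholm operators on a complex normed space given by a carrier V inside an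
  ambient vector space and a norm N on V. Fredholm: finite-dimensional kernel, closed range,
  and range of finite codimension.\<close>

definition bounded_operator_on ::
    "(complex \<Rightarrow> 'v \<Rightarrow> 'v) \<Rightarrow> 'v::ab_group_add set \<Rightarrow> ('v \<Rightarrow> real) \<Rightarrow> ('v \<Rightarrow> 'v) \<Rightarrow> bool" where
  "bounded_operator_on smul V N T \<longleftrightarrow>
     (\<forall>f\<in>V. T f \<in> V) \<and>
     (\<forall>f\<in>V. \<forall>g\<in>V. T (f + g) = T f + T g) \<and>
     (\<forall>c. \<forall>f\<in>V. T (smul c f) = smul c (T f)) \<and>
     (\<exists>K. \<forall>f\<in>V. N (T f) \<le> K * N f)"

definition fredholm_on ::
    "(complex \<Rightarrow> 'v \<Rightarrow> 'v) \<Rightarrow> 'v::ab_group_add set \<Rightarrow> ('v \<Rightarrow> real) \<Rightarrow> ('v \<Rightarrow> 'v) \<Rightarrow> bool" where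
  "fredholm_on smul V N T \<longleftrightarrow>
     bounded_operator_on smul V N T \<and>
     finite_dimensional_in smul {f\<in>V. T f = 0} \<and>
     (\<forall>s g. (\<forall>k. s k \<in> T ` V) \<and> g \<in> V \<and> (\<lambda>k::nat. N (s k - g)) \<longlonglongrightarrow> 0 \<longrightarrow> g \<in> T ` V) \<and>
     (\<exists>B. finite B \<and> B \<subseteq> V \<and> (\<forall>g\<in>V. \<exists>f\<in>V. g - T f \<in> module.span smul B))"

section \<open>Scalar representation and automorphisms of the Euclidean ball\<close>

definition scalar_tuple :: "complex ^ 'n \<Rightarrow> 'n \<Rightarrow> ('h::complex_hilbert \<Rightarrow>\<^sub>L 'h)" where
  "scalar_tuple z = (\<lambda>i. scale_op (z $ i) id_blinfun)"

text \<open>At a scalar tuple in the ball, a free holomorphic self-map again takes a scalar tuple as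
  value.\<close>

definition scalar_rep ::
    "(('n::finite \<Rightarrow> 'h::complex_hilbert \<Rightarrow>\<^sub>L 'h) \<Rightarrow> ('n \<Rightarrow> 'h \<Rightarrow>\<^sub>L 'h)) \<Rightarrow> complex ^ 'n \<Rightarrow> complex ^ 'n" where
  "scalar_rep \<phi> z = (THE \<mu>. \<phi> (scalar_tuple z) = scalar_tuple \<mu>)"

text \<open>Holomorphy in several variables on an open set: the Frechet derivative exists at every point
  and is complex-linear.\<close>

definition holomorphic_map_on ::
    "(complex ^ 'n \<Rightarrow> complex ^ 'm) \<Rightarrow> (complex ^ 'n::finite) set \<Rightarrow> bool" where
  "holomorphic_map_on F S \<longleftrightarrow>
     (\<forall>z\<in>S. \<exists>D. (F has_derivative D) (at z) \<and> (\<forall>c v. D (c *s v) = c *s D v))"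

definition holomorphic_automorphism ::
    "(complex ^ 'n::finite) set \<Rightarrow> (complex ^ 'n \<Rightarrow> complex ^ 'n) \<Rightarrow> bool" where
  "holomorphic_automorphism S F \<longleftrightarrow>
     bij_betw F S S \<and> holomorphic_map_on F S \<and> holomorphic_map_on (inv_into S F) S"

end

theory Submission
  imports Defs "HOL-Real_Asymp.Real_Asymp"
begin

text \<open>Only the finite codimension d of the range of the composition operator matters. Restricting to
  scalar points, every function in the scalar image of the Hardy space agrees with some
  f o F up to a combination of d fixed functions, where F is the scalar representation. Hence any
  d + 1 test functions have a nontrivial combination of the form f o F, and three choices of
  test functions give the theorem. If a row vector annihilates the derivative of F at a, one
  coordinate of F - F(a) vanishes to second order at a, so that the jets of functions f o F at a
  have codimension larger than d. If F identifies two points, then by the open mapping property it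
  identifies pairs of arbitrarily many distinct points, which polynomials separate. If F maps a sequence
  tending to the boundary to a convergent one in the ball, every f o F is bounded along that
  sequence, unlike powers of (1 - <z, \<zeta>>)^(-s). So F is injective with invertible
  derivatives and has an open and relatively closed image.\<close>

section \<open>Hilbert spaces and adjoints\<close>

text \<open>Nothing is known about the regularity of the d fixed functions, so they can be removed
  only by linear algebra, never by estimates; every argument therefore produces more than d objects
  and compares dimensions. For the jets, the gain comes from weights: a coordinate of F - F(a) that
  vanishes to second order gets weight two, and fewer monomials stay below a given weight than below
  the same degree. Taylor expansion is replaced by division: a power series minus its value at a
  point is a combination of the coordinate differences with power series quotients (Gleason's
  problem), obtained by telescoping on words. The derivative has to be treated before injectivity,
  since its invertibility yields the open mapping property. At the boundary, the coefficients of (1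
  - x)^(-s) are of order k^(s - 1), hence square summable for s < 1/2; spread over words along a
  unit vector they keep their l2 norm on each level, so that the range of s does not depend on the
  number of variables. The bound 1/4 used for s stays safely inside this range.\<close>

instance complex_hilbert \<subseteq> banach ..

lemma scaleC_one [simp]: "scaleC 1 x = (x :: 'h::complex_hilbert)"
  using scaleC_of_real[of 1 x] by simp

lemma scaleC_zero_left [simp]: "scaleC 0 x = (0 :: 'h::complex_hilbert)"
  using scaleC_of_real[of 0 x] by simp

lemma cinner_add_right: "cinner x (y + z) = cinner x y + cinner (x::'h::complex_hilbert) z"
  by (metis cinner_add_left cinner_commute complex_cnj_add)

lemma cinner_scaleC_right: "cinner x (scaleC c y) = cnj c * cinner (x::'h::complex_hilbert) y"
  by (metis cinner_commute cinner_scaleC_left complex_cnj_mult)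

lemma cinner_zero_left [simp]: "cinner 0 (x::'h::complex_hilbert) = 0"
  using cinner_add_left[of 0 0 x] by simp

lemma cinner_zero_right [simp]: "cinner (x::'h::complex_hilbert) 0 = 0"
  using cinner_add_right[of x 0 0] by simp

lemma cinner_diff_left: "cinner (x - y) z = cinner x z - cinner (y::'h::complex_hilbert) z"
  using cinner_add_left[of "x - y" y z] by simp

lemma cinner_diff_right: "cinner x (y - z) = cinner x y - cinner (x::'h::complex_hilbert) z"
  using cinner_add_right[of x "y - z" z] by simp

lemma cinner_sum_left: "cinner (sum f A) y = (\<Sum>i\<in>A. cinner (f i) (y::'h::complex_hilbert))"
  by (induction A rule: infinite_finite_induct) (auto simp: cinner_add_left)

lemma norm_add_cinner:
  "(norm (x + y))\<^sup>2 = (norm x)\<^sup>2 + (norm y)\<^sup>2 + 2 * Re (cinner x (y::'h::complex_hilbert))"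
proof -
  have "complex_of_real ((norm (x + y))\<^sup>2)
      = of_real ((norm x)\<^sup>2) + of_real ((norm y)\<^sup>2) + (cinner x y + cnj (cinner x y))"
    using cinner_commute[of y x]
    by (simp add: cinner_add_left cinner_add_right del: of_real_power flip: cinner_self)
  also have "cinner x y + cnj (cinner x y) = of_real (2 * Re (cinner x y))"
    by (simp add: complex_add_cnj)
  finally show ?thesis
    by (metis of_real_add of_real_eq_iff)
qed

lemma cinner_eqI: "(\<And>z. cinner z x = cinner z y) \<Longrightarrow> x = (y::'h::complex_hilbert)"
proof -
  assume "\<And>z. cinner z x = cinner z y"
  then have "cinner (x - y) (x - y) = 0" by (simp add: cinner_diff_right)
  then show ?thesis by (simp add: cinner_self)
qed

text \<open>The scalar is the one that minimizes the norm of x + c y. Nonnegativity of the right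
  side is Cauchy-Schwarz; the strict decrease when \<open>cinner x y\<close> is nonzero gives the
  orthogonality in \<open>riesz_representation\<close>.\<close>

lemma norm_minus_projection:
  fixes x y :: "'h::complex_hilbert"
  assumes "y \<noteq> 0"
  shows "(norm (x + scaleC (- cinner x y / of_real ((norm y)\<^sup>2)) y))\<^sup>2
    = (norm x)\<^sup>2 - (cmod (cinner x y))\<^sup>2 / (norm y)\<^sup>2"
proof -
  let ?c = "- cinner x y / of_real ((norm y)\<^sup>2)"
  have "cnj ?c * cinner x y = - of_real ((cmod (cinner x y))\<^sup>2 / (norm y)\<^sup>2)"
    by (simp add: complex_norm_square mult.commute del: of_real_power flip: power2_eq_square)
  then have "Re (cinner x (scaleC ?c y)) = - ((cmod (cinner x y))\<^sup>2 / (norm y)\<^sup>2)"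
    by (metis cinner_scaleC_right Re_complex_of_real of_real_minus)
  moreover have "(norm (scaleC ?c y))\<^sup>2 = (cmod (cinner x y))\<^sup>2 / (norm y)\<^sup>2"
    using assms by (simp add: norm_scaleC norm_divide power_mult_distrib power_divide field_simps
        power2_eq_square norm_mult)
  ultimately show ?thesis by (simp add: norm_add_cinner)
qed

lemma cinner_Cauchy_Schwarz: "cmod (cinner x y) \<le> norm x * norm (y::'h::complex_hilbert)"
proof (cases "y = 0")
  case False
  have "0 \<le> (norm x)\<^sup>2 - (cmod (cinner x y))\<^sup>2 / (norm y)\<^sup>2"
    using norm_minus_projection[OF False, of x] zero_le_power2 by metis
  then have "(cmod (cinner x y))\<^sup>2 \<le> (norm x * norm y)\<^sup>2"
    using False by (simp add: field_simps power_mult_distrib)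
  then show ?thesis by (meson mult_nonneg_nonneg norm_ge_zero power2_le_imp_le)
qed simp

lemma bounded_linear_cinner_left: "bounded_linear (\<lambda>x. cinner x (y::'h::complex_hilbert))"
proof (rule bounded_linear_intro[where K = "norm y"])
  show "cinner (r *\<^sub>R x) y = r *\<^sub>R cinner x y" for r x
    by (metis cinner_scaleC_left scaleC_of_real scaleR_conv_of_real)
qed (auto simp: cinner_add_left cinner_Cauchy_Schwarz)

text \<open>The representing vector is a multiple of the point of least norm on the affine
  hyperplane f = 1. That point exists by completeness and is orthogonal to the kernel of f.\<close>

lemma riesz_representation:
  fixes f :: "'h::complex_hilbert \<Rightarrow> complex"
  assumes f: "bounded_linear f" and fC: "\<And>c x. f (scaleC c x) = c * f x"
  shows "\<exists>u. \<forall>x. f x = cinner x u"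
proof (cases "\<forall>x. f x = 0")
  case True
  then show ?thesis by (intro exI[of _ 0]) simp
next
  case False
  interpret f: bounded_linear f by (rule f)
  from False obtain x1 where x1: "f x1 \<noteq> 0" by blast
  define A where "A = {x. f x = 1}"
  have "scaleC (1 / f x1) x1 \<in> A" using x1 by (simp add: A_def fC)
  then have Ane: "norm ` A \<noteq> {}" by blast
  define m where "m = Inf (norm ` A)"
  have mle: "m \<le> norm x" if "x \<in> A" for x
    unfolding m_def using that by (intro cInf_lower) (auto intro!: bdd_belowI[of _ 0])
  have m0: "0 \<le> m"
    unfolding m_def by (intro cInf_greatest Ane) auto
  have "\<exists>x\<in>A. norm x < m + inverse (real (Suc n))" for n
    using cInf_lessD[OF Ane, of "m + inverse (real (Suc n))"] by (auto simp: m_def)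
  then obtain x where xA: "\<And>n. x n \<in> A" and xm: "\<And>n. norm (x n) < m + inverse (real (Suc n))"
    by metis
  have "(\<lambda>n. m + inverse (real (Suc n))) \<longlonglongrightarrow> m + 0"
    by (intro tendsto_intros LIMSEQ_inverse_real_of_nat)
  then have up: "(\<lambda>n. m + inverse (real (Suc n))) \<longlonglongrightarrow> m" by simp
  have lim: "(\<lambda>n. norm (x n)) \<longlonglongrightarrow> m"
    by (rule tendsto_sandwich[OF _ _ tendsto_const up])
      (use mle[OF xA] xm in \<open>auto intro!: always_eventually less_imp_le simp del: of_nat_Suc\<close>)
  \<comment> \<open>Midpoints stay in \<open>A\<close> and so have norm at least \<open>m\<close>;
    the parallelogram law turns this into a bound that makes a minimizing sequence Cauchy.\<close>
  have par: "(norm (y - z))\<^sup>2 \<le> 2 * (norm y)\<^sup>2 + 2 * (norm z)\<^sup>2 - 4 * m\<^sup>2"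
    if "y \<in> A" "z \<in> A" for y z
  proof -
    have "(1/2) *\<^sub>R (y + z) \<in> A" using that by (simp add: A_def f.scaleR f.add scaleR_conv_of_real)
    from mle[OF this] have "2 * m \<le> norm (y + z)" by simp
    then have "(2 * m)\<^sup>2 \<le> (norm (y + z))\<^sup>2" using m0 by (intro power_mono) auto
    moreover have "cinner y (- z) = - cinner y z"
      using cinner_diff_right[of y 0 z] by simp
    then have "(norm (y - z))\<^sup>2 + (norm (y + z))\<^sup>2 = 2 * (norm y)\<^sup>2 + 2 * (norm z)\<^sup>2"
      using norm_add_cinner[of y z] norm_add_cinner[of y "- z"] by simp
    ultimately show ?thesis by (simp add: power_mult_distrib)
  qed
  have "Cauchy x"
  proof (rule metric_CauchyI)
    fix e :: real assume "0 < e"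
    have "(\<lambda>n. 4 * ((norm (x n))\<^sup>2 - m\<^sup>2)) \<longlonglongrightarrow> 4 * (m\<^sup>2 - m\<^sup>2)"
      by (intro tendsto_intros lim)
    then have "eventually (\<lambda>n. 4 * ((norm (x n))\<^sup>2 - m\<^sup>2) < e\<^sup>2) sequentially"
      using \<open>0 < e\<close> by (intro order_tendstoD(2)) auto
    then obtain N where N: "\<And>n. n \<ge> N \<Longrightarrow> 4 * ((norm (x n))\<^sup>2 - m\<^sup>2) < e\<^sup>2"
      by (auto simp: eventually_sequentially)
    have "dist (x k) (x l) < e" if "k \<ge> N" "l \<ge> N" for k l
    proof -
      have "(norm (x k - x l))\<^sup>2 < e\<^sup>2"
        using par[OF xA xA, of k l] N[OF that(1)] N[OF that(2)] by simp
      then show ?thesis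
        using \<open>0 < e\<close> by (simp add: dist_norm power2_less_imp_less)
    qed
    then show "\<exists>M. \<forall>m\<ge>M. \<forall>n\<ge>M. dist (x m) (x n) < e" by blast
  qed
  then obtain x0 where x0: "x \<longlonglongrightarrow> x0" using Cauchy_convergent convergent_def by blast
  have "(\<lambda>n. f (x n)) \<longlonglongrightarrow> f x0" by (rule f.tendsto[OF x0])
  then have fx0: "f x0 = 1" using xA LIMSEQ_const_iff[of 1 "f x0"] by (simp add: A_def)
  have nx0: "norm x0 = m"
    using tendsto_norm[OF x0] lim LIMSEQ_unique by blast
  have orth: "cinner x0 y = 0" if y: "f y = 0" for y
  proof (rule ccontr)
    assume ne: "cinner x0 y \<noteq> 0"
    then have "y \<noteq> 0" by auto
    have "x0 + scaleC (- cinner x0 y / of_real ((norm y)\<^sup>2)) y \<in> A"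
      using fx0 y by (simp add: A_def f.add fC)
    from mle[OF this] have "m\<^sup>2 \<le> (norm x0)\<^sup>2 - (cmod (cinner x0 y))\<^sup>2 / (norm y)\<^sup>2"
      unfolding norm_minus_projection[OF \<open>y \<noteq> 0\<close>, symmetric] using m0 by (intro power_mono) auto
    moreover have "(cmod (cinner x0 y))\<^sup>2 / (norm y)\<^sup>2 > 0" using ne \<open>y \<noteq> 0\<close> by simp
    ultimately show False using nx0 by simp
  qed
  have "x0 \<noteq> 0" using fx0 f.zero by auto
  have "f z = cinner z (scaleC (of_real (inverse ((norm x0)\<^sup>2))) x0)" for z
  proof -
    have "f (z - scaleC (f z) x0) = 0" by (simp add: f.diff fC fx0)
    from orth[OF this] have "cinner (z - scaleC (f z) x0) x0 = 0"
      by (metis cinner_commute complex_cnj_zero)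
    then have "cinner z x0 = f z * of_real ((norm x0)\<^sup>2)"
      by (simp add: cinner_diff_left cinner_scaleC_left cinner_self)
    then show ?thesis
      using \<open>x0 \<noteq> 0\<close> by (simp add: cinner_scaleC_right field_simps)
  qed
  then show ?thesis by blast
qed

text \<open>\<open>adj_op\<close> is a definite description; an adjoint is computed by exhibiting a
  candidate, and uniqueness is the nondegeneracy of \<open>cinner\<close>.\<close>

lemma adj_op_eqI:
  fixes T S :: "'h::complex_hilbert \<Rightarrow>\<^sub>L 'h"
  assumes "S \<in> Bop" "\<And>x y. cinner (T x) y = cinner x (S y)"
  shows "adj_op T = S"
  unfolding adj_op_def
proof (rule the_equality)
  fix S' assume S': "S' \<in> Bop \<and> (\<forall>x y. cinner (T x) y = cinner x (blinfun_apply S' y))"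
  show "S' = S"
    by (intro blinfun_eqI cinner_eqI) (metis S' assms(2))
qed (use assms in blast)

text \<open>Riesz applied to x -> <T x, y> supplies the value u y; boundedness follows from |u y|^2
  = <T (u y), y>.\<close>

lemma cinner_adj_op:
  fixes T :: "'h::complex_hilbert \<Rightarrow>\<^sub>L 'h"
  assumes T: "T \<in> Bop"
  shows "cinner (T x) y = cinner x (adj_op T y)"
proof -
  have "\<exists>u. \<forall>x. cinner (T x) y = cinner x u" for y
    using T by (intro riesz_representation bounded_linear_compose[OF bounded_linear_cinner_left]
      blinfun.bounded_linear_right) (simp add: Bop_def cinner_scaleC_left)
  then obtain u where u: "\<And>x y. cinner (T x) y = cinner x (u y)" by metis
  have uC: "u (scaleC c y) = scaleC c (u y)" for c y
    by (rule cinner_eqI) (simp add: cinner_scaleC_right flip: u)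
  have "bounded_linear u"
  proof (rule bounded_linear_intro[where K = "norm T"])
    show "u (x + y) = u x + u y" for x y
      by (rule cinner_eqI) (simp add: cinner_add_right flip: u)
    show "u (r *\<^sub>R x) = r *\<^sub>R u x" for r x using uC[of "of_real r" x] by (simp add: scaleC_of_real)
    fix y
    have "cmod (cinner (u y) (u y)) \<le> norm (T (u y)) * norm y"
      by (metis u cinner_Cauchy_Schwarz)
    then have "norm (u y) * norm (u y) \<le> norm (u y) * (norm y * norm T)"
      using mult_right_mono[OF norm_blinfun[of T "u y"], of "norm y"]
      by (simp add: cinner_self norm_power power2_eq_square norm_mult mult_ac)
    then show "norm (u y) \<le> norm y * norm T"
      by (cases "u y = 0") (simp_all add: mult_le_cancel_left)
  qed
  then have app: "blinfun_apply (Blinfun u) = u" by (rule bounded_linear_Blinfun_apply)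
  then have "adj_op T = Blinfun u"
    using adj_op_eqI[of "Blinfun u" T] u uC by (simp add: Bop_def)
  then show ?thesis using app u by simp
qed

section \<open>Power series over words\<close>

definition word_mono :: "complex ^ 'n \<Rightarrow> 'n list \<Rightarrow> complex" where
  "word_mono z \<alpha> = prod_list (map (($) z) \<alpha>)"

definition level_norm :: "('n::finite list \<Rightarrow> complex) \<Rightarrow> nat \<Rightarrow> real" where
  "level_norm a k = L2_set (\<lambda>\<alpha>. cmod (a \<alpha>)) {\<alpha>. length \<alpha> = k}"

text \<open>Summed unconditionally over all words instead of degree by degree, so that terms can be
  regrouped freely, as in \<open>gleason_division\<close>. The sum over degrees is recovered in
  \<open>word_series_sums\<close>.\<close>

definition word_series :: "('n::finite list \<Rightarrow> complex) \<Rightarrow> complex ^ 'n \<Rightarrow> complex" where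
  "word_series a z = (\<Sum>\<^sub>\<infinity>\<alpha>. a \<alpha> * word_mono z \<alpha>)"

abbreviation square_summable :: "('n::finite list \<Rightarrow> complex) \<Rightarrow> bool" where
  "square_summable a \<equiv> (\<lambda>\<alpha>. (cmod (a \<alpha>))\<^sup>2) summable_on UNIV"

lemma word_mono_simps [simp]:
  "word_mono z [] = 1" "word_mono z (i # \<alpha>) = z $ i * word_mono z \<alpha>"
  "word_mono z (\<alpha> @ \<beta>) = word_mono z \<alpha> * word_mono z \<beta>"
  by (simp_all add: word_mono_def)

lemma op_word_simps [simp]:
  "op_word X [] = id_blinfun" "op_word X (i # \<alpha>) = X i o\<^sub>L op_word X \<alpha>"
  by (simp_all add: op_word_def)

lemma finite_words [simp]: "finite {\<alpha>::'n::finite list. length \<alpha> = k}"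
  using finite_lists_length_eq[of "UNIV :: 'n set" k] by simp

lemma words_0 [simp]: "{\<alpha>::'n list. length \<alpha> = 0} = {[]}" by auto

lemma sum_words_Suc:
  "(\<Sum>\<alpha> | length \<alpha> = Suc k. F \<alpha>) = (\<Sum>i\<in>(UNIV::'n::finite set). \<Sum>\<alpha> | length \<alpha> = k. F (i # \<alpha>))"
proof -
  have eq: "{\<alpha>::'n list. length \<alpha> = Suc k} = (\<lambda>(i, \<alpha>). i # \<alpha>) ` (UNIV \<times> {\<alpha>. length \<alpha> = k})"
    by (auto simp: length_Suc_conv image_iff)
  have "(\<Sum>\<alpha> | length \<alpha> = Suc k. F \<alpha>) = (\<Sum>(i, \<alpha>)\<in>UNIV \<times> {\<alpha>. length \<alpha> = k}. F (i # \<alpha>))"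
    unfolding eq by (subst sum.reindex) (auto simp: inj_on_def case_prod_unfold)
  then show ?thesis by (simp add: sum.cartesian_product)
qed

lemma level_norm_nonneg [simp]: "0 \<le> level_norm a k"
  by (simp add: level_norm_def)

lemma level_norm_squared: "(level_norm a k)\<^sup>2 = (\<Sum>\<alpha> | length \<alpha> = k. (cmod (a \<alpha>))\<^sup>2)"
  by (simp add: level_norm_def L2_set_def sum_nonneg)

lemma level_norm_Suc_squared:
  "(level_norm a (Suc k))\<^sup>2 = (\<Sum>i\<in>UNIV. (level_norm (\<lambda>\<alpha>. a (i # \<alpha>)) k)\<^sup>2)"
  unfolding level_norm_squared by (rule sum_words_Suc)

text \<open>The sum of |z_\<alpha>|^2 over words of length k factors as the k-th power of the sum of
  |z_i|^2. Together with Cauchy-Schwarz on each level, this matches the l2 condition on coefficients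
  with the Euclidean ball.\<close>

lemma level_norm_word_mono: "level_norm (word_mono z) k = norm z ^ k"
proof (induction k)
  case (Suc k)
  have "(level_norm (word_mono z) (Suc k))\<^sup>2 = (\<Sum>i\<in>UNIV. (cmod (z $ i))\<^sup>2 * (level_norm (word_mono z) k)\<^sup>2)"
    unfolding level_norm_Suc_squared by (simp add: level_norm_squared norm_mult power_mult_distrib sum_distrib_left)
  also have "\<dots> = (norm z * level_norm (word_mono z) k)\<^sup>2"
    by (simp add: norm_vec_def L2_set_def sum_nonneg power_mult_distrib flip: sum_distrib_right)
  finally have "level_norm (word_mono z) (Suc k) = norm z * level_norm (word_mono z) k"
    by (simp add: power2_eq_iff_nonneg)
  then show ?case using Suc by simp
qed (simp add: level_norm_def)

lemma sum_level_le:
  "(\<Sum>\<alpha> | length \<alpha> = k. cmod (a \<alpha> * word_mono z \<alpha>)) \<le> level_norm a k * norm z ^ k"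
  using L2_set_mult_ineq[of "\<lambda>\<alpha>. cmod (a \<alpha>)" "\<lambda>\<alpha>. cmod (word_mono z \<alpha>)" "{\<alpha>. length \<alpha> = k}"]
  unfolding level_norm_word_mono[symmetric] level_norm_def norm_mult by simp

text \<open>Root test: for q between r and 1, the limsup is below 1/q, so the terms are eventually
  at most (r/q)^k.\<close>

lemma summable_level_norm:
  assumes a: "free_coeffs a" and r: "0 \<le> r" "r < 1"
  shows "summable (\<lambda>k. level_norm a k * r ^ k)"
proof -
  obtain q where q: "r < q" "q < 1" using r dense by blast
  have q0: "0 < q" using q r by simp
  have "limsup (\<lambda>k. ereal (root (2 * k) ((level_norm a k)\<^sup>2))) \<le> 1"
    using a by (simp add: free_coeffs_def level_norm_squared)
  also have "1 < ereal (1 / q)" using q q0 by simp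
  finally have "eventually (\<lambda>k. ereal (root (2 * k) ((level_norm a k)\<^sup>2)) < ereal (1 / q)) sequentially"
    by (rule Limsup_lessD)
  \<comment> \<open>Degree 0 is excluded because \<open>root 0\<close> is constantly 0.\<close>
  then have "eventually (\<lambda>k. norm (level_norm a k * r ^ k) \<le> (r / q) ^ k) sequentially"
    using eventually_gt_at_top[of 0]
  proof eventually_elim
    case (elim k)
    have "(level_norm a k)\<^sup>2 = root (2 * k) ((level_norm a k)\<^sup>2) ^ (2 * k)"
      using real_root_pow_pos2[of "2 * k" "(level_norm a k)\<^sup>2"] elim(2) by force
    also have "\<dots> \<le> (1 / q) ^ (2 * k)"
      using elim(1) by (intro power_mono real_root_ge_zero zero_le_power2) simp
    finally have "(level_norm a k)\<^sup>2 \<le> ((1 / q) ^ k)\<^sup>2" by (simp only: power_even_eq)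
    then have "level_norm a k \<le> (1 / q) ^ k"
      by (rule power2_le_imp_le) (use q0 in simp)
    then have "level_norm a k * r ^ k \<le> (1 / q) ^ k * r ^ k"
      by (rule mult_right_mono) (use r in simp)
    also have "\<dots> = ((1 / q) * r) ^ k" by (rule power_mult_distrib[symmetric])
    finally show ?case using r by (simp add: abs_mult)
  qed
  then show ?thesis
    by (rule summable_comparison_test_ev) (use q q0 r in \<open>simp add: summable_geometric\<close>)
qed

lemma free_coeffs_square_summable:
  assumes "square_summable a"
  shows "free_coeffs a"
proof -
  \<comment> \<open>The summand 1 makes \<open>C\<close> positive, so that its roots of growing
    order tend to 1.\<close>
  define C where "C = 1 + (\<Sum>\<^sub>\<infinity>\<alpha>. (cmod (a \<alpha>))\<^sup>2)"
  have "0 \<le> (\<Sum>\<^sub>\<infinity>\<alpha>. (cmod (a \<alpha>))\<^sup>2)" by (rule infsum_nonneg) simp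
  then have C: "0 < C" by (simp add: C_def)
  have le: "(\<Sum>\<alpha> | length \<alpha> = k. (cmod (a \<alpha>))\<^sup>2) \<le> C" for k
    using finite_sum_le_infsum[OF assms, of "{\<alpha>. length \<alpha> = k}"] by (simp add: C_def)
  have "limsup (\<lambda>k. ereal (root (2 * k) (\<Sum>\<alpha> | length \<alpha> = k. (cmod (a \<alpha>))\<^sup>2)))
      \<le> limsup (\<lambda>k. ereal (root (2 * k) C))"
    by (intro Limsup_mono eventually_mono[OF eventually_gt_at_top[of 0]]) (simp add: le)
  also have "(\<lambda>k. root (2 * k) C) \<longlonglongrightarrow> 1"
    using LIMSEQ_subseq_LIMSEQ[OF LIMSEQ_root_const[OF C], of "\<lambda>k. 2 * k"]
    by (simp add: strict_mono_def o_def)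
  then have "limsup (\<lambda>k. ereal (root (2 * k) C)) = ereal 1"
    by (intro lim_imp_Limsup) auto
  finally show ?thesis by (simp add: free_coeffs_def one_ereal_def)
qed

text \<open>A finite set of words has bounded length, so its sum is dominated by the sum over
  finitely many levels.\<close>

lemma summable_on_words:
  fixes f :: "'n::finite list \<Rightarrow> real"
  assumes f: "\<And>\<alpha>. 0 \<le> f \<alpha>" and s: "summable g" and fg: "\<And>k. (\<Sum>\<alpha> | length \<alpha> = k. f \<alpha>) \<le> g k"
  shows "f summable_on UNIV"
proof (rule nonneg_bdd_above_summable_on)
  have g: "0 \<le> g k" for k using sum_nonneg[of "{\<alpha>. length \<alpha> = k}" f] f fg[of k] by simp
  show "bdd_above (sum f ` {F. F \<subseteq> UNIV \<and> finite F})"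
  proof (rule bdd_aboveI2)
    fix F :: "'n list set"
    assume "F \<in> {F. F \<subseteq> UNIV \<and> finite F}"
    then have F: "finite F" by simp
    define K where "K = Suc (Max (length ` F))"
    have "F \<subseteq> (\<Union>k<K. {\<alpha>. length \<alpha> = k})"
      using F by (auto simp: K_def less_Suc_eq_le)
    then have "(\<Sum>\<alpha>\<in>F. f \<alpha>) \<le> (\<Sum>\<alpha>\<in>(\<Union>k<K. {\<alpha>. length \<alpha> = k}). f \<alpha>)"
      using f by (intro sum_mono2) auto
    also have "\<dots> = (\<Sum>k<K. \<Sum>\<alpha> | length \<alpha> = k. f \<alpha>)"
      by (subst sum.UNION_disjoint) auto
    also have "\<dots> \<le> (\<Sum>k<K. g k)"
      by (intro sum_mono fg)
    also have "\<dots> \<le> suminf g"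
      using g by (intro sum_le_suminf s) auto
    finally show "(\<Sum>\<alpha>\<in>F. f \<alpha>) \<le> suminf g" .
  qed
qed (rule f)

lemma abs_summable_word_series:
  assumes a: "free_coeffs a" and z: "norm z < 1"
  shows "(\<lambda>\<alpha>. cmod (a \<alpha> * word_mono z \<alpha>)) summable_on UNIV"
proof (rule summable_on_words)
  show "summable (\<lambda>k. level_norm a k * norm z ^ k)"
    by (rule summable_level_norm[OF a norm_ge_zero z])
qed (simp_all add: sum_level_le)

lemma word_series_sums:
  assumes "free_coeffs a" and "norm z < 1"
  shows "(\<lambda>k. \<Sum>\<alpha> | length \<alpha> = k. a \<alpha> * word_mono z \<alpha>) sums word_series a z"
proof -
  have hs: "((\<lambda>\<alpha>. a \<alpha> * word_mono z \<alpha>) has_sum word_series a z) UNIV"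
    unfolding word_series_def
    by (rule has_sum_infsum[OF abs_summable_summable[OF abs_summable_word_series[OF assms]]])
  have bij: "bij_betw snd (SIGMA k:UNIV. {\<alpha>::'a list. length \<alpha> = k}) UNIV"
    by (simp add: bij_betw_def inj_on_def set_eq_iff image_iff)
  have "((\<lambda>p. a (snd p) * word_mono z (snd p)) has_sum word_series a z)
      (SIGMA k:UNIV. {\<alpha>. length \<alpha> = k})"
    unfolding has_sum_reindex_bij_betw[OF bij, of "\<lambda>\<alpha>. a \<alpha> * word_mono z \<alpha>"] by (rule hs)
  then have "((\<lambda>k. \<Sum>\<alpha> | length \<alpha> = k. a \<alpha> * word_mono z \<alpha>) has_sum word_series a z) UNIV"
  proof (rule has_sum_SigmaD)
    fix k
    show "((\<lambda>\<alpha>. a (snd (k, \<alpha>)) * word_mono z (snd (k, \<alpha>))) has_sum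
        (\<Sum>\<alpha> | length \<alpha> = k. a \<alpha> * word_mono z \<alpha>)) {\<alpha>. length \<alpha> = k}"
      unfolding snd_conv by (rule has_sum_finite[OF finite_words])
  qed
  then show ?thesis by (rule has_sum_imp_sums)
qed

section \<open>Free power series on the noncommutative ball\<close>

lemma scale_op_in_Bop: "T \<in> Bop \<Longrightarrow> scale_op c T \<in> Bop"
  by (simp add: Bop_def scale_op.rep_eq scaleC_scaleC mult.commute)

lemma id_blinfun_in_Bop: "id_blinfun \<in> Bop"
  by (simp add: Bop_def)

lemma norm_scale_op: "norm (scale_op c T) = cmod c * norm (T :: 'h::complex_hilbert \<Rightarrow>\<^sub>L 'h)"
proof -
  have le: "norm (scale_op d S) \<le> cmod d * norm S" for d and S :: "'h \<Rightarrow>\<^sub>L 'h"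
    by (rule norm_blinfun_bound)
      (auto simp: scale_op.rep_eq norm_scaleC mult.assoc intro!: mult_left_mono norm_blinfun)
  show ?thesis
  proof (cases "c = 0")
    case True
    then show ?thesis using le[of c T] by simp
  next
    case False
    have "scale_op (1 / c) (scale_op c T) = T"
      using False by (intro blinfun_eqI) (simp add: scale_op.rep_eq scaleC_scaleC)
    then have "norm T \<le> cmod (1 / c) * norm (scale_op c T)" using le by metis
    then have "cmod c * norm T \<le> norm (scale_op c T)"
      using False by (simp add: norm_divide field_simps)
    then show ?thesis using le[of c T] by simp
  qed
qed

lemma bounded_linear_scale_op:
  "bounded_linear (\<lambda>c. scale_op c (T :: 'h::complex_hilbert \<Rightarrow>\<^sub>L 'h))"
proof (rule bounded_linear_intro[where K = "norm T"])
  show "scale_op (c + d) T = scale_op c T + scale_op d T" for c d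
    by (intro blinfun_eqI) (simp add: scale_op.rep_eq scaleC_add_left blinfun.add_left)
  show "scale_op (r *\<^sub>R c) T = r *\<^sub>R scale_op c T" for r c
    by (intro blinfun_eqI)
      (simp add: scale_op.rep_eq scaleR_conv_of_real blinfun.scaleR_left flip: scaleC_scaleC scaleC_of_real)
qed (simp add: norm_scale_op)

lemma scale_op_id_inject:
  assumes "(x0 :: 'h::complex_hilbert) \<noteq> 0"
  shows "scale_op c (id_blinfun :: 'h \<Rightarrow>\<^sub>L 'h) = scale_op d id_blinfun \<longleftrightarrow> c = d"
proof
  assume eq: "scale_op c (id_blinfun :: 'h \<Rightarrow>\<^sub>L 'h) = scale_op d id_blinfun"
  have "scaleC c x0 = scaleC d x0"
    using arg_cong[OF eq, of "\<lambda>T. blinfun_apply T x0"] by (simp add: scale_op.rep_eq)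
  then have "c * cinner x0 x0 = d * cinner x0 x0"
    by (metis cinner_scaleC_left)
  then show "c = d" using assms by (simp add: cinner_self)
qed simp

lemma norm_id_blinfun:
  assumes "(x0 :: 'h::complex_hilbert) \<noteq> 0"
  shows "norm (id_blinfun :: 'h \<Rightarrow>\<^sub>L 'h) = 1"
proof (rule antisym)
  have "norm (blinfun_apply id_blinfun x0) \<le> norm (id_blinfun :: 'h \<Rightarrow>\<^sub>L 'h) * norm x0"
    by (rule norm_blinfun)
  then show "1 \<le> norm (id_blinfun :: 'h \<Rightarrow>\<^sub>L 'h)" using assms by simp
qed (rule norm_blinfun_bound, auto)

lemma op_word_scalar_tuple:
  "op_word (scalar_tuple z) \<alpha> = scale_op (word_mono z \<alpha>) (id_blinfun :: 'h::complex_hilbert \<Rightarrow>\<^sub>L 'h)"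
proof (induction \<alpha>)
  case Nil
  show ?case by (intro blinfun_eqI) (simp add: scale_op.rep_eq)
next
  case (Cons i \<alpha>)
  show ?case unfolding op_word_simps Cons.IH
    by (intro blinfun_eqI) (simp add: scale_op.rep_eq scalar_tuple_def scaleC_scaleC)
qed

lemma homog_term_scalar_tuple:
  "homog_term a (scalar_tuple z) k
    = scale_op (\<Sum>\<alpha> | length \<alpha> = k. a \<alpha> * word_mono z \<alpha>) (id_blinfun :: 'h::complex_hilbert \<Rightarrow>\<^sub>L 'h)"
proof -
  have "scale_op c (scale_op d id_blinfun) = scale_op (c * d) (id_blinfun :: 'h \<Rightarrow>\<^sub>L 'h)" for c d
    by (intro blinfun_eqI) (simp add: scale_op.rep_eq scaleC_scaleC)
  then show ?thesis
    by (simp add: homog_term_def op_word_scalar_tuple linear_sum[OF bounded_linear.linear[OF bounded_linear_scale_op]])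
qed

lemma adj_op_scale_id:
  "adj_op (scale_op c (id_blinfun :: 'h::complex_hilbert \<Rightarrow>\<^sub>L 'h)) = scale_op (cnj c) id_blinfun"
  by (rule adj_op_eqI)
    (simp_all add: scale_op_in_Bop id_blinfun_in_Bop scale_op.rep_eq cinner_scaleC_left cinner_scaleC_right)

lemma scalar_tuple_in_ncball:
  assumes "(x0 :: 'h::complex_hilbert) \<noteq> 0"
  shows "(scalar_tuple z :: 'n::finite \<Rightarrow> 'h \<Rightarrow>\<^sub>L 'h) \<in> ncball \<longleftrightarrow> norm z < 1"
proof -
  have "scale_op c id_blinfun o\<^sub>L scale_op (cnj c) id_blinfun
      = scale_op (of_real ((cmod c)\<^sup>2)) (id_blinfun :: 'h \<Rightarrow>\<^sub>L 'h)" for c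
    unfolding complex_norm_square by (intro blinfun_eqI) (simp add: scale_op.rep_eq scaleC_scaleC)
  then have "(\<Sum>i\<in>UNIV. scalar_tuple z i o\<^sub>L adj_op (scalar_tuple z i))
      = scale_op (of_real (\<Sum>i\<in>UNIV. (cmod (z $ i))\<^sup>2)) (id_blinfun :: 'h \<Rightarrow>\<^sub>L 'h)"
    by (simp add: scalar_tuple_def adj_op_scale_id linear_sum[OF bounded_linear.linear[OF bounded_linear_scale_op]])
  then have "sqrt (norm (\<Sum>i\<in>UNIV. scalar_tuple z i o\<^sub>L adj_op (scalar_tuple z i :: 'h \<Rightarrow>\<^sub>L 'h)))
      = sqrt (cmod (of_real (\<Sum>i\<in>UNIV. (cmod (z $ i))\<^sup>2)))"
    by (simp only: norm_scale_op norm_id_blinfun[OF assms] mult_1_right)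
  also have "\<dots> = norm z"
    by (simp only: norm_of_real norm_vec_def L2_set_def) (simp add: sum_nonneg)
  finally have eq: "sqrt (norm (\<Sum>i\<in>UNIV. scalar_tuple z i o\<^sub>L adj_op (scalar_tuple z i :: 'h \<Rightarrow>\<^sub>L 'h))) = norm z" .
  show ?thesis
    unfolding ncball_def mem_Collect_eq eq by (simp add: scalar_tuple_def scale_op_in_Bop id_blinfun_in_Bop)
qed

section \<open>Row contractions and convergence on the noncommutative ball\<close>

text \<open>With y the image and X_i' the adjoints, |y|^2 is the sum of the <x_i, X_i' y>, while the
  squares of |X_i' y| add up to <Z y, y>, where Z is the sum of the X_i X_i'. This bounds the row
  operator without forming a direct sum of Hilbert spaces.\<close>

lemma norm_row_le:
  fixes X :: "'n::finite \<Rightarrow> 'h::complex_hilbert \<Rightarrow>\<^sub>L 'h"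
  assumes X: "\<And>i. X i \<in> Bop"
  shows "norm (\<Sum>i\<in>UNIV. X i (x i))
    \<le> sqrt (norm (\<Sum>i\<in>UNIV. X i o\<^sub>L adj_op (X i))) * L2_set (\<lambda>i. norm (x i)) UNIV"
proof -
  define r where "r = norm (\<Sum>i\<in>UNIV. X i o\<^sub>L adj_op (X i))"
  define y where "y = (\<Sum>i\<in>UNIV. X i (x i))"
  have "complex_of_real (\<Sum>i\<in>UNIV. (norm (adj_op (X i) y))\<^sup>2)
      = cinner ((\<Sum>i\<in>UNIV. X i o\<^sub>L adj_op (X i)) y) y"
    by (simp add: blinfun.sum_left cinner_sum_left cinner_adj_op[OF X] cinner_self)
  from arg_cong[OF this, of cmod] have "(\<Sum>i\<in>UNIV. (norm (adj_op (X i) y))\<^sup>2)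
      = cmod (cinner ((\<Sum>i\<in>UNIV. X i o\<^sub>L adj_op (X i)) y) y)"
    by (simp only: norm_of_real abs_of_nonneg[OF sum_nonneg[OF zero_le_power2]])
  also have "\<dots> \<le> norm ((\<Sum>i\<in>UNIV. X i o\<^sub>L adj_op (X i)) y) * norm y"
    by (rule cinner_Cauchy_Schwarz)
  also have "\<dots> \<le> (r * norm y) * norm y"
    unfolding r_def by (rule mult_right_mono[OF norm_blinfun norm_ge_zero])
  finally have "(\<Sum>i\<in>UNIV. (norm (adj_op (X i) y))\<^sup>2) \<le> r * (norm y)\<^sup>2"
    by (simp add: power2_eq_square)
  then have "sqrt (\<Sum>i\<in>UNIV. (norm (adj_op (X i) y))\<^sup>2) \<le> sqrt (r * (norm y)\<^sup>2)"
    by (rule real_sqrt_le_mono)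
  then have L: "L2_set (\<lambda>i. norm (adj_op (X i) y)) UNIV \<le> sqrt r * norm y"
    by (simp add: L2_set_def real_sqrt_mult)
  have "norm y * norm y = cmod (cinner y y)"
    by (simp add: cinner_self norm_power power2_eq_square norm_mult)
  also have "cinner y y = (\<Sum>i\<in>UNIV. cinner (x i) (adj_op (X i) y))"
    by (subst y_def) (simp add: cinner_sum_left cinner_adj_op[OF X])
  also have "cmod \<dots> \<le> (\<Sum>i\<in>UNIV. \<bar>norm (x i)\<bar> * \<bar>norm (adj_op (X i) y)\<bar>)"
    by (intro sum_norm_le) (simp add: cinner_Cauchy_Schwarz)
  also have "\<dots> \<le> L2_set (\<lambda>i. norm (x i)) UNIV * L2_set (\<lambda>i. norm (adj_op (X i) y)) UNIV"
    by (rule L2_set_mult_ineq)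
  also have "\<dots> \<le> L2_set (\<lambda>i. norm (x i)) UNIV * (sqrt r * norm y)"
    by (rule mult_left_mono[OF L L2_set_nonneg])
  finally have "norm y * norm y \<le> (sqrt r * L2_set (\<lambda>i. norm (x i)) UNIV) * norm y"
    by (simp add: mult_ac)
  moreover have "0 \<le> sqrt r * L2_set (\<lambda>i. norm (x i)) UNIV"
    by (simp add: r_def L2_set_nonneg)
  ultimately have "norm y \<le> sqrt r * L2_set (\<lambda>i. norm (x i)) UNIV"
    by (cases "norm y = 0") (simp_all only: mult_le_cancel_right, simp_all)
  then show ?thesis by (simp add: y_def r_def)
qed

lemma homog_term_Suc:
  fixes X :: "'n::finite \<Rightarrow> 'h::complex_hilbert \<Rightarrow>\<^sub>L 'h"
  assumes X: "\<And>i. X i \<in> Bop"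
  shows "homog_term a X (Suc k) x = (\<Sum>i\<in>UNIV. X i (homog_term (\<lambda>\<alpha>. a (i # \<alpha>)) X k x))"
proof -
  have XC: "X i (scaleC c y) = scaleC c (X i y)" for i c y
    using X[of i] by (simp add: Bop_def)
  show ?thesis
    unfolding homog_term_def sum_words_Suc blinfun.sum_left blinfun.sum_right
    by (simp add: scale_op.rep_eq XC)
qed

text \<open>Peeling off the first letter and applying \<open>norm_row_le\<close> keeps the l2 norm
  of the coefficients on the level. The triangle inequality alone would produce the l1 norm, which
  can be larger by the factor n^(k/2) and would not fit \<open>free_coeffs\<close>.\<close>

lemma norm_homog_term_le:
  fixes X :: "'n::finite \<Rightarrow> 'h::complex_hilbert \<Rightarrow>\<^sub>L 'h"
  assumes X: "\<And>i. X i \<in> Bop"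
  shows "norm (homog_term a X k x)
    \<le> level_norm a k * sqrt (norm (\<Sum>i\<in>UNIV. X i o\<^sub>L adj_op (X i))) ^ k * norm x"
proof (induction k arbitrary: a)
  case 0
  then show ?case unfolding homog_term_def level_norm_def words_0
    by (simp add: scale_op.rep_eq norm_scaleC)
next
  case (Suc k)
  define r where "r = sqrt (norm (\<Sum>i\<in>UNIV. X i o\<^sub>L adj_op (X i)))"
  have r0: "0 \<le> r" by (simp add: r_def)
  let ?b = "\<lambda>i. level_norm (\<lambda>\<alpha>. a (i # \<alpha>)) k"
  have "norm (homog_term a X (Suc k) x)
      \<le> r * L2_set (\<lambda>i. norm (homog_term (\<lambda>\<alpha>. a (i # \<alpha>)) X k x)) UNIV"
    unfolding homog_term_Suc[OF X] r_def by (rule norm_row_le[OF X])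
  also have "\<dots> \<le> r * L2_set (\<lambda>i. ?b i * (r ^ k * norm x)) UNIV"
    by (intro mult_left_mono L2_set_mono r0) (use Suc.IH in \<open>simp_all add: r_def mult.assoc\<close>)
  also have "L2_set (\<lambda>i. ?b i * (r ^ k * norm x)) UNIV = L2_set ?b UNIV * (r ^ k * norm x)"
    using r0 by (simp add: L2_set_left_distrib)
  also have "L2_set ?b UNIV = level_norm a (Suc k)"
    unfolding L2_set_def level_norm_Suc_squared[symmetric] by simp
  finally show ?case by (simp add: r_def mult_ac)
qed

lemma homog_term_summable:
  fixes X :: "'n::finite \<Rightarrow> 'h::complex_hilbert \<Rightarrow>\<^sub>L 'h"
  assumes a: "free_coeffs a" and X: "X \<in> ncball"
  shows "summable (homog_term a X)"
proof (rule summable_comparison_test)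
  define r where "r = sqrt (norm (\<Sum>i\<in>UNIV. X i o\<^sub>L adj_op (X i)))"
  have XB: "\<And>i. X i \<in> Bop" and r: "0 \<le> r" "r < 1"
    using X by (auto simp: ncball_def r_def)
  show "summable (\<lambda>k. level_norm a k * r ^ k)" by (rule summable_level_norm[OF a r])
  have "norm (homog_term a X k) \<le> level_norm a k * r ^ k" for k
  proof (rule norm_blinfun_bound)
    show "norm (homog_term a X k x) \<le> level_norm a k * r ^ k * norm x" for x
      unfolding r_def by (rule norm_homog_term_le[OF XB])
  qed (simp add: r(1))
  then show "\<exists>N. \<forall>k\<ge>N. norm (homog_term a X k) \<le> level_norm a k * r ^ k" by blast
qed

section \<open>Recovering coefficients from operator values\<close>

text \<open>Gram-Schmidt over an arbitrary finite index set, later a set of words; infinite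
  dimension supplies a vector outside the span at each step.\<close>

lemma orthonormal_family_exists:
  assumes inf: "\<not> finite_dimensional_in scaleC (UNIV :: 'h::complex_hilbert set)" and A: "finite A"
  shows "\<exists>e :: 'a \<Rightarrow> 'h. \<forall>a\<in>A. \<forall>b\<in>A. cinner (e a) (e b) = (if a = b then 1 else 0)"
  using A
proof induction
  case (insert a A)
  interpret V: vector_space "scaleC :: complex \<Rightarrow> 'h \<Rightarrow> 'h" by (rule vector_space_scaleC)
  from insert.IH obtain e :: "'a \<Rightarrow> 'h"
    where e: "\<And>b c. b \<in> A \<Longrightarrow> c \<in> A \<Longrightarrow> cinner (e b) (e c) = (if b = c then 1 else 0)" by blast
  have "finite (e ` A)" using insert.hyps by simp
  then obtain x where x: "x \<notin> V.span (e ` A)"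
    using inf unfolding finite_dimensional_in_def by blast
  define y where "y = x - (\<Sum>b\<in>A. scaleC (cinner x (e b)) (e b))"
  have "(\<Sum>b\<in>A. scaleC (cinner x (e b)) (e b)) \<in> V.span (e ` A)"
    by (intro V.span_sum V.span_scale V.span_base) auto
  with x have y0: "y \<noteq> 0" unfolding y_def by auto
  have ye: "cinner y (e c) = 0" if c: "c \<in> A" for c
  proof -
    have "cinner y (e c) = cinner x (e c) - (\<Sum>b\<in>A. cinner x (e b) * cinner (e b) (e c))"
      by (simp add: y_def cinner_diff_left cinner_sum_left cinner_scaleC_left)
    also have "(\<Sum>b\<in>A. cinner x (e b) * cinner (e b) (e c)) = (\<Sum>b\<in>A. if b = c then cinner x (e b) else 0)"
      by (intro sum.cong) (simp_all add: e c)
    also have "\<dots> = cinner x (e c)" using insert.hyps c by simp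
    finally show ?thesis by simp
  qed
  have ey: "cinner (e c) y = 0" if c: "c \<in> A" for c
    using ye[OF c] cinner_commute[of "e c" y] by simp
  define u where "u = scaleC (of_real (inverse (norm y))) y"
  have uu: "cinner u u = 1"
    unfolding u_def cinner_scaleC_left cinner_scaleC_right
    using y0 by (simp add: cinner_self power2_eq_square field_simps)
  have "cinner u (e c) = 0 \<and> cinner (e c) u = 0" if c: "c \<in> A" for c
    using ye[OF c] ey[OF c] by (simp add: u_def cinner_scaleC_left cinner_scaleC_right)
  then have "\<forall>b\<in>insert a A. \<forall>c\<in>insert a A.
      cinner ((e(a := u)) b) ((e(a := u)) c) = (if b = c then 1 else 0)"
    using uu e insert.hyps by auto
  then show ?case by blast
qed simp

definition rank_one :: "'h::complex_hilbert \<Rightarrow> 'h \<Rightarrow> 'h \<Rightarrow>\<^sub>L 'h" where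
  "rank_one v u = Blinfun (\<lambda>x. scaleC (cinner x u) v)"

lemma rank_one_apply [simp]: "rank_one v u x = scaleC (cinner x u) v"
proof -
  have "bounded_linear (\<lambda>x. scaleC (cinner x u) v)"
  proof (rule bounded_linear_intro[where K = "norm u * norm v"])
    show "scaleC (cinner (r *\<^sub>R x) u) v = r *\<^sub>R scaleC (cinner x u) v" for r x
      by (metis cinner_scaleC_left scaleC_of_real scaleC_scaleC)
    show "norm (scaleC (cinner x u) v) \<le> norm x * (norm u * norm v)" for x
      using mult_right_mono[OF cinner_Cauchy_Schwarz[of x u] norm_ge_zero[of v]]
      by (simp add: norm_scaleC mult.assoc)
  qed (simp add: cinner_add_left scaleC_add_left)
  then show ?thesis by (simp add: rank_one_def bounded_linear_Blinfun_apply)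
qed

lemma scaleC_zero_right [simp]: "scaleC c 0 = (0 :: 'h::complex_hilbert)"
  using norm_scaleC[of c "0 :: 'h"] by simp

lemma scaleC_sum_right: "scaleC c (sum f A) = (\<Sum>i\<in>A. scaleC c (f i :: 'h::complex_hilbert))"
proof -
  interpret V: vector_space "scaleC :: complex \<Rightarrow> 'h \<Rightarrow> 'h" by (rule vector_space_scaleC)
  show ?thesis by (rule V.scale_sum_right)
qed

lemma sum_in_Bop: "(\<And>i. i \<in> A \<Longrightarrow> F i \<in> Bop) \<Longrightarrow> sum F A \<in> Bop"
  by (simp add: Bop_def blinfun.sum_left scaleC_sum_right)

lemma rank_one_in_Bop: "rank_one v u \<in> Bop"
  by (simp add: Bop_def cinner_scaleC_left scaleC_scaleC)

lemma cinner_sum_right: "cinner y (sum f A) = (\<Sum>i\<in>A. cinner y (f i :: 'h::complex_hilbert))"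
  by (induction A rule: infinite_finite_induct) (auto simp: cinner_add_right)

text \<open>Compressions of the left creation operators of the Fock space to words of bounded length,
  scaled into the ball, recover every single coefficient.\<close>

lemma coefficient_extraction:
  fixes \<alpha> :: "'n::finite list"
  assumes inf: "\<not> finite_dimensional_in scaleC (UNIV :: 'h::complex_hilbert set)"
  obtains X :: "'n \<Rightarrow> 'h::complex_hilbert \<Rightarrow>\<^sub>L 'h" and r :: real and x y :: "'h::complex_hilbert"
  where "X \<in> ncball" "r \<noteq> 0" "\<And>a. (\<lambda>k. cinner (homog_term a X k x) y) sums (a \<alpha> * of_real r)"
proof -
  define K where "K = length \<alpha>"
  have "finite {\<beta>::'n list. length \<beta> \<le> K}"
    using finite_lists_length_le[of "UNIV :: 'n set" K] by simp
  from orthonormal_family_exists[OF inf this] obtain e :: "'n list \<Rightarrow> 'h"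
    where e: "\<And>\<beta> \<gamma>. length \<beta> \<le> K \<Longrightarrow> length \<gamma> \<le> K \<Longrightarrow> cinner (e \<beta>) (e \<gamma>) = (if \<beta> = \<gamma> then 1 else 0)"
    by auto
  have fin: "finite {\<beta>::'n list. length \<beta> < K}"
    by (rule finite_subset[OF _ \<open>finite {\<beta>. length \<beta> \<le> K}\<close>]) auto
  define S where "S i = (\<Sum>\<beta> | length \<beta> < K. rank_one (e (i # \<beta>)) (e \<beta>))" for i
  define S' where "S' i = (\<Sum>\<beta> | length \<beta> < K. rank_one (e \<beta>) (e (i # \<beta>)))" for i
  have adj: "cinner (S i x) y = cinner x (S' i y)" for i x y
    by (simp add: S_def S'_def blinfun.sum_left cinner_sum_left cinner_sum_right cinner_scaleC_left
        cinner_scaleC_right mult.commute flip: cinner_commute)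
  have SB: "S i \<in> Bop" "S' i \<in> Bop" for i
    by (simp_all add: S_def S'_def sum_in_Bop rank_one_in_Bop)
  define C where "C = norm (\<Sum>i\<in>UNIV. S i o\<^sub>L S' i)"
  \<comment> \<open>Scaling the operators by r multiplies the norm C by r^2, and r^2 C \<le> r C <
    1.\<close>
  define r where "r = 1 / (1 + C)"
  have C0: "0 \<le> C" by (simp add: C_def)
  have r: "0 < r" "r \<le> 1" "r * C < 1" using C0 by (simp_all add: r_def)
  define X where "X i = scale_op (of_real r) (S i)" for i
  have adjX: "adj_op (X i) = scale_op (of_real r) (S' i)" for i
    by (rule adj_op_eqI)
      (simp_all add: scale_op_in_Bop SB X_def scale_op.rep_eq cinner_scaleC_left cinner_scaleC_right adj)
  have XX: "X i o\<^sub>L adj_op (X i) = (r * r) *\<^sub>R (S i o\<^sub>L S' i)" for i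
    unfolding adjX unfolding X_def
    by (intro blinfun_eqI) (simp add: scale_op.rep_eq scaleC_of_real blinfun.scaleR_left blinfun.scaleR_right)
  have "norm (\<Sum>i\<in>UNIV. X i o\<^sub>L adj_op (X i)) = r * (r * C)"
    unfolding XX C_def using r(1) by (simp flip: scaleR_sum_right)
  also have "\<dots> \<le> 1 * (r * C)"
    by (rule mult_right_mono) (use r C0 in simp_all)
  also have "\<dots> < 1" using r by simp
  finally have XN: "X \<in> ncball"
    by (simp add: ncball_def X_def scale_op_in_Bop SB)
  have Xe: "X i (e \<beta>) = (if length \<beta> < K then scaleC (of_real r) (e (i # \<beta>)) else 0)"
    if "length \<beta> \<le> K" for i \<beta>
  proof -
    have "S i (e \<beta>) = (\<Sum>\<gamma> | length \<gamma> < K. if \<gamma> = \<beta> then e (i # \<beta>) else 0)"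
      unfolding S_def blinfun.sum_left using that by (intro sum.cong) (auto simp: e)
    also have "\<dots> = (if length \<beta> < K then e (i # \<beta>) else 0)"
      using fin by (simp add: sum.delta)
    finally show ?thesis
      by (simp add: X_def scale_op.rep_eq)
  qed
  have XC: "X i (scaleC c x) = scaleC c (X i x)" for i c x
    using scale_op_in_Bop[OF SB(1)[of i], of "of_real r"] by (simp add: X_def Bop_def)
  \<comment> \<open>On \<open>e []\<close> a word writes down its letters one by one, each with a
    factor r, and words longer than K give 0. Pairing with \<open>e \<alpha>\<close> therefore
    isolates one coefficient, in the single degree K.\<close>
  have word: "op_word X \<beta> (e []) = (if length \<beta> \<le> K then scaleC (of_real r ^ length \<beta>) (e \<beta>) else 0)" for \<beta>
  proof (induction \<beta>)
    case (Cons i \<beta>)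
    then show ?case
      by (auto simp: XC Xe scaleC_scaleC mult.commute)
  qed simp
  have "cinner (homog_term a X k (e [])) (e \<alpha>) = (if k = K then a \<alpha> * of_real (r ^ K) else 0)" for a k
  proof -
    have "cinner (homog_term a X k (e [])) (e \<alpha>)
        = (\<Sum>\<beta> | length \<beta> = k. a \<beta> * cinner (op_word X \<beta> (e [])) (e \<alpha>))"
      by (simp add: homog_term_def blinfun.sum_left cinner_sum_left scale_op.rep_eq cinner_scaleC_left)
    also have "\<dots> = (\<Sum>\<beta> | length \<beta> = k. if \<beta> = \<alpha> then a \<alpha> * of_real (r ^ K) else 0)"
      by (intro sum.cong refl) (auto simp: word K_def[symmetric] e cinner_scaleC_left)
    also have "\<dots> = (if k = K then a \<alpha> * of_real (r ^ K) else 0)"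
      by (subst sum.delta) (auto simp: K_def)
    finally show ?thesis .
  qed
  then have "(\<lambda>k. cinner (homog_term a X k (e [])) (e \<alpha>)) sums (a \<alpha> * of_real (r ^ K))" for a
    using sums_single[of K "\<lambda>_. a \<alpha> * of_real (r ^ K)"] by simp
  moreover have "r ^ K \<noteq> 0" using r(1) by simp
  ultimately show thesis using that[OF XN] by blast
qed

lemma has_free_expansion_unique:
  fixes f :: "('n::finite \<Rightarrow> 'h::complex_hilbert \<Rightarrow>\<^sub>L 'h) \<Rightarrow> ('h \<Rightarrow>\<^sub>L 'h)"
  assumes inf: "\<not> finite_dimensional_in scaleC (UNIV :: 'h set)"
    and a: "has_free_expansion f a" and b: "has_free_expansion f b"
  shows "a = b"
proof
  fix \<alpha>
  obtain X :: "'n \<Rightarrow> 'h \<Rightarrow>\<^sub>L 'h" and x y :: 'h and r :: real where X: "X \<in> ncball" "r \<noteq> 0"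
    and s: "\<And>a. (\<lambda>k. cinner (homog_term a X k x) y) sums (a \<alpha> * of_real r)"
    using coefficient_extraction[OF inf, of \<alpha>] by blast
  have bl: "bounded_linear (\<lambda>T. cinner (blinfun_apply T x) y)"
    by (rule bounded_linear_compose[OF bounded_linear_cinner_left blinfun.bounded_linear_left])
  have "(\<lambda>k. cinner (homog_term c X k x) y) sums cinner (f X x) y" if "has_free_expansion f c" for c
    using that X(1) by (intro bounded_linear.sums[OF bl]) (simp add: has_free_expansion_def)
  from this[OF a] this[OF b] have "a \<alpha> * of_real r = b \<alpha> * of_real r"
    using s sums_unique2 by metis
  then show "a \<alpha> = b \<alpha>" using X(2) by simp
qed

lemma free_coeff_eq:
  fixes f :: "('n::finite \<Rightarrow> 'h::complex_hilbert \<Rightarrow>\<^sub>L 'h) \<Rightarrow> ('h \<Rightarrow>\<^sub>L 'h)"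
  assumes "\<not> finite_dimensional_in scaleC (UNIV :: 'h set)" and "has_free_expansion f a"
  shows "free_coeff f = a"
  unfolding free_coeff_def using assms has_free_expansion_unique by blast

lemma free_expansion_scalar_tuple:
  fixes f :: "('n::finite \<Rightarrow> 'h::complex_hilbert \<Rightarrow>\<^sub>L 'h) \<Rightarrow> ('h \<Rightarrow>\<^sub>L 'h)"
  assumes f: "has_free_expansion f a" and z: "norm z < 1" and x0: "(x0 :: 'h) \<noteq> 0"
  shows "f (scalar_tuple z) = scale_op (word_series a z) id_blinfun"
proof -
  have "homog_term a (scalar_tuple z) sums f (scalar_tuple z)"
    using f scalar_tuple_in_ncball[OF x0, of z] z by (simp add: has_free_expansion_def)
  moreover have "homog_term a (scalar_tuple z) sums scale_op (word_series a z) (id_blinfun :: 'h \<Rightarrow>\<^sub>L 'h)"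
    unfolding homog_term_scalar_tuple[abs_def] using f z
    by (intro bounded_linear.sums[OF bounded_linear_scale_op] word_series_sums)
      (simp_all add: has_free_expansion_def)
  ultimately show ?thesis by (rule sums_unique2)
qed

lemma scalar_rep_eq:
  fixes \<phi> :: "('n::finite \<Rightarrow> 'h::complex_hilbert \<Rightarrow>\<^sub>L 'h) \<Rightarrow> ('n \<Rightarrow> 'h \<Rightarrow>\<^sub>L 'h)"
  assumes A: "\<And>i. has_free_expansion (\<lambda>X. \<phi> X i) (A i)" and z: "norm z < 1" and x0: "(x0 :: 'h) \<noteq> 0"
  shows "scalar_rep \<phi> z = (\<chi> i. word_series (A i) z)"
    and "\<phi> (scalar_tuple z) = scalar_tuple (scalar_rep \<phi> z)"
proof -
  have eq: "\<phi> (scalar_tuple z) = scalar_tuple (\<chi> i. word_series (A i) z)"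
    using free_expansion_scalar_tuple[OF A z x0] by (simp add: scalar_tuple_def fun_eq_iff)
  show "scalar_rep \<phi> z = (\<chi> i. word_series (A i) z)"
    unfolding scalar_rep_def
  proof (rule the_equality, rule eq)
    fix \<mu> assume "\<phi> (scalar_tuple z) = scalar_tuple \<mu>"
    with eq show "\<mu> = (\<chi> i. word_series (A i) z)"
      by (simp add: scalar_tuple_def fun_eq_iff vec_eq_iff scale_op_id_inject[OF x0])
  qed
  with eq show "\<phi> (scalar_tuple z) = scalar_tuple (scalar_rep \<phi> z)" by simp
qed

section \<open>From operators on the Hardy space to scalar functions\<close>

lemma H2_ball_element_exists:
  assumes inf: "\<not> finite_dimensional_in scaleC (UNIV :: 'h::complex_hilbert set)"
    and a: "square_summable a"
  obtains f :: "('n::finite \<Rightarrow> 'h::complex_hilbert \<Rightarrow>\<^sub>L 'h) \<Rightarrow> ('h \<Rightarrow>\<^sub>L 'h)"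
  where "f \<in> H2_ball" "free_coeff f = a" "has_free_expansion f a"
proof -
  define f :: "('n \<Rightarrow> 'h \<Rightarrow>\<^sub>L 'h) \<Rightarrow> ('h \<Rightarrow>\<^sub>L 'h)"
    where "f X = (if X \<in> ncball then (\<Sum>k. homog_term a X k) else 0)" for X
  have fa: "has_free_expansion f a"
    unfolding has_free_expansion_def f_def
    using free_coeffs_square_summable[OF a] homog_term_summable by (auto intro: summable_sums)
  from free_coeff_eq[OF inf fa] have "free_coeff f = a" .
  moreover from this have "f \<in> H2_ball"
    using fa a by (auto simp: H2_ball_def free_holomorphic_def f_def)
  ultimately show thesis using fa that by blast
qed

lemma H2_ballD:
  fixes f :: "('n::finite \<Rightarrow> 'h::complex_hilbert \<Rightarrow>\<^sub>L 'h) \<Rightarrow> ('h \<Rightarrow>\<^sub>L 'h)"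
  assumes inf: "\<not> finite_dimensional_in scaleC (UNIV :: 'h set)" and f: "f \<in> H2_ball"
  shows "has_free_expansion f (free_coeff f)" "square_summable (free_coeff f)"
  using f free_coeff_eq[OF inf] by (auto simp: H2_ball_def free_holomorphic_def)

lemma sum_fun_apply: "(\<Sum>v\<in>B. F v) X = (\<Sum>v\<in>B. F v X)"
  by (induction B rule: infinite_finite_induct) auto

text \<open>The d functions \<open>b\<close> are the scalar values of a finite set \<open>B\<close>
  whose span, added to the range of the composition operator, covers the Hardy space.\<close>

lemma scalar_reduction:
  fixes \<phi> :: "('n::finite \<Rightarrow> 'h::complex_hilbert \<Rightarrow>\<^sub>L 'h) \<Rightarrow> ('n \<Rightarrow> 'h \<Rightarrow>\<^sub>L 'h)"
  assumes inf: "\<not> finite_dimensional_in scaleC (UNIV :: 'h set)"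
    and self_map: "free_holomorphic_self_map \<phi>"
    and fredholm: "fredholm_on scale_fun H2_ball H2_norm (comp_op \<phi>)"
  obtains A :: "'n \<Rightarrow> 'n list \<Rightarrow> complex" and d :: nat and b :: "nat \<Rightarrow> complex ^ 'n \<Rightarrow> complex"
  where "\<And>i. free_coeffs (A i)"
    and "\<And>z. norm z < 1 \<Longrightarrow> scalar_rep \<phi> z = (\<chi> i. word_series (A i) z)"
    and "\<And>z. norm z < 1 \<Longrightarrow> norm (scalar_rep \<phi> z) < 1"
    and "\<And>a. square_summable a \<Longrightarrow> \<exists>a' c. square_summable a' \<and>
          (\<forall>z. norm z < 1 \<longrightarrow> word_series a z = word_series a' (scalar_rep \<phi> z) + (\<Sum>j<d. c j * b j z))"
proof -
  obtain e :: "unit \<Rightarrow> 'h" where "cinner (e ()) (e ()) = 1"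
    using orthonormal_family_exists[OF inf, of "{()}"] by auto
  then obtain x0 :: 'h where x01: "cinner x0 x0 = 1" by blast
  then have x0: "x0 \<noteq> 0" by auto
  obtain A where A: "\<And>i. has_free_expansion (\<lambda>X. \<phi> X i) (A i)"
    using self_map unfolding free_holomorphic_self_map_def free_holomorphic_def by metis
  note rep = scalar_rep_eq[OF A _ x0]
  have ball: "norm (scalar_rep \<phi> z) < 1" if z: "norm z < 1" for z
  proof -
    have "\<phi> (scalar_tuple z) \<in> ncball"
      using self_map scalar_tuple_in_ncball[OF x0, of z] z by (simp add: free_holomorphic_self_map_def)
    then show ?thesis by (simp only: rep(2)[OF z] scalar_tuple_in_ncball[OF x0])
  qed
  \<comment> \<open>A matrix coefficient at a unit vector. It reads off the scalar where the value
    is a multiple of the identity, and it is linear in g, so it passes through the span of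
    \<open>B\<close> whatever values the elements of \<open>B\<close> take at scalar tuples.\<close>
  define hat :: "(('n \<Rightarrow> 'h \<Rightarrow>\<^sub>L 'h) \<Rightarrow> ('h \<Rightarrow>\<^sub>L 'h)) \<Rightarrow> complex ^ 'n \<Rightarrow> complex"
    where "hat g z = cinner (g (scalar_tuple z) x0) x0" for g z
  have hat_scalar: "hat g z = c" if "g (scalar_tuple z) = scale_op c id_blinfun" for g z c
    using x01 by (simp add: hat_def that scale_op.rep_eq cinner_scaleC_left)
  interpret V: vector_space "scale_fun :: complex \<Rightarrow> (('n \<Rightarrow> 'h \<Rightarrow>\<^sub>L 'h) \<Rightarrow> ('h \<Rightarrow>\<^sub>L 'h)) \<Rightarrow> _"
    by (rule vector_space_scale_fun)
  from fredholm obtain B :: "(('n \<Rightarrow> 'h \<Rightarrow>\<^sub>L 'h) \<Rightarrow> ('h \<Rightarrow>\<^sub>L 'h)) set"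
    where B: "finite B" "\<And>g. g \<in> H2_ball \<Longrightarrow> \<exists>f\<in>H2_ball. g - comp_op \<phi> f \<in> V.span B"
    unfolding fredholm_on_def by blast
  obtain v where v: "bij_betw v {..<card B} B"
    using ex_bij_betw_nat_finite[OF B(1)] by (auto simp: atLeast0LessThan)
  have "\<exists>a' c. square_summable a' \<and>
      (\<forall>z. norm z < 1 \<longrightarrow> word_series a z = word_series a' (scalar_rep \<phi> z) + (\<Sum>j<card B. c j * hat (v j) z))"
    if a: "square_summable a" for a
  proof -
    obtain g :: "('n \<Rightarrow> 'h \<Rightarrow>\<^sub>L 'h) \<Rightarrow> ('h \<Rightarrow>\<^sub>L 'h)"
      where g: "g \<in> H2_ball" "has_free_expansion g a"
      using H2_ball_element_exists[OF inf a] by metis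
    from B(2)[OF g(1)] obtain f where f: "f \<in> H2_ball" "g - comp_op \<phi> f \<in> V.span B" by blast
    from f(2) obtain u where u: "g - comp_op \<phi> f = (\<Sum>w\<in>B. scale_fun (u w) w)"
      unfolding V.span_finite[OF B(1)] by blast
    note fa = H2_ballD[OF inf f(1)]
    have "word_series a z = word_series (free_coeff f) (scalar_rep \<phi> z) + (\<Sum>j<card B. u (v j) * hat (v j) z)"
      if z: "norm z < 1" for z
    proof -
      have "comp_op \<phi> f (scalar_tuple z) = (\<Sum>k. homog_term (free_coeff f) (scalar_tuple (scalar_rep \<phi> z)) k)"
        using scalar_tuple_in_ncball[OF x0, of z] z by (simp add: comp_op_def rep(2)[OF z])
      also have "\<dots> = f (scalar_tuple (scalar_rep \<phi> z))"
        using fa(1) scalar_tuple_in_ncball[OF x0, of "scalar_rep \<phi> z"] ball[OF z]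
        by (simp add: has_free_expansion_def sums_iff)
      also have "\<dots> = scale_op (word_series (free_coeff f) (scalar_rep \<phi> z)) id_blinfun"
        by (rule free_expansion_scalar_tuple[OF fa(1) ball[OF z] x0])
      finally have "hat (comp_op \<phi> f) z = word_series (free_coeff f) (scalar_rep \<phi> z)"
        by (rule hat_scalar)
      moreover have "hat g z = word_series a z"
        by (rule hat_scalar, rule free_expansion_scalar_tuple[OF g(2) z x0])
      moreover have "hat (g - comp_op \<phi> f) z = hat g z - hat (comp_op \<phi> f) z"
        by (simp add: hat_def blinfun.diff_left cinner_diff_left)
      moreover have "hat (\<Sum>w\<in>B. scale_fun (u w) w) z = (\<Sum>w\<in>B. u w * hat w z)"
        by (simp add: hat_def sum_fun_apply blinfun.sum_left cinner_sum_left scale_fun_def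
            scale_op.rep_eq cinner_scaleC_left)
      moreover have "(\<Sum>w\<in>B. u w * hat w z) = (\<Sum>j<card B. u (v j) * hat (v j) z)"
        by (rule sum.reindex_bij_betw[OF v, symmetric])
      moreover have "hat (g - comp_op \<phi> f) z = hat (\<Sum>w\<in>B. scale_fun (u w) w) z"
        by (simp only: u)
      ultimately show ?thesis by (simp add: diff_eq_eq add.commute)
    qed
    then show ?thesis
      by (intro exI[of _ "free_coeff f"] exI[of _ "\<lambda>j. u (v j)"]) (use fa(2) in simp)
  qed
  from that[OF _ rep(1) ball this] A show thesis
    unfolding has_free_expansion_def by blast
qed

section \<open>Division at a point of the ball\<close>

definition rad_mono :: "('n \<Rightarrow> real) \<Rightarrow> 'n list \<Rightarrow> real" where
  "rad_mono R \<alpha> = prod_list (map R \<alpha>)"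

text \<open>Absolute convergence on the closed polydisc with radii R. The quotients in
  \<open>gleason_division\<close> stay in this class with the same radii, so division can be
  repeated any number of times.\<close>

definition wiener :: "('n \<Rightarrow> real) \<Rightarrow> ('n list \<Rightarrow> complex) \<Rightarrow> bool" where
  "wiener R a \<longleftrightarrow> (\<lambda>\<alpha>. cmod (a \<alpha>) * rad_mono R \<alpha>) summable_on UNIV"

lemma rad_mono_simps [simp]:
  "rad_mono R [] = 1" "rad_mono R (i # \<alpha>) = R i * rad_mono R \<alpha>"
  "rad_mono R (\<alpha> @ \<beta>) = rad_mono R \<alpha> * rad_mono R \<beta>"
  by (simp_all add: rad_mono_def)

lemma rad_mono_nonneg: "(\<And>i. 0 \<le> R i) \<Longrightarrow> 0 \<le> rad_mono R \<alpha>"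
  by (induction \<alpha>) simp_all

lemma norm_word_mono_le:
  "(\<And>i. cmod (z $ i) \<le> R i) \<Longrightarrow> cmod (word_mono z \<alpha>) \<le> rad_mono R \<alpha>"
proof (induction \<alpha>)
  case (Cons i \<alpha>)
  have "cmod (z $ i) * cmod (word_mono z \<alpha>) \<le> R i * rad_mono R \<alpha>"
    by (intro mult_mono Cons) (use Cons.prems[of i] norm_ge_zero[of "z $ i"] in \<open>linarith, simp\<close>)
  then show ?case by (simp add: norm_mult)
qed simp

lemma norm_word_mono_scale_le:
  assumes "\<And>i. cmod (z $ i) \<le> q * R i" and q: "0 \<le> q" and R: "\<And>i. 0 \<le> R i"
  shows "cmod (word_mono z \<alpha>) \<le> q ^ length \<alpha> * rad_mono R \<alpha>"
proof (induction \<alpha>)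
  case (Cons i \<alpha>)
  have "cmod (z $ i) * cmod (word_mono z \<alpha>) \<le> (q * R i) * (q ^ length \<alpha> * rad_mono R \<alpha>)"
    by (rule mult_mono[OF assms(1) Cons]) (simp_all add: q R)
  then show ?case by (simp add: norm_mult mult_ac)
qed simp

lemma wiener_free_coeffs:
  assumes a: "free_coeffs a" and R: "\<And>i. 0 \<le> R i" and N: "norm (\<chi> i. complex_of_real (R i)) < 1"
  shows "wiener R a"
proof -
  have "cmod (word_mono (\<chi> i. complex_of_real (R i)) \<alpha>) = rad_mono R \<alpha>" for \<alpha>
    by (induction \<alpha>) (simp_all add: norm_mult R)
  then show ?thesis
    using abs_summable_word_series[OF a N] by (simp add: wiener_def norm_mult)
qed

lemma norm_term_le:
  assumes "\<And>i. cmod (z $ i) \<le> R i"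
  shows "cmod (a \<alpha> * word_mono z \<alpha>) \<le> cmod (a \<alpha>) * rad_mono R \<alpha>"
  unfolding norm_mult by (rule mult_left_mono[OF norm_word_mono_le[OF assms] norm_ge_zero])

lemma wiener_abs_summable:
  assumes a: "wiener R a" and z: "\<And>i. cmod (z $ i) \<le> R i"
  shows "(\<lambda>\<alpha>. cmod (a \<alpha> * word_mono z \<alpha>)) summable_on UNIV"
  by (rule Infinite_Sum.abs_summable_on_comparison_test'[OF a[unfolded wiener_def]]) (rule norm_term_le[OF z])

lemma norm_word_series_le:
  assumes a: "wiener R a" and z: "\<And>i. cmod (z $ i) \<le> R i"
  shows "cmod (word_series a z) \<le> (\<Sum>\<^sub>\<infinity>\<alpha>. cmod (a \<alpha>) * rad_mono R \<alpha>)"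
  unfolding word_series_def
proof (rule norm_infsum_le)
  show "((\<lambda>\<alpha>. a \<alpha> * word_mono z \<alpha>) has_sum (\<Sum>\<^sub>\<infinity>\<alpha>. a \<alpha> * word_mono z \<alpha>)) UNIV"
    by (rule has_sum_infsum[OF abs_summable_summable[OF wiener_abs_summable[OF a z]]])
  show "((\<lambda>\<alpha>. cmod (a \<alpha>) * rad_mono R \<alpha>) has_sum (\<Sum>\<^sub>\<infinity>\<alpha>. cmod (a \<alpha>) * rad_mono R \<alpha>)) UNIV"
    by (rule has_sum_infsum[OF a[unfolded wiener_def]])
qed (rule norm_term_le[OF z])

lemma wiener_add:
  assumes "wiener R a" "wiener R b" and R: "\<And>i. 0 \<le> R i"
  shows "wiener R (\<lambda>\<alpha>. a \<alpha> + b \<alpha>)"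
  unfolding wiener_def
proof (rule summable_on_comparison_test)
  show "(\<lambda>\<alpha>. cmod (a \<alpha>) * rad_mono R \<alpha> + cmod (b \<alpha>) * rad_mono R \<alpha>) summable_on UNIV"
    by (rule summable_on_add[OF assms(1,2)[unfolded wiener_def]])
  show "cmod (a \<alpha> + b \<alpha>) * rad_mono R \<alpha> \<le> cmod (a \<alpha>) * rad_mono R \<alpha> + cmod (b \<alpha>) * rad_mono R \<alpha>" for \<alpha>
    unfolding distrib_right[symmetric]
    by (rule mult_right_mono[OF norm_triangle_ineq]) (rule rad_mono_nonneg[of R, OF R])
  show "0 \<le> cmod (a \<alpha> + b \<alpha>) * rad_mono R \<alpha>" for \<alpha>
    using rad_mono_nonneg[of R, OF R] by simp
qed

lemma wiener_cmult: "wiener R a \<Longrightarrow> wiener R (\<lambda>\<alpha>. c * a \<alpha>)"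
  unfolding wiener_def
  using summable_on_cmult_right[of "\<lambda>\<alpha>. cmod (a \<alpha>) * rad_mono R \<alpha>" UNIV "cmod c"]
  by (simp add: norm_mult mult.assoc)

lemma word_series_add:
  assumes "wiener R a" "wiener R b" "\<And>i. cmod (z $ i) \<le> R i"
  shows "word_series (\<lambda>\<alpha>. a \<alpha> + b \<alpha>) z = word_series a z + word_series b z"
  unfolding word_series_def distrib_right
  by (rule infsum_add[OF abs_summable_summable abs_summable_summable])
    (rule wiener_abs_summable[OF assms(1,3)] wiener_abs_summable[OF assms(2,3)])+

lemma word_series_cmult:
  "word_series (\<lambda>\<alpha>. c * a \<alpha>) z = c * word_series a z"
  unfolding word_series_def mult.assoc by (rule infsum_cmult_right')

text \<open>The number of splittings of a word grows with its length; the weight q^|\<beta>| turns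
  the sum over splittings into part of a geometric series. A splitting is recovered from the whole
  word and the length of \<beta>, so the pairs embed into a product.\<close>

lemma split_dominant_summable:
  assumes a: "wiener R a" and R: "\<And>i. 0 \<le> R i" and q: "0 \<le> q" "q < 1"
  shows "(\<lambda>(\<alpha>, \<beta>). cmod (a (\<beta> @ \<alpha>)) * rad_mono R (\<beta> @ \<alpha>) * q ^ length \<beta>) summable_on UNIV"
proof -
  let ?c = "\<lambda>\<gamma>. cmod (a \<gamma>) * rad_mono R \<gamma>"
  let ?F = "\<lambda>p. ?c (fst p) * q ^ snd p"
  have c0: "0 \<le> ?c \<gamma>" for \<gamma> using rad_mono_nonneg[of R, OF R] by simp
  have "?F summable_on (UNIV \<times> UNIV)"
  proof (rule summable_on_SigmaI)
    fix \<gamma>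
    have "(\<lambda>l. ?c \<gamma> * q ^ l) sums (?c \<gamma> * (1 / (1 - q)))"
      using q by (intro sums_mult geometric_sums) simp
    then show "((\<lambda>l. ?F (\<gamma>, l)) has_sum (?c \<gamma> * (1 / (1 - q)))) UNIV"
      unfolding fst_conv snd_conv
      by (rule sums_nonneg_imp_has_sum) (use c0 q in simp)
  next
    show "(\<lambda>\<gamma>. ?c \<gamma> * (1 / (1 - q))) summable_on UNIV"
      by (rule summable_on_cmult_left[OF a[unfolded wiener_def]])
  qed (use c0 q in simp)
  then have "?F summable_on ((\<lambda>(\<alpha>, \<beta>). (\<beta> @ \<alpha>, length \<beta>)) ` UNIV)"
    by (rule summable_on_subset_banach) simp
  moreover have "inj (\<lambda>(\<alpha>::'a list, \<beta>). (\<beta> @ \<alpha>, length \<beta>))"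
    by (rule injI) auto
  ultimately have "?F \<circ> (\<lambda>(\<alpha>, \<beta>). (\<beta> @ \<alpha>, length \<beta>)) summable_on UNIV"
    by (simp only: summable_on_reindex)
  then show ?thesis by (simp only: o_def case_prod_unfold fst_conv snd_conv)
qed

text \<open>Telescoping on words: the family a(\<beta>\<alpha>) \<mu>_\<beta> w_\<alpha> over all
  pairs is summed in two ways. Detaching the first letter i of \<alpha> gives a factor w_i and
  leaves over the pairs with \<alpha> empty, whose sum is the series at \<mu>. Detaching the last
  letter i of \<beta> gives a factor \<mu>_i and leaves over the pairs with \<beta> empty, whose sum
  is the series at w. In both cases the remaining family is \<open>U w i\<close>, indexed by words
  \<beta> i \<alpha> with a marked letter.\<close>

lemma gleason_division:
  fixes R :: "'n::finite \<Rightarrow> real"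
  assumes a: "wiener R a" and R: "\<And>i. 0 < R i" and \<mu>: "\<And>i. cmod (\<mu> $ i) < R i"
  obtains g where "\<And>i. wiener R (g i)"
    and "\<And>w. (\<And>i. cmod (w $ i) \<le> R i) \<Longrightarrow>
      word_series a w - word_series a \<mu> = (\<Sum>i\<in>UNIV. (w $ i - \<mu> $ i) * word_series (g i) w)"
proof -
  have R0: "0 \<le> R i" for i using R[of i] by simp
  \<comment> \<open>The largest ratio |\<mu>_i| / R_i is below 1 since there are finitely many
    indices; it provides the geometric weight of \<open>split_dominant_summable\<close>.\<close>
  define q where "q = Max (range (\<lambda>i. cmod (\<mu> $ i) / R i))"
  have qle: "cmod (\<mu> $ i) / R i \<le> q" for i
    unfolding q_def by (rule Max_ge) auto
  have "q \<in> range (\<lambda>i. cmod (\<mu> $ i) / R i)"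
    unfolding q_def by (rule Max_in) auto
  then have q: "0 \<le> q" "q < 1" using R \<mu> R0 by auto
  have \<mu>q: "cmod (\<mu> $ i) \<le> q * R i" for i
    using qle[of i] R[of i] by (simp add: pos_divide_le_eq)
  define D where "D p = cmod (a (snd p @ fst p)) * rad_mono R (snd p @ fst p) * q ^ length (snd p)"
    for p :: "'n list \<times> 'n list"
  have D: "D summable_on UNIV"
    using split_dominant_summable[OF a R0 q] by (simp only: D_def[abs_def] case_prod_unfold)
  define T where "T w p = a (snd p @ fst p) * word_mono \<mu> (snd p) * word_mono w (fst p)"
    for w and p :: "'n list \<times> 'n list"
  define U where "U w i p = a (snd p @ i # fst p) * word_mono \<mu> (snd p) * word_mono w (fst p)"
    for w i and p :: "'n list \<times> 'n list"
  define g where "g i \<gamma> = (\<Sum>\<^sub>\<infinity>\<beta>. a (\<beta> @ i # \<gamma>) * word_mono \<mu> \<beta>)" for i \<gamma>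
  have Tle: "cmod (T w p) \<le> D p" if w: "\<And>i. cmod (w $ i) \<le> R i" for w p
  proof -
    have "cmod (word_mono \<mu> (snd p)) * cmod (word_mono w (fst p))
        \<le> (q ^ length (snd p) * rad_mono R (snd p)) * rad_mono R (fst p)"
      by (rule mult_mono[OF norm_word_mono_scale_le[OF \<mu>q q(1) R0] norm_word_mono_le[OF w]])
        (use q rad_mono_nonneg[of R, OF R0] in simp_all)
    then have "cmod (a (snd p @ fst p)) * (cmod (word_mono \<mu> (snd p)) * cmod (word_mono w (fst p)))
        \<le> cmod (a (snd p @ fst p)) * ((q ^ length (snd p) * rad_mono R (snd p)) * rad_mono R (fst p))"
      by (rule mult_left_mono) simp
    then show ?thesis by (simp add: T_def D_def norm_mult mult_ac)
  qed
  have Tsum: "T w summable_on A" if w: "\<And>i. cmod (w $ i) \<le> R i" for w A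
    by (rule summable_on_subset_banach[OF abs_summable_summable[OF
          Infinite_Sum.abs_summable_on_comparison_test'[OF D Tle[OF w]]] subset_UNIV])
  have inj1: "inj (\<lambda>p. (i # fst p, snd p))" for i :: 'n
    by (rule injI) (simp add: prod_eq_iff)
  have Usum: "(\<lambda>p. cmod (U w i p)) summable_on UNIV" if w: "\<And>i. cmod (w $ i) \<le> R i" for w i
  proof (rule Infinite_Sum.abs_summable_on_comparison_test')
    \<comment> \<open>\<open>U w i p\<close> is majorized by \<open>D\<close> at the pair with i
      prepended, up to the factor R i that this letter contributes to the weight.\<close>
    have "D summable_on range (\<lambda>p. (i # fst p, snd p))"
      by (rule summable_on_subset_banach[OF D subset_UNIV])
    then have "(D \<circ> (\<lambda>p. (i # fst p, snd p))) summable_on UNIV"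
      by (simp only: summable_on_reindex[OF inj1])
    then show "(\<lambda>p. D (i # fst p, snd p) * (1 / R i)) summable_on UNIV"
      unfolding o_def by (rule summable_on_cmult_left)
    fix p :: "'n list \<times> 'n list"
    have "cmod (word_mono \<mu> (snd p)) * cmod (word_mono w (fst p))
        \<le> (q ^ length (snd p) * rad_mono R (snd p)) * rad_mono R (fst p)"
      by (rule mult_mono[OF norm_word_mono_scale_le[OF \<mu>q q(1) R0] norm_word_mono_le[OF w]])
        (use q rad_mono_nonneg[of R, OF R0] in simp_all)
    then have "cmod (a (snd p @ i # fst p)) * (cmod (word_mono \<mu> (snd p)) * cmod (word_mono w (fst p)))
        \<le> cmod (a (snd p @ i # fst p)) * ((q ^ length (snd p) * rad_mono R (snd p)) * rad_mono R (fst p))"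
      by (rule mult_left_mono) simp
    then show "cmod (U w i p) \<le> D (i # fst p, snd p) * (1 / R i)"
      using R[of i] by (simp add: U_def D_def norm_mult mult_ac)
  qed
  have wg: "wiener R (g i)" for i
  proof -
    \<comment> \<open>At the point with coordinates R i the monomials equal the weights
      \<open>rad_mono R\<close>, so \<open>Usum\<close> at this point yields the summability
      required of \<open>g i\<close>.\<close>
    let ?r = "\<chi> i. complex_of_real (R i)"
    have r: "cmod (?r $ i) \<le> R i" for i using R0[of i] by simp
    have rm: "word_mono ?r \<gamma> = of_real (rad_mono R \<gamma>)" for \<gamma>
      by (induction \<gamma>) simp_all
    have "(\<lambda>\<gamma>. \<Sum>\<^sub>\<infinity>\<beta>. cmod (U ?r i (\<gamma>, \<beta>))) summable_on UNIV"
      using Usum[OF r, of i] Infinite_Sum.abs_summable_on_Sigma_iff[of "U ?r i" UNIV "\<lambda>_. UNIV"]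
      by (simp add: infsum_nonneg)
    moreover have "cmod (g i \<gamma>) * rad_mono R \<gamma> \<le> (\<Sum>\<^sub>\<infinity>\<beta>. cmod (U ?r i (\<gamma>, \<beta>)))" for \<gamma>
    proof -
      have "(\<lambda>\<beta>. cmod (U ?r i (\<gamma>, \<beta>))) summable_on UNIV"
        using Usum[OF r, of i] Infinite_Sum.abs_summable_on_Sigma_iff[of "U ?r i" UNIV "\<lambda>_. UNIV"] by simp
      then have "cmod (\<Sum>\<^sub>\<infinity>\<beta>. U ?r i (\<gamma>, \<beta>)) \<le> (\<Sum>\<^sub>\<infinity>\<beta>. cmod (U ?r i (\<gamma>, \<beta>)))"
        by (rule norm_infsum_bound)
      also have "(\<Sum>\<^sub>\<infinity>\<beta>. U ?r i (\<gamma>, \<beta>)) = g i \<gamma> * of_real (rad_mono R \<gamma>)"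
        unfolding U_def fst_conv snd_conv rm g_def by (rule infsum_cmult_left')
      finally show ?thesis
        using rad_mono_nonneg[of R, OF R0, of \<gamma>] by (simp add: norm_mult)
    qed
    ultimately show ?thesis
      unfolding wiener_def
      by (rule summable_on_comparison_test) (use rad_mono_nonneg[of R, OF R0] in simp)
  qed
  have main: "word_series a w - word_series a \<mu> = (\<Sum>i\<in>UNIV. (w $ i - \<mu> $ i) * word_series (g i) w)"
    if w: "\<And>i. cmod (w $ i) \<le> R i" for w
  proof -
    have ws: "word_series (g i) w = infsum (U w i) UNIV" for i
    proof -
      have "word_series (g i) w = (\<Sum>\<^sub>\<infinity>\<gamma>. \<Sum>\<^sub>\<infinity>\<beta>. U w i (\<gamma>, \<beta>))"
        unfolding word_series_def g_def U_def fst_conv snd_conv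
        by (rule infsum_cong) (rule infsum_cmult_left'[symmetric])
      also have "\<dots> = infsum (U w i) (UNIV \<times> UNIV)"
        by (rule infsum_Sigma_banach) (use abs_summable_summable[OF Usum[OF w, of i]] in simp)
      finally show ?thesis by simp
    qed
    note Ts = Tsum[OF w]
    let ?H1 = "\<lambda>x :: 'n \<times> 'n list \<times> 'n list. (fst x # fst (snd x), snd (snd x))"
    let ?H2 = "\<lambda>x :: 'n \<times> 'n list \<times> 'n list. (fst (snd x), snd (snd x) @ [fst x])"
    have shift: "infsum (T w) (range H) = (\<Sum>i\<in>UNIV. c i * infsum (U w i) UNIV)"
      if H: "inj H" and TH: "\<And>i p. T w (H (i, p)) = c i * U w i p"
      for H :: "'n \<times> 'n list \<times> 'n list \<Rightarrow> 'n list \<times> 'n list" and c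
    proof -
      have "infsum (T w) (range H) = infsum (T w \<circ> H) (UNIV \<times> UNIV)"
        using infsum_reindex[OF H] by simp
      also have "\<dots> = (\<Sum>\<^sub>\<infinity>i. \<Sum>\<^sub>\<infinity>p. (T w \<circ> H) (i, p))"
        by (rule infsum_Sigma_banach[symmetric])
          (use Ts[of "range H"] summable_on_reindex[OF H, of "T w"] in simp)
      also have "\<dots> = (\<Sum>i\<in>UNIV. \<Sum>\<^sub>\<infinity>p. (T w \<circ> H) (i, p))"
        by (rule infsum_finite) simp
      also have "\<dots> = (\<Sum>i\<in>UNIV. c i * infsum (U w i) UNIV)"
        unfolding o_def TH by (rule sum.cong[OF refl]) (rule infsum_cmult_right')
      finally show ?thesis .
    qed
    have "inj ?H1" by (rule injI) (simp add: prod_eq_iff)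
    from shift[OF this, of "\<lambda>i. w $ i"]
    have S1: "infsum (T w) (range ?H1) = (\<Sum>i\<in>UNIV. w $ i * infsum (U w i) UNIV)"
      by (simp add: T_def U_def mult_ac)
    have "inj ?H2" by (rule injI) (simp add: prod_eq_iff)
    from shift[OF this, of "\<lambda>i. \<mu> $ i"]
    have S2: "infsum (T w) (range ?H2) = (\<Sum>i\<in>UNIV. \<mu> $ i * infsum (U w i) UNIV)"
      by (simp add: T_def U_def mult_ac)
    have u1: "(UNIV :: ('n list \<times> 'n list) set) = range ?H1 \<union> range (Pair [])"
      by (auto simp: image_iff neq_Nil_conv)
    have u2: "(UNIV :: ('n list \<times> 'n list) set) = range ?H2 \<union> range (\<lambda>\<alpha>. (\<alpha>, []))"
      by (auto simp: image_iff) (metis rev_exhaust)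
    have "infsum (T w) UNIV = infsum (T w) (range ?H1) + infsum (T w) (range (Pair []))"
      by (subst u1) (rule infsum_Un_disjoint[OF Ts Ts], auto)
    moreover have "infsum (T w) (range (Pair [])) = word_series a \<mu>"
      by (subst infsum_reindex) (simp_all add: inj_on_def o_def T_def word_series_def)
    moreover have "infsum (T w) UNIV = infsum (T w) (range ?H2) + infsum (T w) (range (\<lambda>\<alpha>. (\<alpha>, [])))"
      by (subst u2) (rule infsum_Un_disjoint[OF Ts Ts], auto)
    moreover have "infsum (T w) (range (\<lambda>\<alpha>. (\<alpha>, []))) = word_series a w"
      by (subst infsum_reindex) (simp_all add: inj_on_def o_def T_def word_series_def)
    ultimately have "word_series a w - word_series a \<mu>
        = (\<Sum>i\<in>UNIV. w $ i * infsum (U w i) UNIV) - (\<Sum>i\<in>UNIV. \<mu> $ i * infsum (U w i) UNIV)"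
      unfolding S1 S2 by (simp add: algebra_simps)
    then show ?thesis
      by (simp add: ws left_diff_distrib sum_subtractf)
  qed
  show thesis by (rule that[OF wg main])
qed

section \<open>Composition operators of finite codimension\<close>

lemma sum_swap_factor:
  fixes t :: "'k \<Rightarrow> 'c::comm_semiring_0"
  shows "(\<Sum>\<beta>\<in>K. t \<beta> * (\<Sum>\<alpha>\<in>E. c \<beta> \<alpha> * x \<alpha>)) = (\<Sum>\<alpha>\<in>E. (\<Sum>\<beta>\<in>K. t \<beta> * c \<beta> \<alpha>) * x \<alpha>)"
  unfolding sum_distrib_left sum_distrib_right by (subst sum.swap) (simp only: mult.assoc)

text \<open>Gaussian elimination for a homogeneous system with more unknowns than equations:
  equation j is solved for the unknown m, and the others are reduced accordingly. In the
  applications K indexes test functions and J the coordinates to be cancelled.\<close>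

lemma linear_dependence:
  fixes c :: "'k \<Rightarrow> 'j \<Rightarrow> 'f::field"
  assumes "finite J" "finite K" "card J < card K"
  shows "\<exists>t. (\<exists>k\<in>K. t k \<noteq> 0) \<and> (\<forall>j\<in>J. (\<Sum>k\<in>K. t k * c k j) = 0)"
  using assms
proof (induction J arbitrary: K c rule: finite_induct)
  case empty
  then have "K \<noteq> {}" by auto
  then show ?case by (intro exI[of _ "\<lambda>_. 1"]) auto
next
  case (insert j J)
  show ?case
  proof (cases "\<forall>k\<in>K. c k j = 0")
    case True
    have "card J < card K" using insert by simp
    from insert.IH[OF insert.prems(1) this, of c] obtain t where
      "\<exists>k\<in>K. t k \<noteq> 0" "\<forall>j\<in>J. (\<Sum>k\<in>K. t k * c k j) = 0" by blast
    with True show ?thesis by (intro exI[of _ t]) auto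
  next
    case False
    then obtain m where m: "m \<in> K" "c m j \<noteq> 0" by blast
    define K' where "K' = K - {m}"
    have K': "finite K'" "card J < card K'" "K = insert m K'" "m \<notin> K'"
      using insert m by (auto simp: K'_def)
    from insert.IH[OF K'(1,2), of "\<lambda>k i. c k i - c k j / c m j * c m i"] obtain t where
      t: "\<exists>k\<in>K'. t k \<noteq> 0" "\<And>i. i \<in> J \<Longrightarrow> (\<Sum>k\<in>K'. t k * (c k i - c k j / c m j * c m i)) = 0" by blast
    define s where "s = - (\<Sum>k\<in>K'. t k * c k j) / c m j"
    define t' where "t' = t(m := s)"
    have split: "(\<Sum>k\<in>K. t' k * c k i) = s * c m i + (\<Sum>k\<in>K'. t k * c k i)" for i
    proof -
      have "(\<Sum>k\<in>K'. t' k * c k i) = (\<Sum>k\<in>K'. t k * c k i)"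
        using K'(4) by (intro sum.cong) (auto simp: t'_def)
      then show ?thesis using K'(1,4) by (simp add: K'(3) t'_def)
    qed
    have "(\<Sum>k\<in>K. t' k * c k i) = 0" if "i \<in> insert j J" for i
    proof (cases "i = j")
      case True
      then show ?thesis unfolding split using m(2) by (simp add: s_def)
    next
      case False
      then have "(\<Sum>k\<in>K'. t k * (c k i - c k j / c m j * c m i)) = 0" using that t(2) by simp
      moreover have "(\<Sum>k\<in>K'. t k * (c k i - c k j / c m j * c m i))
          = (\<Sum>k\<in>K'. t k * c k i) - (\<Sum>k\<in>K'. t k * c k j) / c m j * c m i"
        by (simp add: right_diff_distrib sum_subtractf sum_divide_distrib sum_distrib_right mult.assoc)
      ultimately show ?thesis unfolding split by (simp add: s_def)
    qed
    moreover have "\<exists>k\<in>K. t' k \<noteq> 0" using t(1) K'(3,4) by (auto simp: t'_def)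
    ultimately show ?thesis by blast
  qed
qed

section \<open>Scalar functions of the Hardy space\<close>

text \<open>This is the Drury-Arveson space. Letters commute at scalar arguments, so the
  coefficients over words are not unique and only their existence is demanded; values outside the
  ball are free.\<close>

definition H2_fun :: "(complex ^ 'n::finite \<Rightarrow> complex) \<Rightarrow> bool" where
  "H2_fun g \<longleftrightarrow> (\<exists>a. square_summable a \<and> (\<forall>z. norm z < 1 \<longrightarrow> g z = word_series a z))"

lemma word_series_summable:
  "square_summable a \<Longrightarrow> norm z < 1 \<Longrightarrow> (\<lambda>\<alpha>. a \<alpha> * word_mono z \<alpha>) summable_on UNIV"
  by (rule abs_summable_summable[OF abs_summable_word_series[OF free_coeffs_square_summable]])

lemma H2_fun_add:
  assumes "H2_fun g" "H2_fun h"
  shows "H2_fun (\<lambda>z. g z + h z)"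
proof -
  obtain a b where a: "square_summable a" "\<And>z. norm z < 1 \<Longrightarrow> g z = word_series a z"
    and b: "square_summable b" "\<And>z. norm z < 1 \<Longrightarrow> h z = word_series b z"
    using assms unfolding H2_fun_def by blast
  have "square_summable (\<lambda>\<alpha>. a \<alpha> + b \<alpha>)"
  proof (rule summable_on_comparison_test)
    show "(\<lambda>\<alpha>. 2 * (cmod (a \<alpha>))\<^sup>2 + 2 * (cmod (b \<alpha>))\<^sup>2) summable_on UNIV"
      by (rule summable_on_add[OF summable_on_cmult_right[OF a(1)] summable_on_cmult_right[OF b(1)]])
    show "(cmod (a \<alpha> + b \<alpha>))\<^sup>2 \<le> 2 * (cmod (a \<alpha>))\<^sup>2 + 2 * (cmod (b \<alpha>))\<^sup>2" for \<alpha>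
    proof -
      have "(cmod (a \<alpha> + b \<alpha>))\<^sup>2 \<le> (cmod (a \<alpha>) + cmod (b \<alpha>))\<^sup>2"
        by (rule power_mono[OF norm_triangle_ineq norm_ge_zero])
      also have "\<dots> \<le> 2 * (cmod (a \<alpha>))\<^sup>2 + 2 * (cmod (b \<alpha>))\<^sup>2"
        using zero_le_power2[of "cmod (a \<alpha>) - cmod (b \<alpha>)"] by (simp add: power2_sum power2_diff)
      finally show ?thesis .
    qed
  qed simp
  moreover have "g z + h z = word_series (\<lambda>\<alpha>. a \<alpha> + b \<alpha>) z" if z: "norm z < 1" for z
    unfolding a(2)[OF z] b(2)[OF z] word_series_def distrib_right
    by (rule infsum_add[symmetric]) (rule word_series_summable[OF a(1) z] word_series_summable[OF b(1) z])+
  ultimately show ?thesis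
    unfolding H2_fun_def by (intro exI[of _ "\<lambda>\<alpha>. a \<alpha> + b \<alpha>"] conjI allI impI)
qed

lemma H2_fun_cmult:
  assumes "H2_fun g"
  shows "H2_fun (\<lambda>z. c * g z)"
proof -
  obtain a where a: "square_summable a" "\<And>z. norm z < 1 \<Longrightarrow> g z = word_series a z"
    using assms unfolding H2_fun_def by blast
  have "square_summable (\<lambda>\<alpha>. c * a \<alpha>)"
    using summable_on_cmult_right[OF a(1), of "(cmod c)\<^sup>2"] by (simp add: norm_mult power_mult_distrib)
  then show ?thesis unfolding H2_fun_def using a(2) word_series_cmult[of c a] by force
qed

lemma H2_fun_one: "H2_fun (\<lambda>_. 1)"
proof -
  let ?a = "\<lambda>\<alpha>::'a list. if \<alpha> = [] then 1 else 0 :: complex"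
  have "(\<lambda>\<alpha>. (cmod (?a \<alpha>))\<^sup>2) summable_on {[]}" by (rule summable_on_finite) simp
  then have "square_summable ?a"
    by (rule summable_on_cong_neutral[THEN iffD1, rotated 3]) auto
  moreover have "word_series ?a z = 1" for z
  proof -
    have "word_series ?a z = (\<Sum>\<^sub>\<infinity>\<alpha>\<in>{[]}. ?a \<alpha> * word_mono z \<alpha>)"
      unfolding word_series_def by (rule infsum_cong_neutral) auto
    then show ?thesis by simp
  qed
  ultimately show ?thesis unfolding H2_fun_def by metis
qed

text \<open>Prepending the letter i is an isometric shift of the coefficients: the left creation
  operator of the Fock space.\<close>

lemma H2_fun_coordinate_mult:
  assumes "H2_fun g"
  shows "H2_fun (\<lambda>z. z $ i * g z)"
proof -
  obtain a where a: "square_summable a" "\<And>z. norm z < 1 \<Longrightarrow> g z = word_series a z"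
    using assms unfolding H2_fun_def by blast
  define a' where "a' \<alpha> = (case \<alpha> of [] \<Rightarrow> 0 | j # \<gamma> \<Rightarrow> if j = i then a \<gamma> else 0)" for \<alpha>
  have a'0: "a' \<alpha> = 0" if "\<alpha> \<notin> range (Cons i)" for \<alpha>
    using that by (auto simp: a'_def split: list.splits)
  have a'i: "a' (i # \<gamma>) = a \<gamma>" for \<gamma> by (simp add: a'_def)
  have inj: "inj (Cons i)" by (simp add: inj_on_def)
  have "(\<lambda>\<alpha>. (cmod (a' \<alpha>))\<^sup>2) summable_on range (Cons i)"
    unfolding summable_on_reindex[OF inj] o_def a'i by (rule a(1))
  then have "square_summable a'"
    by (rule summable_on_cong_neutral[THEN iffD1, rotated 3]) (auto simp: a'0)
  moreover have "z $ i * word_series a z = word_series a' z" for z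
  proof -
    have "word_series a' z = (\<Sum>\<^sub>\<infinity>\<alpha>\<in>range (Cons i). a' \<alpha> * word_mono z \<alpha>)"
      unfolding word_series_def by (rule infsum_cong_neutral) (auto simp: a'0)
    also have "\<dots> = (\<Sum>\<^sub>\<infinity>\<gamma>. z $ i * (a \<gamma> * word_mono z \<gamma>))"
      unfolding infsum_reindex[OF inj] o_def a'i by (simp add: mult_ac)
    also have "\<dots> = z $ i * word_series a z"
      unfolding word_series_def by (rule infsum_cmult_right')
    finally show ?thesis by simp
  qed
  ultimately show ?thesis unfolding H2_fun_def using a(2) by metis
qed

lemma H2_fun_const: "H2_fun (\<lambda>_. c)"
  using H2_fun_cmult[OF H2_fun_one, of c] by simp

lemma H2_fun_sum: "(\<And>k. k \<in> K \<Longrightarrow> H2_fun (g k)) \<Longrightarrow> H2_fun (\<lambda>z. \<Sum>k\<in>K. g k z)"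
  by (induction K rule: infinite_finite_induct) (auto intro: H2_fun_const[of 0] H2_fun_add)

text \<open>What is kept of the operator: a scalar map with power series components and a
  decomposition modulo d functions \<open>b\<close>, about which nothing else is recorded.\<close>

locale finite_codimension_composition =
  fixes F :: "complex ^ 'n::finite \<Rightarrow> complex ^ 'n" and A :: "'n \<Rightarrow> 'n list \<Rightarrow> complex"
    and d :: nat and b :: "nat \<Rightarrow> complex ^ 'n \<Rightarrow> complex"
  assumes free_coeffs_A: "free_coeffs (A i)"
    and F_eq: "norm z < 1 \<Longrightarrow> F z = (\<chi> i. word_series (A i) z)"
    and F_ball: "norm z < 1 \<Longrightarrow> norm (F z) < 1"
    and codim: "square_summable a \<Longrightarrow> \<exists>a' c. square_summable a' \<and>
      (\<forall>z. norm z < 1 \<longrightarrow> word_series a z = word_series a' (F z) + (\<Sum>j<d. c j * b j z))"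
begin

lemma H2_fun_decompose:
  assumes "H2_fun g"
  shows "\<exists>a c. square_summable a \<and> (\<forall>z. norm z < 1 \<longrightarrow> g z = word_series a (F z) + (\<Sum>j<d. c j * b j z))"
  using assms codim unfolding H2_fun_def by metis

text \<open>Each \<open>g k\<close> has d coefficients against \<open>b\<close>, so more than d of
  them admit a nontrivial relation that cancels all terms in \<open>b\<close>. The combination may
  still be the zero function; a contradiction has to come from the choice of the test
  functions.\<close>

lemma combination_in_range:
  assumes K: "finite K" "d < card K" and g: "\<And>k. k \<in> K \<Longrightarrow> H2_fun (g k)"
  shows "\<exists>t a. (\<exists>k\<in>K. t k \<noteq> 0) \<and> square_summable a \<and>
    (\<forall>z. norm z < 1 \<longrightarrow> (\<Sum>k\<in>K. t k * g k z) = word_series a (F z))"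
proof -
  have "\<forall>k\<in>K. \<exists>a c. square_summable a \<and>
      (\<forall>z. norm z < 1 \<longrightarrow> g k z = word_series a (F z) + (\<Sum>j<d. c j * b j z))"
    using H2_fun_decompose[OF g] by blast
  from bchoice[OF this] obtain a where "\<forall>k\<in>K. \<exists>c. square_summable (a k) \<and>
      (\<forall>z. norm z < 1 \<longrightarrow> g k z = word_series (a k) (F z) + (\<Sum>j<d. c j * b j z))" ..
  from bchoice[OF this] obtain c where ac: "\<forall>k\<in>K. square_summable (a k) \<and>
      (\<forall>z. norm z < 1 \<longrightarrow> g k z = word_series (a k) (F z) + (\<Sum>j<d. c k j * b j z))" ..
  have a: "square_summable (a k)" if "k \<in> K" for k
    using ac that by blast
  have c: "g k z = word_series (a k) (F z) + (\<Sum>j<d. c k j * b j z)" if "k \<in> K" "norm z < 1" for k z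
    using ac that by blast
  obtain t where t: "\<exists>k\<in>K. t k \<noteq> 0" "\<And>j. j < d \<Longrightarrow> (\<Sum>k\<in>K. t k * c k j) = 0"
    using linear_dependence[of "{..<d}" K c] K by auto
  have "H2_fun (word_series (a k))" if "k \<in> K" for k
    using a[OF that] unfolding H2_fun_def by blast
  then have "H2_fun (\<lambda>z. \<Sum>k\<in>K. t k * word_series (a k) z)"
    by (intro H2_fun_sum H2_fun_cmult)
  then obtain a' where a': "square_summable a'"
    "\<And>z. norm z < 1 \<Longrightarrow> (\<Sum>k\<in>K. t k * word_series (a k) z) = word_series a' z"
    unfolding H2_fun_def by blast
  have "(\<Sum>k\<in>K. t k * g k z) = word_series a' (F z)" if z: "norm z < 1" for z
  proof -
    have "(\<Sum>k\<in>K. t k * g k z) = (\<Sum>k\<in>K. t k * word_series (a k) (F z)) + (\<Sum>k\<in>K. t k * (\<Sum>j<d. c k j * b j z))"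
        unfolding sum.distrib[symmetric] distrib_left[symmetric]
      by (rule sum.cong[OF refl]) (simp only: c[OF _ z])
    also have "(\<Sum>k\<in>K. t k * (\<Sum>j<d. c k j * b j z)) = (\<Sum>j<d. (\<Sum>k\<in>K. t k * c k j) * b j z)"
      by (rule sum_swap_factor)
    also have "\<dots> = 0" by (simp add: t(2))
    finally show ?thesis using a'(2)[OF F_ball[OF z]] by simp
  qed
  with t(1) a'(1) show ?thesis by (intro exI[of _ t] exI[of _ a'] conjI allI impI)
qed

end

section \<open>Local expansions of power series\<close>

lemma polyradius_exists:
  fixes \<mu> :: "complex ^ 'n::finite"
  assumes "norm \<mu> < 1"
  shows "\<exists>R. (\<forall>i. 0 < R i \<and> cmod (\<mu> $ i) < R i) \<and> norm (\<chi> i. complex_of_real (R i)) < 1"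
proof -
  \<comment> \<open>The vector with all coordinates e has norm at most n e, and the denominator n +
    1 keeps this strictly below 1 - |\<mu>|.\<close>
  define e where "e = (1 - norm \<mu>) / (real CARD('n) + 1)"
  have e: "0 < e" using assms by (simp add: e_def)
  have "norm ((\<chi> i. complex_of_real e) :: complex ^ 'n) \<le> (\<Sum>i\<in>(UNIV::'n set). cmod (complex_of_real e))"
    using L2_set_le_sum[of UNIV "\<lambda>i::'n. cmod (complex_of_real e)"] by (simp add: norm_vec_def)
  also have "\<dots> = real CARD('n) * e" using e by simp
  also have "\<dots> < (real CARD('n) + 1) * e" using e by simp
  also have "\<dots> = 1 - norm \<mu>" by (simp add: e_def)
  finally have 1: "norm ((\<chi> i. complex_of_real e) :: complex ^ 'n) < 1 - norm \<mu>" .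
  have 2: "norm ((\<chi> i. complex_of_real (cmod (\<mu> $ i))) :: complex ^ 'n) = norm \<mu>"
    by (simp add: norm_vec_def)
  have "norm ((\<chi> i. complex_of_real (cmod (\<mu> $ i) + e)) :: complex ^ 'n)
      = norm ((\<chi> i. complex_of_real (cmod (\<mu> $ i))) + ((\<chi> i. complex_of_real e) :: complex ^ 'n))"
    by (rule arg_cong[of _ _ norm]) (simp add: vec_eq_iff)
  also have "\<dots> \<le> norm \<mu> + norm ((\<chi> i. complex_of_real e) :: complex ^ 'n)"
    using norm_triangle_ineq[of "\<chi> i. complex_of_real (cmod (\<mu> $ i))" "(\<chi> i. complex_of_real e) :: complex ^ 'n"]
    unfolding 2 .
  also have "\<dots> < 1" using 1 by simp
  finally show ?thesis
    using e by (intro exI[of _ "\<lambda>i. cmod (\<mu> $ i) + e"]) (simp add: add_nonneg_pos)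
qed

lemma eventually_in_polydisc:
  fixes \<mu> :: "complex ^ 'n::finite"
  assumes "\<And>i. cmod (\<mu> $ i) < R i"
  shows "eventually (\<lambda>w. \<forall>i. cmod (w $ i) \<le> R i) (nhds \<mu>)"
proof -
  have "eventually (\<lambda>w. cmod (w $ i) < R i) (nhds \<mu>)" for i
    by (rule order_tendstoD(2)[OF _ assms]) (intro tendsto_intros filterlim_ident)
  then have "eventually (\<lambda>w. \<forall>i. cmod (w $ i) < R i) (nhds \<mu>)"
    by (rule eventually_all_finite)
  then show ?thesis by (rule eventually_mono) (auto intro: less_imp_le)
qed

lemma word_series_lipschitz:
  fixes R :: "'n::finite \<Rightarrow> real"
  assumes a: "wiener R a" and R: "\<And>i. 0 < R i" and \<mu>: "\<And>i. cmod (\<mu> $ i) < R i"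
  shows "\<exists>C\<ge>0. \<forall>w. (\<forall>i. cmod (w $ i) \<le> R i) \<longrightarrow>
    cmod (word_series a w - word_series a \<mu>) \<le> C * norm (w - \<mu>)"
proof -
  from gleason_division[of R a \<mu>, OF a R \<mu>] obtain g where g: "\<And>i. wiener R (g i)"
    and eq: "\<And>w. (\<And>i. cmod (w $ i) \<le> R i) \<Longrightarrow>
      word_series a w - word_series a \<mu> = (\<Sum>i\<in>UNIV. (w $ i - \<mu> $ i) * word_series (g i) w)" by blast
  define B where "B i = (\<Sum>\<^sub>\<infinity>\<alpha>. cmod (g i \<alpha>) * rad_mono R \<alpha>)" for i
  have B0: "0 \<le> B i" for i
    unfolding B_def using rad_mono_nonneg[of R] R by (intro infsum_nonneg) (simp add: less_imp_le)
  show ?thesis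
  proof (intro exI conjI allI impI)
    show "0 \<le> sum B UNIV" by (rule sum_nonneg) (rule B0)
    fix w assume "\<forall>i. cmod (w $ i) \<le> R i"
    then have w: "cmod (w $ i) \<le> R i" for i by blast
    have "cmod (word_series a w - word_series a \<mu>)
        \<le> (\<Sum>i\<in>UNIV. cmod ((w $ i - \<mu> $ i) * word_series (g i) w))"
      unfolding eq[OF w] by (rule norm_sum)
    also have "\<dots> \<le> (\<Sum>i\<in>UNIV. norm (w - \<mu>) * B i)"
      unfolding norm_mult B_def
      by (intro sum_mono mult_mono norm_word_series_le[OF g w])
        (use Finite_Cartesian_Product.norm_nth_le[where x = "w - \<mu>"] in simp_all)
    also have "\<dots> = sum B UNIV * norm (w - \<mu>)"
      by (simp add: sum_distrib_left[symmetric] mult.commute[of "norm _"] flip: sum_distrib_right)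
    finally show "cmod (word_series a w - word_series a \<mu>) \<le> sum B UNIV * norm (w - \<mu>)" .
  qed
qed

text \<open>Two divisions in place of Taylor's theorem: the linear coefficients are the values of
  the quotients at \<mu>, and the Lipschitz bound for the quotients makes the remainder
  quadratic.\<close>

lemma word_series_second_order:
  fixes R :: "'n::finite \<Rightarrow> real"
  assumes a: "wiener R a" and R: "\<And>i. 0 < R i" and \<mu>: "\<And>i. cmod (\<mu> $ i) < R i"
  shows "\<exists>c C. 0 \<le> C \<and> (\<forall>w. (\<forall>i. cmod (w $ i) \<le> R i) \<longrightarrow>
    cmod (word_series a w - word_series a \<mu> - (\<Sum>i\<in>UNIV. c i * (w $ i - \<mu> $ i))) \<le> C * (norm (w - \<mu>))\<^sup>2)"
proof -
  from gleason_division[of R a \<mu>, OF a R \<mu>] obtain g where g: "\<And>i. wiener R (g i)"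
    and eq: "\<And>w. (\<And>i. cmod (w $ i) \<le> R i) \<Longrightarrow>
      word_series a w - word_series a \<mu> = (\<Sum>i\<in>UNIV. (w $ i - \<mu> $ i) * word_series (g i) w)" by blast
  have "\<exists>C\<ge>0. \<forall>w. (\<forall>i. cmod (w $ i) \<le> R i) \<longrightarrow>
      cmod (word_series (g i) w - word_series (g i) \<mu>) \<le> C * norm (w - \<mu>)" for i
    by (rule word_series_lipschitz[of R "g i" \<mu>, OF g R \<mu>])
  then have "\<forall>i. \<exists>C. 0 \<le> C \<and> (\<forall>w. (\<forall>i. cmod (w $ i) \<le> R i) \<longrightarrow>
      cmod (word_series (g i) w - word_series (g i) \<mu>) \<le> C * norm (w - \<mu>))" by blast
  from choice[OF this] obtain B where BB: "\<forall>i. 0 \<le> B i \<and> (\<forall>w. (\<forall>i. cmod (w $ i) \<le> R i) \<longrightarrow>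
      cmod (word_series (g i) w - word_series (g i) \<mu>) \<le> B i * norm (w - \<mu>))" ..
  then have B0: "0 \<le> B i" for i by blast
  have B: "cmod (word_series (g i) w - word_series (g i) \<mu>) \<le> B i * norm (w - \<mu>)"
    if "\<And>i. cmod (w $ i) \<le> R i" for i w using BB that by blast
  show ?thesis
  proof (intro exI conjI allI impI)
    show "0 \<le> sum B UNIV" by (rule sum_nonneg) (rule B0)
    fix w assume "\<forall>i. cmod (w $ i) \<le> R i"
    then have w: "cmod (w $ i) \<le> R i" for i by blast
    have "word_series a w - word_series a \<mu> - (\<Sum>i\<in>UNIV. word_series (g i) \<mu> * (w $ i - \<mu> $ i))
        = (\<Sum>i\<in>UNIV. (w $ i - \<mu> $ i) * (word_series (g i) w - word_series (g i) \<mu>))"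
      unfolding eq[OF w] sum_subtractf[symmetric] by (simp add: algebra_simps)
    also have "cmod \<dots> \<le> (\<Sum>i\<in>UNIV. cmod ((w $ i - \<mu> $ i) * (word_series (g i) w - word_series (g i) \<mu>)))"
      by (rule norm_sum)
    also have "\<dots> \<le> (\<Sum>i\<in>UNIV. norm (w - \<mu>) * (B i * norm (w - \<mu>)))"
      unfolding norm_mult
      by (intro sum_mono mult_mono B w) (use Finite_Cartesian_Product.norm_nth_le[where x = "w - \<mu>"] in simp_all)
    also have "\<dots> = sum B UNIV * (norm (w - \<mu>))\<^sup>2"
      by (simp add: sum_distrib_left[symmetric] sum_distrib_right[symmetric] power2_eq_square mult_ac)
    finally show "cmod (word_series a w - word_series a \<mu> - (\<Sum>i\<in>UNIV. word_series (g i) \<mu> * (w $ i - \<mu> $ i)))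
      \<le> sum B UNIV * (norm (w - \<mu>))\<^sup>2" .
  qed
qed

context finite_codimension_composition
begin

lemma F_second_order:
  assumes a: "norm a < 1"
  obtains M :: "complex ^ 'n ^ 'n" and C where "0 \<le> C"
    "eventually (\<lambda>z. norm (F z - F a - M *v (z - a)) \<le> C * (norm (z - a))\<^sup>2) (nhds a)"
proof -
  obtain R where "\<forall>i. 0 < R i \<and> cmod (a $ i) < R i" and R3: "norm (\<chi> i. complex_of_real (R i)) < 1"
    using polyradius_exists[OF a] by blast
  then have R: "0 < R i" "cmod (a $ i) < R i" for i by simp_all
  have wA: "wiener R (A i)" for i
    by (rule wiener_free_coeffs[OF free_coeffs_A less_imp_le[OF R(1)] R3])
  define Q where "Q i c C \<longleftrightarrow> 0 \<le> C \<and> (\<forall>w. (\<forall>j. cmod (w $ j) \<le> R j) \<longrightarrow>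
      cmod (word_series (A i) w - word_series (A i) a - (\<Sum>j\<in>UNIV. c j * (w $ j - a $ j))) \<le> C * (norm (w - a))\<^sup>2)"
    for i and c :: "'n \<Rightarrow> complex" and C
  have "\<exists>c C. Q i c C" for i
    unfolding Q_def by (rule word_series_second_order[of R "A i" a, OF wA R])
  then obtain c C where Q: "\<And>i. Q i (c i) (C i)" by metis
  have C0: "0 \<le> C i" for i using Q unfolding Q_def by blast
  have C: "cmod (word_series (A i) w - word_series (A i) a - (\<Sum>j\<in>UNIV. c i j * (w $ j - a $ j))) \<le> C i * (norm (w - a))\<^sup>2"
    if "\<forall>j. cmod (w $ j) \<le> R j" for i w
    using Q[of i] that unfolding Q_def by blast
  have a': "a \<in> ball 0 1" using a by simp
  define M where "M = (\<chi> i j. c i j)"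
  have "eventually (\<lambda>z. norm (F z - F a - M *v (z - a)) \<le> sum C UNIV * (norm (z - a))\<^sup>2) (nhds a)"
    using eventually_in_polydisc[of a R, OF R(2)] eventually_nhds_in_open[OF open_ball a']
  proof eventually_elim
    case (elim z)
    have z: "norm z < 1" using elim(2) by simp
    have "norm (F z - F a - M *v (z - a)) \<le> (\<Sum>i\<in>UNIV. cmod ((F z - F a - M *v (z - a)) $ i))"
      using L2_set_le_sum[of UNIV "\<lambda>i. cmod ((F z - F a - M *v (z - a)) $ i)"] by (simp add: norm_vec_def)
    also have "\<dots> \<le> (\<Sum>i\<in>UNIV. C i * (norm (z - a))\<^sup>2)"
      using C[OF elim(1)] by (intro sum_mono) (simp add: F_eq[OF z] F_eq[OF a] matrix_vector_mult_def M_def)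
    also have "\<dots> = sum C UNIV * (norm (z - a))\<^sup>2" by (simp add: sum_distrib_right)
    finally show ?case .
  qed
  moreover have "0 \<le> sum C UNIV" by (rule sum_nonneg) (rule C0)
  ultimately show thesis using that by blast
qed

end

section \<open>Jets and the Jacobian\<close>

text \<open>A growth bound instead of Taylor coefficients, meaningful for functions without known
  smoothness such as those involving \<open>b\<close>.\<close>

definition vanishes :: "complex ^ 'n::finite \<Rightarrow> nat \<Rightarrow> (complex ^ 'n \<Rightarrow> complex) \<Rightarrow> bool" where
  "vanishes a m g \<longleftrightarrow> (\<exists>C\<ge>0. eventually (\<lambda>z. cmod (g z) \<le> C * norm (z - a) ^ m) (nhds a))"

lemma vanishes_add:
  assumes "vanishes a m g" "vanishes a m h"
  shows "vanishes a m (\<lambda>z. g z + h z)"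
proof -
  obtain C D where C: "0 \<le> C" "eventually (\<lambda>z. cmod (g z) \<le> C * norm (z - a) ^ m) (nhds a)"
    and D: "0 \<le> D" "eventually (\<lambda>z. cmod (h z) \<le> D * norm (z - a) ^ m) (nhds a)"
    using assms unfolding vanishes_def by blast
  have "eventually (\<lambda>z. cmod (g z + h z) \<le> (C + D) * norm (z - a) ^ m) (nhds a)"
    using C(2) D(2)
  proof eventually_elim
    case (elim z)
    have "cmod (g z + h z) \<le> cmod (g z) + cmod (h z)" by (rule norm_triangle_ineq)
    then show ?case using elim by (simp add: distrib_right)
  qed
  then show ?thesis
    unfolding vanishes_def using C(1) D(1) by (intro exI[of _ "C + D"]) simp
qed

lemma vanishes_mult:
  assumes "vanishes a k g" "vanishes a l h"
  shows "vanishes a (k + l) (\<lambda>z. g z * h z)"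
proof -
  obtain C D where C: "0 \<le> C" "eventually (\<lambda>z. cmod (g z) \<le> C * norm (z - a) ^ k) (nhds a)"
    and D: "0 \<le> D" "eventually (\<lambda>z. cmod (h z) \<le> D * norm (z - a) ^ l) (nhds a)"
    using assms unfolding vanishes_def by blast
  have "eventually (\<lambda>z. cmod (g z * h z) \<le> (C * D) * norm (z - a) ^ (k + l)) (nhds a)"
    using C(2) D(2)
  proof eventually_elim
    case (elim z)
    have "cmod (g z * h z) \<le> (C * norm (z - a) ^ k) * (D * norm (z - a) ^ l)"
      unfolding norm_mult by (rule mult_mono[OF elim]) (simp_all add: C(1))
    then show ?case by (simp add: power_add mult_ac)
  qed
  then show ?thesis
    unfolding vanishes_def using C(1) D(1) by (intro exI[of _ "C * D"]) simp
qed

lemma vanishes_mono: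
  assumes "vanishes a l g" "k \<le> l"
  shows "vanishes a k g"
proof -
  obtain C where C: "0 \<le> C" "eventually (\<lambda>z. cmod (g z) \<le> C * norm (z - a) ^ l) (nhds a)"
    using assms unfolding vanishes_def by blast
  have "a \<in> ball a 1" by simp
  have "eventually (\<lambda>z. cmod (g z) \<le> C * norm (z - a) ^ k) (nhds a)"
    using C(2) eventually_nhds_in_open[OF open_ball \<open>a \<in> ball a 1\<close>]
  proof eventually_elim
    case (elim z)
    have "norm (z - a) ^ l \<le> norm (z - a) ^ k"
      using elim(2) assms(2) by (intro power_decreasing) (simp_all add: dist_norm norm_minus_commute)
    from mult_left_mono[OF this C(1)] elim(1) show ?case by linarith
  qed
  then show ?thesis unfolding vanishes_def using C(1) by blast
qed

lemma vanishes_zero: "vanishes a m (\<lambda>_. 0)"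
  unfolding vanishes_def by (intro exI[of _ 0]) simp

lemma vanishes_const: "vanishes a 0 (\<lambda>_. c)"
  unfolding vanishes_def by (intro exI[of _ "cmod c"]) simp

lemma vanishes_cmult: "vanishes a m g \<Longrightarrow> vanishes a m (\<lambda>z. c * g z)"
  using vanishes_mult[OF vanishes_const, of a m g c] by simp

lemma vanishes_sum: "(\<And>k. k \<in> K \<Longrightarrow> vanishes a m (g k)) \<Longrightarrow> vanishes a m (\<lambda>z. \<Sum>k\<in>K. g k z)"
  by (induction K rule: infinite_finite_induct) (simp_all add: vanishes_zero vanishes_add)

lemma vanishes_cong:
  assumes "vanishes a m g" "eventually (\<lambda>z. g z = h z) (nhds a)"
  shows "vanishes a m h"
proof -
  obtain C where C: "0 \<le> C" "eventually (\<lambda>z. cmod (g z) \<le> C * norm (z - a) ^ m) (nhds a)"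
    using assms unfolding vanishes_def by blast
  have "eventually (\<lambda>z. cmod (h z) \<le> C * norm (z - a) ^ m) (nhds a)"
    using C(2) assms(2) by eventually_elim simp
  then show ?thesis unfolding vanishes_def using C(1) by blast
qed

definition weighted_exponents :: "('n::finite \<Rightarrow> nat) \<Rightarrow> nat \<Rightarrow> ('n \<Rightarrow> nat) set" where
  "weighted_exponents \<omega> m = {\<alpha>. (\<Sum>i\<in>UNIV. \<omega> i * \<alpha> i) < m}"

lemma finite_weighted_exponents:
  assumes "\<And>i. 1 \<le> \<omega> i"
  shows "finite (weighted_exponents \<omega> m)"
proof -
  have "\<alpha> i < m" if "\<alpha> \<in> weighted_exponents \<omega> m" for \<alpha> i
  proof -
    have "\<alpha> i \<le> \<omega> i * \<alpha> i" using assms[of i] by (cases "\<omega> i") auto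
    also have "\<dots> \<le> (\<Sum>i\<in>UNIV. \<omega> i * \<alpha> i)" by (rule member_le_sum) auto
    finally show ?thesis using that by (simp add: weighted_exponents_def)
  qed
  then have "weighted_exponents \<omega> m \<subseteq> PiE UNIV (\<lambda>_. {..<m})"
    by (auto simp: PiE_def)
  then show ?thesis by (rule finite_subset) (simp add: finite_PiE)
qed

text \<open>Modulo order m, g is a polynomial in the functions Y i with monomials of weighted degree
  below m, where the weight \<omega> i stands for the order of vanishing of Y i. The number of these
  monomials bounds the dimension of the space of such jets.\<close>

definition jet_span :: "complex ^ 'n::finite \<Rightarrow> ('n \<Rightarrow> complex ^ 'n \<Rightarrow> complex) \<Rightarrow> ('n \<Rightarrow> nat) \<Rightarrow> nat
    \<Rightarrow> (complex ^ 'n \<Rightarrow> complex) \<Rightarrow> bool" where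
  "jet_span a Y \<omega> m g \<longleftrightarrow> (\<exists>c. vanishes a m
     (\<lambda>z. g z - (\<Sum>\<alpha>\<in>weighted_exponents \<omega> m. c \<alpha> * (\<Prod>i\<in>UNIV. Y i z ^ \<alpha> i))))"

lemma jet_span_add:
  assumes "jet_span a Y \<omega> m g" "jet_span a Y \<omega> m h"
  shows "jet_span a Y \<omega> m (\<lambda>z. g z + h z)"
proof -
  let ?S = "\<lambda>c z. \<Sum>\<alpha>\<in>weighted_exponents \<omega> m. c \<alpha> * (\<Prod>i\<in>UNIV. Y i z ^ \<alpha> i)"
  obtain c e where c: "vanishes a m (\<lambda>z. g z - ?S c z)" and e: "vanishes a m (\<lambda>z. h z - ?S e z)"
    using assms unfolding jet_span_def by blast
  have "(g z - ?S c z) + (h z - ?S e z) = g z + h z - ?S (\<lambda>\<alpha>. c \<alpha> + e \<alpha>) z" for z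
    by (simp add: distrib_right sum.distrib)
  then have "vanishes a m (\<lambda>z. g z + h z - ?S (\<lambda>\<alpha>. c \<alpha> + e \<alpha>) z)"
    using vanishes_add[OF c e] by (simp only:)
  then show ?thesis unfolding jet_span_def by (rule exI[of _ "\<lambda>\<alpha>. c \<alpha> + e \<alpha>"])
qed

lemma jet_span_cong:
  assumes "jet_span a Y \<omega> m g" "eventually (\<lambda>z. g z = h z) (nhds a)"
  shows "jet_span a Y \<omega> m h"
proof -
  let ?S = "\<lambda>c z. \<Sum>\<alpha>\<in>weighted_exponents \<omega> m. c \<alpha> * (\<Prod>i\<in>UNIV. Y i z ^ \<alpha> i)"
  obtain c where c: "vanishes a m (\<lambda>z. g z - ?S c z)"
    using assms unfolding jet_span_def by blast
  have "vanishes a m (\<lambda>z. h z - ?S c z)"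
    by (rule vanishes_cong[OF c]) (rule eventually_mono[OF assms(2)], simp)
  then show ?thesis unfolding jet_span_def by blast
qed

lemma jet_span_zero: "jet_span a Y \<omega> m (\<lambda>_. 0)"
  unfolding jet_span_def by (intro exI[of _ "\<lambda>_. 0"]) (simp add: vanishes_zero)

lemma jet_span_sum: "(\<And>k. k \<in> K \<Longrightarrow> jet_span a Y \<omega> m (g k)) \<Longrightarrow> jet_span a Y \<omega> m (\<lambda>z. \<Sum>k\<in>K. g k z)"
  by (induction K rule: infinite_finite_induct) (simp_all add: jet_span_zero jet_span_add)

lemma jet_span_const:
  assumes "\<And>i. 1 \<le> \<omega> i" "0 < m"
  shows "jet_span a Y \<omega> m (\<lambda>_. c)"
proof -
  let ?e = "\<lambda>\<alpha>. if \<alpha> = (\<lambda>_. 0) then c else 0"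
  have "(\<Sum>\<alpha>\<in>weighted_exponents \<omega> m. ?e \<alpha> * (\<Prod>i\<in>UNIV. Y i z ^ \<alpha> i))
      = (\<Sum>\<alpha>\<in>weighted_exponents \<omega> m. if \<alpha> = (\<lambda>_. 0) then c else 0)" for z
    by (rule sum.cong) auto
  also have "\<dots> = c"
    using assms by (simp add: sum.delta finite_weighted_exponents) (simp add: weighted_exponents_def)
  finally have "(\<lambda>z. c - (\<Sum>\<alpha>\<in>weighted_exponents \<omega> m. ?e \<alpha> * (\<Prod>i\<in>UNIV. Y i z ^ \<alpha> i))) = (\<lambda>_. 0)"
    by (simp only: diff_self)
  then show ?thesis
    unfolding jet_span_def by (intro exI[of _ ?e]) (simp only: vanishes_zero)
qed

text \<open>Multiplication by Y i raises the i-th exponent by one, and both the weight of a monomial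
  and the order of the remainder by \<omega> i.\<close>

lemma jet_span_mult:
  assumes \<omega>: "\<And>i. 1 \<le> \<omega> i" and Y: "vanishes a (\<omega> i) (Y i)" and g: "jet_span a Y \<omega> (m - \<omega> i) g"
  shows "jet_span a Y \<omega> m (\<lambda>z. Y i z * g z)"
proof -
  let ?E = "weighted_exponents \<omega>"
  let ?mon = "\<lambda>\<alpha> z. \<Prod>i\<in>UNIV. Y i z ^ \<alpha> i"
  obtain c where c: "vanishes a (m - \<omega> i) (\<lambda>z. g z - (\<Sum>\<alpha>\<in>?E (m - \<omega> i). c \<alpha> * ?mon \<alpha> z))"
    using g unfolding jet_span_def by blast
  define h where "h \<alpha> = \<alpha>(i := Suc (\<alpha> i))" for \<alpha> :: "'a \<Rightarrow> nat"
  have inj: "inj_on h X" for X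
    by (rule inj_onI) (auto simp: h_def fun_eq_iff split: if_splits)
  have mon: "?mon (h \<alpha>) z = Y i z * ?mon \<alpha> z" for \<alpha> z
  proof -
    have "?mon (h \<alpha>) z = (\<Prod>k\<in>UNIV. (if k = i then Y i z else 1) * Y k z ^ \<alpha> k)"
      by (rule prod.cong) (auto simp: h_def)
    also have "\<dots> = Y i z * ?mon \<alpha> z" by (simp add: prod.distrib prod.delta)
    finally show ?thesis .
  qed
  have wt: "(\<Sum>k\<in>UNIV. \<omega> k * h \<alpha> k) = \<omega> i + (\<Sum>k\<in>UNIV. \<omega> k * \<alpha> k)" for \<alpha>
  proof -
    have "(\<Sum>k\<in>UNIV. \<omega> k * h \<alpha> k) = (\<Sum>k\<in>UNIV. (if k = i then \<omega> i else 0) + \<omega> k * \<alpha> k)"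
      by (rule sum.cong) (auto simp: h_def)
    also have "\<dots> = \<omega> i + (\<Sum>k\<in>UNIV. \<omega> k * \<alpha> k)" by (simp add: sum.distrib)
    finally show ?thesis .
  qed
  have sub: "h ` ?E (m - \<omega> i) \<subseteq> ?E m"
    by (auto simp: weighted_exponents_def wt)
  define e where "e \<beta> = (if \<beta> \<in> h ` ?E (m - \<omega> i) then c (the_inv_into (?E (m - \<omega> i)) h \<beta>) else 0)" for \<beta>
  have "(\<Sum>\<beta>\<in>?E m. e \<beta> * ?mon \<beta> z) = Y i z * (\<Sum>\<alpha>\<in>?E (m - \<omega> i). c \<alpha> * ?mon \<alpha> z)" for z
  proof -
    have "(\<Sum>\<beta>\<in>?E m. e \<beta> * ?mon \<beta> z) = (\<Sum>\<beta>\<in>h ` ?E (m - \<omega> i). e \<beta> * ?mon \<beta> z)"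
      by (rule sum.mono_neutral_right[OF finite_weighted_exponents[OF \<omega>] sub]) (simp add: e_def)
    also have "\<dots> = (\<Sum>\<alpha>\<in>?E (m - \<omega> i). e (h \<alpha>) * ?mon (h \<alpha>) z)"
      by (rule sum.reindex_cong[OF inj refl refl])
    also have "\<dots> = (\<Sum>\<alpha>\<in>?E (m - \<omega> i). Y i z * (c \<alpha> * ?mon \<alpha> z))"
      by (rule sum.cong[OF refl]) (simp add: mon e_def the_inv_into_f_f[OF inj])
    finally show ?thesis by (simp add: sum_distrib_left)
  qed
  then have eq: "Y i z * g z - (\<Sum>\<beta>\<in>?E m. e \<beta> * ?mon \<beta> z)
      = Y i z * (g z - (\<Sum>\<alpha>\<in>?E (m - \<omega> i). c \<alpha> * ?mon \<alpha> z))" for z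
    by (simp only: right_diff_distrib)
  \<comment> \<open>If \<omega> i exceeds m, the natural number m - \<omega> i is 0; in every case
    \<omega> i + (m - \<omega> i) is at least m.\<close>
  have "vanishes a m (\<lambda>z. Y i z * g z - (\<Sum>\<beta>\<in>?E m. e \<beta> * ?mon \<beta> z))"
    unfolding eq by (rule vanishes_mono[OF vanishes_mult[OF Y c]]) simp
  then show ?thesis unfolding jet_span_def by blast
qed

text \<open>Repeated division: the quotient multiplied by Y i has to be expanded only up to order m
  - \<omega> i, which is smaller than m, and at order 0 boundedness is enough. Only the constants
  split off on the way enter the jet.\<close>

lemma jet_span_divisible_class:
  assumes \<omega>: "\<And>i. 1 \<le> \<omega> i" and Y: "\<And>i. vanishes a (\<omega> i) (Y i)"
    and bounded: "\<And>g. g \<in> G \<Longrightarrow> vanishes a 0 g"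
    and division: "\<And>g. g \<in> G \<Longrightarrow> \<exists>c k. (\<forall>i. k i \<in> G) \<and>
      eventually (\<lambda>z. c + (\<Sum>i\<in>UNIV. Y i z * k i z) = g z) (nhds a)"
    and g: "g \<in> G"
  shows "jet_span a Y \<omega> m g"
  using g
proof (induction m arbitrary: g rule: less_induct)
  case (less m)
  show ?case
  proof (cases "m = 0")
    case True
    have "weighted_exponents \<omega> 0 = {}" by (simp add: weighted_exponents_def)
    then show ?thesis
      using bounded[OF less.prems] by (simp add: True jet_span_def)
  next
    case False
    obtain c k where k: "\<And>i. k i \<in> G"
      and eq: "eventually (\<lambda>z. c + (\<Sum>i\<in>UNIV. Y i z * k i z) = g z) (nhds a)"
      using division[OF less.prems] by blast
    have "jet_span a Y \<omega> (m - \<omega> i) (k i)" for i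
      by (rule less.IH[OF _ k]) (use \<omega>[of i] False in simp)
    then have "jet_span a Y \<omega> m (\<lambda>z. c + (\<Sum>i\<in>UNIV. Y i z * k i z))"
      by (intro jet_span_add jet_span_const jet_span_sum jet_span_mult \<omega> Y) (use False in simp)
    then show ?thesis by (rule jet_span_cong[OF _ eq])
  qed
qed

section \<open>Polynomials that vanish beyond their degree\<close>

text \<open>Division by s^p, for the least p with \<open>c p\<close> nonzero, leaves a function that
  tends to \<open>c p\<close> but is bounded by a multiple of a positive power of |s|.\<close>

lemma polynomial_vanishing_coeffs:
  fixes c :: "nat \<Rightarrow> complex"
  assumes "eventually (\<lambda>s. cmod (\<Sum>j<m. c j * s ^ j) \<le> C * cmod s ^ m) (nhds 0)"
  shows "\<forall>j<m. c j = 0"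
proof (rule ccontr)
  assume "\<not> (\<forall>j<m. c j = 0)"
  then have ex: "\<exists>j. j < m \<and> c j \<noteq> 0" by blast
  define p where "p = (LEAST j. j < m \<and> c j \<noteq> 0)"
  have p: "p < m" "c p \<noteq> 0" using LeastI_ex[OF ex] by (simp_all add: p_def)
  have below: "c j = 0" if "j < p" for j
    using not_less_Least[of j "\<lambda>j. j < m \<and> c j \<noteq> 0"] that p(1) by (auto simp: p_def[symmetric])
  define h where "h s = (\<Sum>j\<in>{p..<m}. c j * s ^ (j - p))" for s
  have fac: "(\<Sum>j<m. c j * s ^ j) = s ^ p * h s" for s
  proof -
    have "(\<Sum>j<m. c j * s ^ j) = (\<Sum>j\<in>{p..<m}. c j * s ^ j)"
      by (rule sum.mono_neutral_right) (auto simp: below)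
    also have "\<dots> = (\<Sum>j\<in>{p..<m}. s ^ p * (c j * s ^ (j - p)))"
      by (rule sum.cong[OF refl]) (simp add: power_add[symmetric] mult.left_commute)
    finally show ?thesis by (simp add: h_def sum_distrib_left)
  qed
  have "eventually (\<lambda>s. cmod (\<Sum>j<m. c j * s ^ j) \<le> C * cmod s ^ m) (at 0)"
    using assms by (simp add: eventually_nhds_conv_at)
  moreover have "eventually (\<lambda>s::complex. s \<noteq> 0) (at 0)" by (rule eventually_neq_at_within)
  ultimately have "eventually (\<lambda>s. cmod (h s) \<le> C * cmod s ^ (m - p)) (at 0)"
  proof eventually_elim
    case (elim s)
    have "cmod s ^ p * cmod (h s) \<le> cmod s ^ p * (C * cmod s ^ (m - p))"
      using elim(1) p(1) unfolding fac by (simp add: norm_mult norm_power mult.left_commute flip: power_add)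
    then show ?case using elim(2) by (simp add: mult_le_cancel_left_pos)
  qed
  then have bound: "eventually (\<lambda>s. norm (h s) \<le> C * cmod s ^ (m - p)) (at 0)" .
  have "((\<lambda>s::complex. C * cmod s ^ (m - p)) \<longlongrightarrow> C * cmod 0 ^ (m - p)) (at 0)"
    by (intro tendsto_intros)
  moreover have "C * cmod 0 ^ (m - p) = 0"
    using p(1) by (simp add: power_0_left)
  ultimately have "((\<lambda>s::complex. C * cmod s ^ (m - p)) \<longlongrightarrow> 0) (at 0)" by (simp only:)
  from Lim_null_comparison[OF bound this] have "(h \<longlongrightarrow> 0) (at 0)" .
  moreover have "(h \<longlongrightarrow> h 0) (at 0)"
    unfolding h_def by (intro tendsto_intros)
  ultimately have "h 0 = 0" using tendsto_unique[OF at_neq_bot] by blast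
  moreover have "h 0 = (\<Sum>j\<in>{p..<m}. if j = p then c p else 0)"
    unfolding h_def by (rule sum.cong[OF refl]) auto
  ultimately show False using p by simp
qed

text \<open>Variables are split off one at a time: grouping by the exponent of j gives a polynomial
  in one variable that vanishes identically. Requiring exponents in K to be determined by their
  values on I keeps each group separated by the remaining variables.\<close>

lemma monomials_independent:
  fixes t :: "('n \<Rightarrow> nat) \<Rightarrow> complex"
  assumes "finite I" "finite K"
    and "\<forall>\<alpha>\<in>K. \<forall>\<beta>\<in>K. (\<forall>i\<in>I. \<alpha> i = \<beta> i) \<longrightarrow> \<alpha> = \<beta>"
    and "\<forall>x. (\<Sum>\<alpha>\<in>K. t \<alpha> * (\<Prod>i\<in>I. x i ^ \<alpha> i)) = 0"
  shows "\<forall>\<alpha>\<in>K. t \<alpha> = 0"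
  using assms
proof (induction I arbitrary: K rule: finite_induct)
  case empty
  show ?case
  proof
    fix \<alpha> assume "\<alpha> \<in> K"
    with empty.prems(2) have "K = {\<alpha>}" by blast
    with empty.prems(3) show "t \<alpha> = 0" by simp
  qed
next
  case (insert j I)
  define N where "N = Max ((\<lambda>\<beta>. \<beta> j) ` K)"
  have N: "\<beta> j \<le> N" if "\<beta> \<in> K" for \<beta>
    unfolding N_def by (rule Max_ge[OF finite_imageI[OF insert.prems(1)] imageI[OF that]])
  define L where "L l = {\<beta> \<in> K. \<beta> j = l}" for l
  have finL: "finite (L l)" for l using insert.prems(1) by (simp add: L_def)
  have sepL: "\<forall>\<beta>\<in>L l. \<forall>\<gamma>\<in>L l. (\<forall>i\<in>I. \<beta> i = \<gamma> i) \<longrightarrow> \<beta> = \<gamma>" for l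
  proof (intro ballI impI)
    fix \<beta> \<gamma> assume *: "\<beta> \<in> L l" "\<gamma> \<in> L l" "\<forall>i\<in>I. \<beta> i = \<gamma> i"
    then have "\<beta> \<in> K" "\<gamma> \<in> K" "\<beta> j = \<gamma> j" by (simp_all add: L_def)
    moreover have "\<forall>i\<in>insert j I. \<beta> i = \<gamma> i" using *(3) calculation(3) by simp
    ultimately show "\<beta> = \<gamma>" using insert.prems(2) by blast
  qed
  have zero: "(\<Sum>\<beta>\<in>L l. t \<beta> * (\<Prod>i\<in>I. x i ^ \<beta> i)) = 0" if l: "l \<le> N" for l and x :: "'n \<Rightarrow> complex"
  proof -
    have "(\<Sum>l\<le>N. (\<Sum>\<beta>\<in>L l. t \<beta> * (\<Prod>i\<in>I. x i ^ \<beta> i)) * s ^ l) = 0" for s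
    proof -
      have "(\<Sum>l\<le>N. (\<Sum>\<beta>\<in>L l. t \<beta> * (\<Prod>i\<in>I. x i ^ \<beta> i)) * s ^ l)
          = (\<Sum>l\<le>N. \<Sum>\<beta>\<in>L l. t \<beta> * (\<Prod>i\<in>I. x i ^ \<beta> i) * s ^ \<beta> j)"
        unfolding sum_distrib_right by (rule sum.cong[OF refl], rule sum.cong[OF refl]) (simp add: L_def)
      also have "\<dots> = (\<Sum>\<beta>\<in>K. t \<beta> * (\<Prod>i\<in>I. x i ^ \<beta> i) * s ^ \<beta> j)"
        unfolding L_def
        by (rule sum.group[OF insert.prems(1) finite_atMost]) (use N in blast)
      also have "\<dots> = (\<Sum>\<beta>\<in>K. t \<beta> * (\<Prod>i\<in>insert j I. (x(j := s)) i ^ \<beta> i))"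
      proof (rule sum.cong[OF refl])
        fix \<beta>
        have "(\<Prod>i\<in>I. (x(j := s)) i ^ \<beta> i) = (\<Prod>i\<in>I. x i ^ \<beta> i)"
          by (rule prod.cong[OF refl]) (use insert.hyps(2) in \<open>metis fun_upd_other\<close>)
        then have "(\<Prod>i\<in>insert j I. (x(j := s)) i ^ \<beta> i) = s ^ \<beta> j * (\<Prod>i\<in>I. x i ^ \<beta> i)"
          by (simp only: prod.insert[OF insert.hyps] fun_upd_same)
        then show "t \<beta> * (\<Prod>i\<in>I. x i ^ \<beta> i) * s ^ \<beta> j = t \<beta> * (\<Prod>i\<in>insert j I. (x(j := s)) i ^ \<beta> i)"
          by (simp only: mult_ac)
      qed
      also have "\<dots> = 0" by (rule insert.prems(3)[rule_format])
      finally show ?thesis .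
    qed
    then have "\<forall>l\<le>N. (\<Sum>\<beta>\<in>L l. t \<beta> * (\<Prod>i\<in>I. x i ^ \<beta> i)) = 0"
      by (intro polyfun_eq_0[THEN iffD1] allI)
    with l show ?thesis by blast
  qed
  show ?case
  proof
    fix \<alpha> assume \<alpha>: "\<alpha> \<in> K"
    have "\<forall>\<beta>\<in>L (\<alpha> j). t \<beta> = 0"
      by (rule insert.IH[OF finL sepL]) (intro allI zero N \<alpha>)
    with \<alpha> show "t \<alpha> = 0" by (simp add: L_def)
  qed
qed

text \<open>Along the line s -> a + s x the homogeneous parts become the coefficients of a
  polynomial in s of degree below m that is O(|s|^m), hence zero.\<close>

lemma vanishing_polynomial_zero:
  fixes a :: "complex ^ 'n::finite"
  assumes K: "finite K" "\<And>\<alpha>. \<alpha> \<in> K \<Longrightarrow> (\<Sum>i\<in>UNIV. \<alpha> i) < m"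
    and v: "vanishes a m (\<lambda>z. \<Sum>\<alpha>\<in>K. t \<alpha> * (\<Prod>i\<in>UNIV. (z $ i - a $ i) ^ \<alpha> i))"
    and \<alpha>: "\<alpha> \<in> K"
  shows "t \<alpha> = 0"
proof -
  have zero: "(\<Sum>\<alpha>\<in>K. t \<alpha> * (\<Prod>i\<in>UNIV. x i ^ \<alpha> i)) = 0" for x :: "'n \<Rightarrow> complex"
  proof -
  define q where "q j = (\<Sum>\<alpha> | \<alpha> \<in> K \<and> (\<Sum>i\<in>UNIV. \<alpha> i) = j. t \<alpha> * (\<Prod>i\<in>UNIV. x i ^ \<alpha> i))" for j
  define y :: "complex \<Rightarrow> complex ^ 'n" where "y s = a + s *s (\<chi> i. x i)" for s
  have qs: "(\<Sum>j<m. q j * s ^ j) = (\<Sum>\<alpha>\<in>K. t \<alpha> * (\<Prod>i\<in>UNIV. (s * x i) ^ \<alpha> i))" for s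
  proof -
    have "(\<Sum>j<m. q j * s ^ j)
        = (\<Sum>j<m. \<Sum>\<alpha> | \<alpha> \<in> K \<and> (\<Sum>i\<in>UNIV. \<alpha> i) = j. t \<alpha> * (\<Prod>i\<in>UNIV. x i ^ \<alpha> i) * s ^ (\<Sum>i\<in>UNIV. \<alpha> i))"
      unfolding q_def sum_distrib_right by (intro sum.cong refl) simp
    also have "\<dots> = (\<Sum>\<alpha>\<in>K. t \<alpha> * (\<Prod>i\<in>UNIV. x i ^ \<alpha> i) * s ^ (\<Sum>i\<in>UNIV. \<alpha> i))"
      by (rule sum.group) (use K in auto)
    also have "\<dots> = (\<Sum>\<alpha>\<in>K. t \<alpha> * (\<Prod>i\<in>UNIV. (s * x i) ^ \<alpha> i))"
      by (simp add: power_mult_distrib prod.distrib power_sum mult_ac)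
    finally show ?thesis .
  qed
  obtain C where C: "0 \<le> C" "eventually (\<lambda>z. cmod (\<Sum>\<alpha>\<in>K. t \<alpha> * (\<Prod>i\<in>UNIV. (z $ i - a $ i) ^ \<alpha> i))
      \<le> C * norm (z - a) ^ m) (nhds a)"
    using v unfolding vanishes_def by blast
  have nys: "norm (y s - a) = cmod s * norm (\<chi> i. x i)" for s
    by (simp add: y_def norm_vec_def norm_mult L2_set_right_distrib)
  have "(y \<longlongrightarrow> y 0) (nhds 0)"
    unfolding y_def vector_scalar_mult_def by (intro tendsto_intros filterlim_ident)
  then have "filterlim y (nhds a) (nhds 0)" by (simp add: y_def)
  from filterlim_iff[THEN iffD1, OF this, rule_format, OF C(2)]
  have "eventually (\<lambda>s. cmod (\<Sum>j<m. q j * s ^ j) \<le> (C * norm (\<chi> i. x i) ^ m) * cmod s ^ m) (nhds 0)"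
  proof eventually_elim
    case (elim s)
    have "(\<Sum>\<alpha>\<in>K. t \<alpha> * (\<Prod>i\<in>UNIV. (y s $ i - a $ i) ^ \<alpha> i)) = (\<Sum>j<m. q j * s ^ j)"
      unfolding qs by (simp add: y_def)
    with elim show ?case by (simp only: nys power_mult_distrib mult_ac)
  qed
  \<comment> \<open>At s = 1 the sum of the homogeneous parts is the polynomial itself at x.\<close>
  from polynomial_vanishing_coeffs[OF this] have "(\<Sum>j<m. q j * 1 ^ j) = 0" by simp
  then show ?thesis
    unfolding qs by simp
  qed
  have "\<forall>\<alpha>\<in>K. t \<alpha> = 0"
    by (rule monomials_independent[OF finite[of UNIV] K(1)]) (simp_all add: zero fun_eq_iff)
  with \<alpha> show ?thesis by blast
qed

lemma H2_fun_shift_mult: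
  assumes "H2_fun g"
  shows "H2_fun (\<lambda>z. (z $ i - c) * g z)"
proof -
  have "H2_fun (\<lambda>z. z $ i * g z + (- c) * g z)"
    by (intro H2_fun_add H2_fun_coordinate_mult H2_fun_cmult assms)
  then show ?thesis by (simp add: left_diff_distrib)
qed

lemma H2_fun_monomial: "H2_fun (\<lambda>z. \<Prod>i\<in>UNIV. (z $ i - a $ i) ^ \<alpha> i)"
proof -
  have pow: "H2_fun (\<lambda>z. (z $ i - a $ i) ^ k * g z)" if "H2_fun g" for g i k
    by (induction k) (use that H2_fun_shift_mult in \<open>simp_all add: mult.assoc\<close>)
  have "H2_fun (\<lambda>z. \<Prod>i\<in>I. (z $ i - a $ i) ^ \<alpha> i)" if "finite I" for I
    using that by induction (simp_all add: H2_fun_one pow)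
  then show ?thesis by simp
qed

text \<open>Exponents concentrated at j with value k between d + 1 and 2 d + 1 have degree below 2
  (d + 1), but weighted degree 2 k at least 2 (d + 1). There are d + 1 of them, which explains the
  choice of the order.\<close>

lemma card_weighted_exponents_gap:
  fixes \<omega> :: "'n::finite \<Rightarrow> nat"
  assumes "\<And>i. 1 \<le> \<omega> i" "\<omega> j = 2"
  shows "card (weighted_exponents \<omega> (2 * (d + 1))) + d < card (weighted_exponents (\<lambda>_::'n. 1) (2 * (d + 1)))"
proof -
  let ?m = "2 * (d + 1)"
  let ?u = "\<lambda>k i. if i = j then k else 0"
  have inj: "inj_on ?u {d+1..<?m}" by (rule inj_onI) (metis (full_types))
  have s: "(\<Sum>i\<in>UNIV. w i * ?u k i) = w j * k" for w :: "'n \<Rightarrow> nat" and k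
  proof -
    have "(\<Sum>i\<in>UNIV. w i * ?u k i) = (\<Sum>i\<in>UNIV. if i = j then w j * k else 0)"
      by (rule sum.cong) auto
    then show ?thesis by simp
  qed
  have "\<alpha> \<in> weighted_exponents (\<lambda>_. 1) ?m" if "\<alpha> \<in> weighted_exponents \<omega> ?m" for \<alpha>
  proof -
    have "(\<Sum>i\<in>UNIV. 1 * \<alpha> i) \<le> (\<Sum>i\<in>UNIV. \<omega> i * \<alpha> i)"
      by (intro sum_mono mult_right_mono assms(1)) simp
    then show ?thesis using that by (simp add: weighted_exponents_def)
  qed
  moreover have "?u ` {d+1..<?m} \<subseteq> weighted_exponents (\<lambda>_. 1) ?m"
    unfolding weighted_exponents_def by (auto simp only: s mem_Collect_eq) auto
  ultimately have sub: "weighted_exponents \<omega> ?m \<union> ?u ` {d+1..<?m} \<subseteq> weighted_exponents (\<lambda>_. 1) ?m" by blast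
  have "weighted_exponents \<omega> ?m \<inter> ?u ` {d+1..<?m} = {}"
    unfolding weighted_exponents_def by (auto simp only: s mem_Collect_eq) (auto simp: assms(2))
  then have "card (weighted_exponents \<omega> ?m \<union> ?u ` {d+1..<?m}) = card (weighted_exponents \<omega> ?m) + (d + 1)"
    using card_Un_disjoint[OF finite_weighted_exponents[of \<omega> ?m, OF assms(1)] finite_imageI[OF finite_atLeastLessThan]]
    by (simp only: card_image[OF inj] card_atLeastLessThan) simp
  moreover have "card (weighted_exponents \<omega> ?m \<union> ?u ` {d+1..<?m}) \<le> card (weighted_exponents (\<lambda>_::'n. 1) ?m)"
    by (rule card_mono[OF finite_weighted_exponents sub]) simp
  ultimately show ?thesis by simp
qed

context finite_codimension_composition
begin

lemma F_lipschitz_at: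
  assumes a: "norm a < 1"
  shows "\<exists>C\<ge>0. eventually (\<lambda>z. norm (F z - F a) \<le> C * norm (z - a)) (nhds a)"
proof -
  obtain M C where C: "0 \<le> C" and ev: "eventually (\<lambda>z. norm (F z - F a - M *v (z - a)) \<le> C * (norm (z - a))\<^sup>2) (nhds a)"
    by (rule F_second_order[OF a])
  obtain K where K: "\<And>v. norm (M *v v) \<le> norm v * K"
    using bounded_linear.bounded[OF matrix_vector_mul_bounded_linear[of M]] by blast
  have a': "a \<in> ball a 1" by simp
  have "eventually (\<lambda>z. norm (F z - F a) \<le> (C + \<bar>K\<bar>) * norm (z - a)) (nhds a)"
    using ev eventually_nhds_in_open[OF open_ball a']
  proof eventually_elim
    case (elim z)
    have n: "norm (z - a) \<le> 1" using elim(2) by (simp add: dist_norm norm_minus_commute)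
    have "norm (F z - F a) \<le> norm (F z - F a - M *v (z - a)) + norm (M *v (z - a))"
      using norm_triangle_ineq[of "F z - F a - M *v (z - a)" "M *v (z - a)"] by simp
    also have "\<dots> \<le> C * (norm (z - a))\<^sup>2 + norm (z - a) * \<bar>K\<bar>"
    proof (rule add_mono[OF elim(1)])
      have "norm (z - a) * K \<le> norm (z - a) * \<bar>K\<bar>" by (rule mult_left_mono) simp_all
      with K[of "z - a"] show "norm (M *v (z - a)) \<le> norm (z - a) * \<bar>K\<bar>" by linarith
    qed
    also have "C * (norm (z - a))\<^sup>2 \<le> C * norm (z - a)"
      unfolding power2_eq_square by (rule mult_left_mono[OF mult_left_le_one_le[OF norm_ge_zero norm_ge_zero n] C])
    finally show ?case by (simp add: distrib_right mult.commute)
  qed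
  then show ?thesis using C by (intro exI[of _ "C + \<bar>K\<bar>"]) simp
qed

lemma F_tendsto:
  assumes a: "norm a < 1"
  shows "(F \<longlongrightarrow> F a) (nhds a)"
proof -
  obtain C where C: "0 \<le> C" "eventually (\<lambda>z. norm (F z - F a) \<le> C * norm (z - a)) (nhds a)"
    using F_lipschitz_at[OF a] by blast
  have "((\<lambda>z. C * norm (z - a)) \<longlongrightarrow> C * norm (a - a)) (nhds a)"
    by (intro tendsto_intros filterlim_ident)
  then have "((\<lambda>z. C * norm (z - a)) \<longlongrightarrow> 0) (nhds a)" by simp
  from Lim_null_comparison[OF C(2) this] show ?thesis by (rule LIM_zero_cancel)
qed

text \<open>Division at F(a) expresses h o F through the coordinates of F - F(a); since
  \<open>u j\<close> is nonzero, the j-th of them can be traded for the functional u of F - F(a).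
  The functions h o F with h in \<open>wiener R\<close> thus form a class closed under division by
  the Y i.\<close>

lemma range_in_jet_span:
  assumes a: "norm a < 1" and R: "\<And>i. 0 < R i" "\<And>i. cmod (F a $ i) < R i"
    and u: "u j \<noteq> 0" and \<omega>: "\<And>i. 1 \<le> \<omega> i"
    and Y: "\<And>i z. Y i z = (if i = j then \<Sum>l\<in>UNIV. u l * (F z $ l - F a $ l) else F z $ i - F a $ i)"
    and vY: "\<And>i. vanishes a (\<omega> i) (Y i)" and h: "wiener R h"
  shows "jet_span a Y \<omega> m (\<lambda>z. word_series h (F z))"
proof -
  define G where "G = {\<lambda>z. word_series h (F z) | h. wiener R h}"
  have poly: "eventually (\<lambda>z. \<forall>i. cmod (F z $ i) \<le> R i) (nhds a)"
    by (rule filterlim_iff[THEN iffD1, OF F_tendsto[OF a], rule_format, OF eventually_in_polydisc[of "F a" R, OF R(2)]])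
  show ?thesis
  proof (rule jet_span_divisible_class[where G = G, OF \<omega> vY])
    show "(\<lambda>z. word_series h (F z)) \<in> G" using h by (auto simp: G_def)
  next
    fix g assume "g \<in> G"
    then obtain h where g: "g = (\<lambda>z. word_series h (F z))" and h: "wiener R h" unfolding G_def by blast
    define B where "B = (\<Sum>\<^sub>\<infinity>\<alpha>. cmod (h \<alpha>) * rad_mono R \<alpha>)"
    have "eventually (\<lambda>z. cmod (g z) \<le> B * norm (z - a) ^ 0) (nhds a)"
      using poly by eventually_elim (use norm_word_series_le[OF h] in \<open>simp add: g B_def\<close>)
    moreover have "0 \<le> B"
      unfolding B_def using rad_mono_nonneg[of R, OF less_imp_le[OF R(1)]] by (intro infsum_nonneg) simp
    ultimately show "vanishes a 0 g" unfolding vanishes_def by blast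
  next
    fix g assume "g \<in> G"
    then obtain h where g: "g = (\<lambda>z. word_series h (F z))" and h: "wiener R h" unfolding G_def by blast
    obtain k where k: "\<And>i. wiener R (k i)" and eq: "\<And>w. (\<And>i. cmod (w $ i) \<le> R i) \<Longrightarrow>
        word_series h w - word_series h (F a) = (\<Sum>i\<in>UNIV. (w $ i - F a $ i) * word_series (k i) w)"
      using gleason_division[of R h "F a", OF h R] by blast
    \<comment> \<open>Solving Y_j = \<Sum> u_l x_l for the j-th coordinate difference gives x_j =
      \<Sum> e_i Y_i. The quotient \<open>k'\<close> collects everything that multiplies Y i after
      this substitution.\<close>
    define e where "e i = (if i = j then 1 / u j else - u i / u j)" for i
    define k' where "k' i = (\<lambda>\<alpha>. (if i = j then 0 else 1) * k i \<alpha> + e i * k j \<alpha>)" for i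
    have wk: "wiener R (k' i)" for i
      unfolding k'_def by (intro wiener_add wiener_cmult k less_imp_le R(1))
    have "eventually (\<lambda>z. word_series h (F a) + (\<Sum>i\<in>UNIV. Y i z * word_series (k' i) (F z)) = g z) (nhds a)"
      using poly
    proof eventually_elim
      case (elim z)
      have pd: "cmod (F z $ i) \<le> R i" for i using elim by blast
      have ws: "word_series (k' i) (F z)
          = (if i = j then 0 else 1) * word_series (k i) (F z) + e i * word_series (k j) (F z)" for i
        unfolding k'_def word_series_add[OF wiener_cmult[OF k] wiener_cmult[OF k] pd]
          word_series_cmult ..
      let ?x = "\<lambda>i. F z $ i - F a $ i"
      have "(\<Sum>i\<in>UNIV. Y i z * word_series (k' i) (F z))
          = (\<Sum>i\<in>UNIV. Y i z * ((if i = j then 0 else 1) * word_series (k i) (F z)))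
            + (\<Sum>i\<in>UNIV. e i * Y i z) * word_series (k j) (F z)"
        unfolding ws sum_distrib_right sum.distrib[symmetric]
        by (rule sum.cong[OF refl]) (simp only: distrib_left mult_ac)
      also have "(\<Sum>i\<in>UNIV. e i * Y i z) = ?x j"
      proof -
        let ?T = "\<Sum>i\<in>UNIV - {j}. u i * ?x i"
        have Yj: "Y j z = u j * ?x j + ?T"
          using sum.remove[of UNIV j "\<lambda>i. u i * ?x i"] by (simp add: Y)
        have rest: "(\<Sum>i\<in>UNIV - {j}. e i * Y i z) = (\<Sum>i\<in>UNIV - {j}. - (u i * ?x i / u j))"
          by (rule sum.cong) (simp_all add: e_def Y)
        have "(\<Sum>i\<in>UNIV. e i * Y i z) = e j * Y j z + (\<Sum>i\<in>UNIV - {j}. e i * Y i z)"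
          by (rule sum.remove) simp_all
        also have "\<dots> = (u j * ?x j + ?T) / u j - ?T / u j"
          unfolding rest unfolding Yj by (simp add: e_def sum_negf flip: sum_divide_distrib)
        also have "\<dots> = ?x j" using u by (simp add: add_divide_distrib)
        finally show ?thesis .
      qed
      also have "(\<Sum>i\<in>UNIV. Y i z * ((if i = j then 0 else 1) * word_series (k i) (F z)))
          = (\<Sum>i\<in>UNIV - {j}. ?x i * word_series (k i) (F z))"
        by (rule sum.mono_neutral_cong_right) (simp_all add: Y)
      also have "(\<Sum>i\<in>UNIV - {j}. ?x i * word_series (k i) (F z)) + ?x j * word_series (k j) (F z)
          = (\<Sum>i\<in>UNIV. ?x i * word_series (k i) (F z))"
        using sum.remove[of UNIV j "\<lambda>i. ?x i * word_series (k i) (F z)"] by (simp add: add.commute)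
      also have "\<dots> = word_series h (F z) - word_series h (F a)" by (rule eq[OF pd, symmetric])
      finally show ?case by (simp add: g)
    qed
    moreover have "(\<lambda>z. word_series (k' i) (F z)) \<in> G" for i using wk by (auto simp: G_def)
    ultimately show "\<exists>c k. (\<forall>i. k i \<in> G) \<and> eventually (\<lambda>z. c + (\<Sum>i\<in>UNIV. Y i z * k i z) = g z) (nhds a)"
      by (intro exI[of _ "word_series h (F a)"] exI[of _ "\<lambda>i z. word_series (k' i) (F z)"] conjI allI)
  qed
qed

text \<open>If the row vector u annihilates the derivative at a, then the coordinate u of F - F(a)
  vanishes to second order. The jets at a of the functions in the range then have strictly larger
  codimension in the space of all jets than the range itself.\<close>

lemma jacobian_nondegenerate:
  assumes a: "norm a < 1"
    and ev: "eventually (\<lambda>z. norm (F z - F a - M *v (z - a)) \<le> C * (norm (z - a))\<^sup>2) (nhds a)"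
    and u: "\<And>v. (\<Sum>i\<in>UNIV. u i * (M *v v) $ i) = 0"
  shows "u j = 0"
proof (rule ccontr)
  assume uj: "u j \<noteq> 0"
  define \<omega> :: "'n \<Rightarrow> nat" where "\<omega> i = (if i = j then 2 else 1)" for i
  define m where "m = 2 * (d + 1)"
  define Y where "Y i z = (if i = j then \<Sum>l\<in>UNIV. u l * (F z $ l - F a $ l) else F z $ i - F a $ i)" for i z
  have \<omega>1: "1 \<le> \<omega> i" for i by (simp add: \<omega>_def)
  have vY: "vanishes a (\<omega> i) (Y i)" for i
  proof (cases "i = j")
    case True
    have "eventually (\<lambda>z. cmod (Y j z) \<le> ((\<Sum>l\<in>UNIV. cmod (u l)) * \<bar>C\<bar>) * norm (z - a) ^ 2) (nhds a)"
      using ev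
    proof eventually_elim
      case (elim z)
      let ?r = "F z - F a - M *v (z - a)"
      have "Y j z = (\<Sum>l\<in>UNIV. u l * ?r $ l) + (\<Sum>l\<in>UNIV. u l * (M *v (z - a)) $ l)"
        by (simp add: Y_def distrib_left[symmetric] flip: sum.distrib)
      then have "cmod (Y j z) = cmod (\<Sum>l\<in>UNIV. u l * ?r $ l)" by (simp add: u)
      also have "\<dots> \<le> (\<Sum>l\<in>UNIV. cmod (u l) * (\<bar>C\<bar> * (norm (z - a))\<^sup>2))"
      proof (rule sum_norm_le)
        fix l
        have "cmod (?r $ l) \<le> norm ?r" by (rule Finite_Cartesian_Product.norm_nth_le)
        also have "\<dots> \<le> C * (norm (z - a))\<^sup>2" by (rule elim)
        also have "\<dots> \<le> \<bar>C\<bar> * (norm (z - a))\<^sup>2" by (rule mult_right_mono) simp_all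
        finally show "cmod (u l * ?r $ l) \<le> cmod (u l) * (\<bar>C\<bar> * (norm (z - a))\<^sup>2)"
          unfolding norm_mult by (rule mult_left_mono) simp
      qed
      finally show ?case by (simp only: sum_distrib_right mult.assoc)
    qed
    moreover have "0 \<le> (\<Sum>l\<in>UNIV. cmod (u l)) * \<bar>C\<bar>" by (simp add: sum_nonneg)
    ultimately have "vanishes a 2 (Y j)" unfolding vanishes_def by blast
    then show ?thesis using True by (simp add: \<omega>_def)
  next
    case False
    obtain K where K: "0 \<le> K" "eventually (\<lambda>z. norm (F z - F a) \<le> K * norm (z - a)) (nhds a)"
      using F_lipschitz_at[OF a] by blast
    have "eventually (\<lambda>z. cmod (Y i z) \<le> K * norm (z - a) ^ 1) (nhds a)"
      using K(2)
    proof eventually_elim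
      case (elim z)
      have "cmod ((F z - F a) $ i) \<le> norm (F z - F a)" by (rule Finite_Cartesian_Product.norm_nth_le)
      then show ?case using elim False by (simp add: Y_def)
    qed
    then have "vanishes a 1 (Y i)" unfolding vanishes_def using K(1) by blast
    then show ?thesis using False by (simp add: \<omega>_def)
  qed
  obtain R where R': "\<forall>i. 0 < R i \<and> cmod (F a $ i) < R i" and R3: "norm (\<chi> i. complex_of_real (R i)) < 1"
    using polyradius_exists[OF F_ball[OF a]] by blast
  then have R: "0 < R i" "cmod (F a $ i) < R i" for i by simp_all
  let ?K = "weighted_exponents (\<lambda>_::'n. 1) m"
  let ?E = "weighted_exponents \<omega> m"
  let ?p = "\<lambda>\<beta> z. \<Prod>i\<in>UNIV. (z $ i - a $ i) ^ \<beta> i"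
  let ?S = "\<lambda>c z. \<Sum>\<alpha>\<in>?E. c \<alpha> * (\<Prod>i\<in>UNIV. Y i z ^ \<alpha> i)"
  \<comment> \<open>Each monomial in z - a is described up to order m by its coefficients on the
    monomials in Y and by its d coefficients against \<open>b\<close>.\<close>
  have "\<exists>c e. vanishes a m (\<lambda>z. ?p \<beta> z - ?S c z - (\<Sum>l<d. e l * b l z))" for \<beta>
  proof -
    obtain h e where h: "square_summable h"
      and he: "\<And>z. norm z < 1 \<Longrightarrow> ?p \<beta> z = word_series h (F z) + (\<Sum>l<d. e l * b l z)"
      using H2_fun_decompose[OF H2_fun_monomial[of a \<beta>]] by blast
    have "wiener R h"
      by (rule wiener_free_coeffs[OF free_coeffs_square_summable[OF h] less_imp_le[OF R(1)] R3])
    from range_in_jet_span[OF a R uj \<omega>1 Y_def vY this] obtain c where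
      c: "vanishes a m (\<lambda>z. word_series h (F z) - ?S c z)"
      unfolding jet_span_def by blast
    have a': "a \<in> ball 0 1" using a by simp
    have "vanishes a m (\<lambda>z. ?p \<beta> z - ?S c z - (\<Sum>l<d. e l * b l z))"
    proof (rule vanishes_cong[OF c])
      show "eventually (\<lambda>z. word_series h (F z) - ?S c z = ?p \<beta> z - ?S c z - (\<Sum>l<d. e l * b l z)) (nhds a)"
        using eventually_nhds_in_open[OF open_ball a'] by eventually_elim (simp add: he)
    qed
    then show ?thesis by blast
  qed
  then have "\<forall>\<beta>. \<exists>c e. vanishes a m (\<lambda>z. ?p \<beta> z - ?S c z - (\<Sum>l<d. e l * b l z))" ..
  from choice[OF this] obtain c
    where "\<forall>\<beta>. \<exists>e. vanishes a m (\<lambda>z. ?p \<beta> z - ?S (c \<beta>) z - (\<Sum>l<d. e l * b l z))" ..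
  from choice[OF this] obtain e
    where "\<forall>\<beta>. vanishes a m (\<lambda>z. ?p \<beta> z - ?S (c \<beta>) z - (\<Sum>l<d. e \<beta> l * b l z))" ..
  then have ce: "vanishes a m (\<lambda>z. ?p \<beta> z - ?S (c \<beta>) z - (\<Sum>l<d. e \<beta> l * b l z))" for \<beta> ..
  have fin: "finite ?E" "finite ?K"
    using finite_weighted_exponents[of \<omega> m, OF \<omega>1] finite_weighted_exponents[of "\<lambda>_. 1" m] by simp_all
  \<comment> \<open>Both kinds of coefficients have to be cancelled by one relation, so the
    equations are indexed by a disjoint sum.\<close>
  have "card (?E <+> {..<d}) < card ?K"
    using card_weighted_exponents_gap[of \<omega> j d, OF \<omega>1] fin by (simp add: \<omega>_def card_Plus m_def)
  moreover have "finite (?E <+> {..<d})" using fin(1) by simp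
  ultimately obtain t where "(\<exists>\<beta>\<in>?K. t \<beta> \<noteq> 0) \<and>
      (\<forall>x\<in>?E <+> {..<d}. (\<Sum>\<beta>\<in>?K. t \<beta> * case_sum (c \<beta>) (e \<beta>) x) = 0)"
    using linear_dependence[OF _ fin(2), of "?E <+> {..<d}" "\<lambda>\<beta>. case_sum (c \<beta>) (e \<beta>)"] by blast
  then have t: "\<exists>\<beta>\<in>?K. t \<beta> \<noteq> 0"
    and tz: "\<forall>x\<in>?E <+> {..<d}. (\<Sum>\<beta>\<in>?K. t \<beta> * case_sum (c \<beta>) (e \<beta>) x) = 0" by simp_all
  have tc: "(\<Sum>\<beta>\<in>?K. t \<beta> * c \<beta> \<alpha>) = 0" if "\<alpha> \<in> ?E" for \<alpha>
    using tz[rule_format, OF InlI[OF that]] by simp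
  have te: "(\<Sum>\<beta>\<in>?K. t \<beta> * e \<beta> l) = 0" if "l < d" for l
    using tz[rule_format, OF InrI[of l]] that by simp
  have S0: "(\<Sum>\<beta>\<in>?K. t \<beta> * ?S (c \<beta>) z) = 0" for z
  proof -
    have "(\<Sum>\<beta>\<in>?K. t \<beta> * ?S (c \<beta>) z) = (\<Sum>\<alpha>\<in>?E. (\<Sum>\<beta>\<in>?K. t \<beta> * c \<beta> \<alpha>) * (\<Prod>i\<in>UNIV. Y i z ^ \<alpha> i))"
      by (rule sum_swap_factor)
    also have "\<dots> = 0" by (intro sum.neutral ballI) (simp only: tc mult_zero_left)
    finally show ?thesis .
  qed
  have b0: "(\<Sum>\<beta>\<in>?K. t \<beta> * (\<Sum>l<d. e \<beta> l * b l z)) = 0" for z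
  proof -
    have "(\<Sum>\<beta>\<in>?K. t \<beta> * (\<Sum>l<d. e \<beta> l * b l z)) = (\<Sum>l<d. (\<Sum>\<beta>\<in>?K. t \<beta> * e \<beta> l) * b l z)"
      by (rule sum_swap_factor)
    also have "\<dots> = 0" by (intro sum.neutral ballI) (simp only: te lessThan_iff mult_zero_left)
    finally show ?thesis .
  qed
  \<comment> \<open>The relation leaves a polynomial of degree below m that vanishes to order m,
    which forces its coefficients t to be zero.\<close>
  have "vanishes a m (\<lambda>z. \<Sum>\<beta>\<in>?K. t \<beta> * (?p \<beta> z - ?S (c \<beta>) z - (\<Sum>l<d. e \<beta> l * b l z)))"
    by (intro vanishes_sum vanishes_cmult ce)
  then have "vanishes a m (\<lambda>z. \<Sum>\<beta>\<in>?K. t \<beta> * ?p \<beta> z)"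
    by (simp only: right_diff_distrib sum_subtractf S0 b0 diff_zero)
  from vanishing_polynomial_zero[OF fin(2) _ this] have "\<forall>\<beta>\<in>?K. t \<beta> = 0"
    by (simp add: weighted_exponents_def)
  with t show False by blast
qed

text \<open>A singular square matrix is annihilated by a nonzero row vector, which
  \<open>jacobian_nondegenerate\<close> excludes. As multiplication by a complex matrix, the
  derivative is complex-linear.\<close>

lemma F_derivative:
  assumes a: "norm a < 1"
  obtains M M' :: "complex ^ 'n ^ 'n" where "(F has_derivative (\<lambda>v. M *v v)) (at a)"
    "M ** M' = mat 1" "M' ** M = mat 1"
proof -
  obtain M C where C: "0 \<le> C" and ev: "eventually (\<lambda>z. norm (F z - F a - M *v (z - a)) \<le> C * (norm (z - a))\<^sup>2) (nhds a)"
    by (rule F_second_order[OF a])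
  have "(F has_derivative (\<lambda>v. M *v v)) (at a)"
    unfolding has_derivative_at_alt
  proof (intro conjI allI impI)
    show "bounded_linear ((*v) M)" by (rule matrix_vector_mul_bounded_linear)
    fix e :: real assume e: "0 < e"
    obtain r where r: "0 < r" "\<And>z. dist z a < r \<Longrightarrow> norm (F z - F a - M *v (z - a)) \<le> C * (norm (z - a))\<^sup>2"
      using ev unfolding eventually_nhds_metric by blast
    \<comment> \<open>The constant \<open>C\<close> may be 0, hence the denominator C + 1.\<close>
    define s where "s = min r (e / (C + 1))"
    have s: "0 < s" using r(1) e C by (simp add: s_def)
    have "norm (F z - F a - M *v (z - a)) \<le> e * norm (z - a)" if z: "norm (z - a) < s" for z
    proof -
      have "norm (F z - F a - M *v (z - a)) \<le> C * (norm (z - a))\<^sup>2"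
        using z by (intro r(2)) (simp add: s_def dist_norm)
      also have "\<dots> = (C * norm (z - a)) * norm (z - a)" by (simp add: power2_eq_square)
      also have "\<dots> \<le> e * norm (z - a)"
      proof (rule mult_right_mono)
        have "C * norm (z - a) \<le> (C + 1) * norm (z - a)" by (simp add: mult_right_mono)
        also have "\<dots> \<le> (C + 1) * (e / (C + 1))"
          by (rule mult_left_mono) (use z C in \<open>simp_all add: s_def\<close>)
        also have "\<dots> = e" using C by simp
        finally show "C * norm (z - a) \<le> e" .
      qed simp
      finally show ?thesis .
    qed
    with s show "\<exists>da>0. \<forall>z. norm (z - a) < da \<longrightarrow> norm (F z - F a - M *v (z - a)) \<le> e * norm (z - a)" by blast
  qed
  moreover have "\<exists>B. B ** transpose M = mat 1"
    unfolding matrix_left_invertible_ker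
  proof (intro allI impI)
    fix x assume x: "transpose M *v x = 0"
    have "(\<Sum>i\<in>UNIV. x $ i * (M *v v) $ i) = 0" for v
    proof -
      have "(\<Sum>i\<in>UNIV. x $ i * (M *v v) $ i) = (\<Sum>k\<in>UNIV. (transpose M *v x) $ k * v $ k)"
        unfolding matrix_vector_mult_def transpose_def
        by (simp add: sum_distrib_left sum_distrib_right) (subst sum.swap, simp add: mult_ac)
      then show ?thesis unfolding x by simp
    qed
    from jacobian_nondegenerate[OF a ev this] show "x = 0" by (simp add: vec_eq_iff)
  qed
  then obtain B where "B ** transpose M = mat 1" by blast
  then have "M ** transpose B = mat 1"
    by (metis matrix_transpose_mul transpose_mat transpose_transpose)
  ultimately show thesis using that matrix_left_right_inverse by blast
qed

end

section \<open>Injectivity, properness and the main theorem\<close>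

context finite_codimension_composition
begin

lemma F_continuous_on: "continuous_on (ball 0 1) F"
proof -
  have "isCont F a" if "a \<in> ball 0 1" for a
  proof -
    from that have "norm a < 1" by simp
    then obtain M M' :: "complex ^ 'n ^ 'n" where "(F has_derivative (\<lambda>v. M *v v)) (at a)"
      by (rule F_derivative)
    then show ?thesis by (rule has_derivative_continuous)
  qed
  then show ?thesis by (intro continuous_at_imp_continuous_on ballI)
qed

text \<open>This open mapping theorem rests on Brouwer's fixed point theorem: it works with
  continuity of F and a right inverse of the derivative at the one point a.\<close>

lemma F_open_at:
  assumes a: "norm a < 1" and T: "T \<subseteq> ball 0 1" "a \<in> interior T"
  shows "F a \<in> interior (F ` T)"
proof -
  obtain M M' :: "complex ^ 'n ^ 'n" where M: "(F has_derivative (\<lambda>v. M *v v)) (at a)" "M ** M' = mat 1"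
    by (rule F_derivative[OF a])
  have "(\<lambda>v. M *v v) \<circ> (\<lambda>v. M' *v v) = id"
    by (simp add: fun_eq_iff matrix_vector_mul_assoc M(2))
  then show ?thesis
    using a by (intro sussmann_open_mapping[OF open_ball F_continuous_on _ M(1)
          matrix_vector_mul_bounded_linear _ T]) simp_all
qed

text \<open>Openness at q matches points x m near p with points y m near q that have the same image.
  The test functions Q(z_i) z_i^k vanish at y 0, ..., y d, so a combination of the form f o F
  vanishes at x 0, ..., x d as well. There Q is nonzero, which leaves a polynomial of degree at most
  d with d + 1 roots.\<close>

lemma F_inj: "inj_on F (ball 0 1)"
proof (rule inj_onI, rule ccontr)
  fix p q assume p: "p \<in> ball 0 1" and q: "q \<in> ball 0 1" and eq: "F p = F q" and ne: "p \<noteq> q"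
  then obtain i where i: "p $ i \<noteq> q $ i" by (auto simp: vec_eq_iff)
  \<comment> \<open>Half of the gap between the i-th coordinates: within distance r of p and q,
    these coordinates cannot agree.\<close>
  define r where "r = cmod (p $ i - q $ i) / 2"
  have r: "0 < r" using i by (simp add: r_def)
  define T where "T = ball q r \<inter> ball 0 1"
  have "open T" by (simp add: T_def open_Int)
  then have qT: "q \<in> interior T" using q r by (simp add: interior_open T_def)
  have "F p \<in> interior (F ` T)"
    unfolding eq by (rule F_open_at[OF _ _ qT]) (use q in \<open>simp_all add: T_def\<close>)
  from topological_tendstoD[OF F_tendsto open_interior this] p
  have "eventually (\<lambda>z. F z \<in> interior (F ` T)) (nhds p)" by simp
  moreover have "eventually (\<lambda>z. z \<in> ball 0 1) (nhds p)"
    by (rule eventually_nhds_in_open[OF open_ball p])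
  ultimately have "eventually (\<lambda>z. F z \<in> F ` T \<and> z \<in> ball 0 1) (nhds p)"
    by eventually_elim (use interior_subset in blast)
  then obtain e where e: "0 < e" "\<And>z. dist z p < e \<Longrightarrow> F z \<in> F ` T \<and> z \<in> ball 0 1"
    unfolding eventually_nhds_metric by blast
  define s where "s = min e r"
  have s: "0 < s" "s \<le> e" "s \<le> r" using e r by (simp_all add: s_def)
  define x :: "nat \<Rightarrow> complex ^ 'n" where "x k = p + axis i (of_real (s / (real k + 2)))" for k
  have sk: "s / (real k + 2) < s" "0 < s / (real k + 2)" for k
    using s(1) by (simp_all add: field_simps add_pos_nonneg)
  have xp: "dist (x k) p < s" for k
  proof -
    define q where "q = s / (real k + 2)"
    have q: "0 < q" "q < s" using sk[of k] by (simp_all add: q_def)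
    have "norm (axis i (complex_of_real q)) \<le> (\<Sum>j\<in>UNIV. if j = i then q else 0)"
      unfolding norm_vec_def using q(1)
      by (intro order_trans[OF L2_set_le_sum] sum_mono) (simp_all add: axis_def)
    also have "\<dots> < s" using q(2) by simp
    finally show ?thesis by (simp add: x_def dist_norm del: of_real_divide flip: q_def)
  qed
  have xi: "x k $ i = p $ i + of_real (s / (real k + 2))" for k by (simp add: x_def axis_def)
  have "\<exists>y\<in>T. F y = F (x k)" for k
    using e(2)[of "x k"] xp[of k] s(2) by fastforce
  then obtain y where y: "\<And>k. y k \<in> T" "\<And>k. F (y k) = F (x k)" by metis
  have xb: "norm (x k) < 1" and yb: "norm (y k) < 1" for k
    using e(2)[of "x k"] xp[of k] s(2) y(1)[of k] by (simp_all add: T_def)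
  have xy: "x k $ i \<noteq> y l $ i" for k l
  proof
    assume "x k $ i = y l $ i"
    then have "p $ i - q $ i = (y l - q) $ i - of_real (s / (real k + 2))"
      by (simp add: xi algebra_simps)
    then have "cmod (p $ i - q $ i) \<le> cmod ((y l - q) $ i) + cmod (complex_of_real (s / (real k + 2)))"
      by (metis norm_triangle_ineq4)
    also have "cmod ((y l - q) $ i) \<le> norm (y l - q)" by (rule Finite_Cartesian_Product.norm_nth_le)
    also have "norm (y l - q) < r" using y(1)[of l] by (simp add: T_def dist_norm norm_minus_commute)
    also have "cmod (complex_of_real (s / (real k + 2))) < r"
      using sk[of k] s(3) by (simp only: norm_of_real)
    finally show False by (simp add: r_def)
  qed
  define Q where "Q w = (\<Prod>l\<le>d. w - y l $ i)" for w
  define g where "g k z = Q (z $ i) * (z $ i) ^ k" for k and z :: "complex ^ 'n"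
  have g: "H2_fun (g k)" for k
  proof -
    have pow: "H2_fun (\<lambda>z :: complex ^ 'n. (z $ i) ^ k)"
      by (induction k) (simp_all add: H2_fun_one H2_fun_coordinate_mult)
    have "H2_fun (\<lambda>z. (\<Prod>l\<in>L. z $ i - y l $ i) * (z $ i) ^ k)" if "finite L" for L
      using that by induction (simp_all add: pow H2_fun_shift_mult mult.assoc)
    then show ?thesis by (simp add: g_def[abs_def] Q_def)
  qed
  have fin: "finite {..d}" "d < card {..d}" by simp_all
  obtain t a where t: "\<exists>k\<in>{..d}. t k \<noteq> 0"
    and "\<forall>z. norm z < 1 \<longrightarrow> (\<Sum>k\<in>{..d}. t k * g k z) = word_series a (F z)"
    using combination_in_range[of "{..d}" g, OF fin g] by blast
  then have ta: "(\<Sum>k\<in>{..d}. t k * g k z) = word_series a (F z)" if "norm z < 1" for z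
    using that by blast
  have root: "(\<Sum>k\<le>d. t k * (x m $ i) ^ k) = 0" if m: "m \<le> d" for m
  proof -
    have "Q (y m $ i) = 0" using m by (auto simp: Q_def)
    then have "(\<Sum>k\<le>d. t k * g k (y m)) = 0" by (simp add: g_def)
    then have "(\<Sum>k\<le>d. t k * g k (x m)) = 0" using ta[OF xb] ta[OF yb] y(2) by metis
    moreover have "(\<Sum>k\<le>d. t k * g k (x m)) = Q (x m $ i) * (\<Sum>k\<le>d. t k * (x m $ i) ^ k)"
      unfolding sum_distrib_left by (rule sum.cong[OF refl]) (simp add: g_def)
    moreover have "Q (x m $ i) \<noteq> 0" using xy by (simp add: Q_def)
    ultimately show ?thesis by simp
  qed
  have inj: "inj_on (\<lambda>m. x m $ i) {..d}"
    using s(1) by (intro inj_onI) (simp add: xi field_simps)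
  have "\<exists>k\<le>d. t k \<noteq> 0" using t by auto
  from polyfun_rootbound[where c = t, OF this]
  have "finite {z. (\<Sum>k\<le>d. t k * z ^ k) = 0}" "card {z. (\<Sum>k\<le>d. t k * z ^ k) = 0} \<le> d" by auto
  moreover from this(1) have "card ((\<lambda>m. x m $ i) ` {..d}) \<le> card {z. (\<Sum>k\<le>d. t k * z ^ k) = 0}"
    by (rule card_mono) (use root in auto)
  ultimately show False by (simp add: card_image[OF inj])
qed

end

section \<open>Functions with a singularity at a boundary point\<close>

text \<open>The binomial coefficients are O(k^(s - 1)), so for s \<le> 1/4 their squares are
  O(k^(-3/2)).\<close>

lemma summable_gbinomial_squared:
  assumes s: "0 < s" "s \<le> 1 / 4"
  shows "summable (\<lambda>k. (cmod ((- complex_of_real s) gchoose k))\<^sup>2)"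
proof -
  let ?z = "- complex_of_real s"
  let ?u = "\<lambda>n. (?z gchoose n) / ((- 1) ^ n / exp ((?z + 1) * of_real (ln (real n))))"
  have "Bseq ?u" using gbinomial_asymptotic[of ?z] by (intro convergent_imp_Bseq convergentI)
  then obtain K where K: "0 < K" "\<And>n. norm (?u n) \<le> K" by (auto elim: BseqE)
  have ev: "norm ((cmod (?z gchoose n))\<^sup>2) \<le> K\<^sup>2 * real n powr (- (3 / 2))" if n: "n \<ge> 1" for n
  proof -
    have "norm (?u n) = cmod (?z gchoose n) * exp ((1 - s) * ln (real n))"
      by (simp add: norm_divide norm_mult norm_power)
    also have "exp ((1 - s) * ln (real n)) = real n powr (1 - s)"
      using n by (simp add: powr_def)
    finally have "cmod (?z gchoose n) * real n powr (1 - s) \<le> K" using K(2) by metis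
    moreover have "real n powr (3 / 4) \<le> real n powr (1 - s)"
      using n s by (intro powr_mono) auto
    then have "cmod (?z gchoose n) * real n powr (3 / 4) \<le> cmod (?z gchoose n) * real n powr (1 - s)"
      by (rule mult_left_mono) simp
    ultimately have "cmod (?z gchoose n) * real n powr (3 / 4) \<le> K" by linarith
    then have "(cmod (?z gchoose n) * real n powr (3 / 4))\<^sup>2 \<le> K\<^sup>2"
      by (rule power_mono) simp
    moreover have "(real n powr (3 / 4))\<^sup>2 = real n powr (3 / 2)"
      using n by (simp add: powr_power)
    ultimately have "(cmod (?z gchoose n))\<^sup>2 * real n powr (3 / 2) \<le> K\<^sup>2"
      by (simp add: power_mult_distrib)
    then show ?thesis
      using n by (simp add: powr_minus field_simps)
  qed
  show ?thesis
  proof (rule summable_comparison_test)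
    show "\<exists>N. \<forall>n\<ge>N. norm ((cmod (?z gchoose n))\<^sup>2) \<le> K\<^sup>2 * real n powr (- (3 / 2))"
      using ev by blast
    show "summable (\<lambda>n. K\<^sup>2 * real n powr (- (3 / 2)))"
      by (intro summable_mult) (simp add: summable_real_powr_iff)
  qed
qed

text \<open>The k-th power of \<Sum> \<zeta>_i z_i is spread over words with coefficients
  \<zeta>_\<alpha>, of l2 norm 1 because \<zeta> is a unit vector. Level k thus contributes exactly
  the square of the one-variable binomial coefficient.\<close>

lemma H2_fun_binomial:
  fixes \<zeta> :: "complex ^ 'n::finite"
  assumes s: "0 < s" "s \<le> 1 / 4" and \<zeta>: "norm \<zeta> = 1"
  shows "H2_fun (\<lambda>z. (1 - (\<Sum>i\<in>UNIV. \<zeta> $ i * z $ i)) powr (- complex_of_real s))"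
proof -
  define c where "c k = ((- complex_of_real s) gchoose k) * (- 1) ^ k" for k
  define a where "a \<alpha> = c (length \<alpha>) * word_mono \<zeta> \<alpha>" for \<alpha>
  have lev: "(\<Sum>\<alpha> | length \<alpha> = k. (cmod (a \<alpha>))\<^sup>2) = (cmod ((- complex_of_real s) gchoose k))\<^sup>2" for k
  proof -
    have "(\<Sum>\<alpha> | length \<alpha> = k. (cmod (a \<alpha>))\<^sup>2) = (\<Sum>\<alpha> | length \<alpha> = k. (cmod (c k))\<^sup>2 * (cmod (word_mono \<zeta> \<alpha>))\<^sup>2)"
      by (rule sum.cong[OF refl]) (simp add: a_def norm_mult power_mult_distrib)
    also have "\<dots> = (cmod (c k))\<^sup>2 * (level_norm (word_mono \<zeta>) k)\<^sup>2"
      by (simp only: level_norm_squared sum_distrib_left)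
    also have "\<dots> = (cmod (c k))\<^sup>2" by (simp add: level_norm_word_mono \<zeta>)
    finally show ?thesis by (simp add: c_def norm_mult norm_power)
  qed
  have a: "square_summable a"
    by (rule summable_on_words[OF _ summable_gbinomial_squared[OF s]]) (simp_all add: lev)
  have homog: "(\<Sum>\<alpha> | length \<alpha> = k. word_mono \<zeta> \<alpha> * word_mono z \<alpha>) = (\<Sum>i\<in>UNIV. \<zeta> $ i * z $ i) ^ k"
    for k and z :: "complex ^ 'n"
  proof (induction k)
    case (Suc k)
    have "(\<Sum>\<alpha> | length \<alpha> = Suc k. word_mono \<zeta> \<alpha> * word_mono z \<alpha>)
        = (\<Sum>i\<in>UNIV. (\<zeta> $ i * z $ i) * (\<Sum>\<alpha> | length \<alpha> = k. word_mono \<zeta> \<alpha> * word_mono z \<alpha>))"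
      unfolding sum_words_Suc sum_distrib_left by (simp add: mult_ac)
    then show ?case by (simp add: Suc sum_distrib_right)
  qed (simp only: words_0, simp)
  have "(1 - (\<Sum>i\<in>UNIV. \<zeta> $ i * z $ i)) powr (- complex_of_real s) = word_series a z"
    if z: "norm z < 1" for z
  proof -
    let ?x = "\<Sum>i\<in>UNIV. \<zeta> $ i * z $ i"
    have "cmod ?x \<le> (\<Sum>i\<in>UNIV. \<bar>cmod (\<zeta> $ i)\<bar> * \<bar>cmod (z $ i)\<bar>)"
      by (rule sum_norm_le) (simp add: norm_mult)
    also have "\<dots> \<le> norm \<zeta> * norm z" unfolding norm_vec_def by (rule L2_set_mult_ineq)
    finally have "cmod (- ?x) < 1" using z \<zeta> by simp
    from gen_binomial_complex[OF this, of "- complex_of_real s"]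
    have "(\<lambda>k. c k * ?x ^ k) sums ((1 - ?x) powr (- complex_of_real s))"
      by (simp add: c_def power_minus[of ?x] mult.assoc)
    moreover have "(\<lambda>k. c k * ?x ^ k) sums word_series a z"
    proof -
      have "(\<Sum>\<alpha> | length \<alpha> = k. a \<alpha> * word_mono z \<alpha>) = c k * ?x ^ k" for k
        unfolding homog[symmetric] sum_distrib_left by (rule sum.cong[OF refl]) (simp add: a_def mult.assoc)
      with word_series_sums[OF free_coeffs_square_summable[OF a] z] show ?thesis by (simp only:)
    qed
    ultimately show ?thesis by (rule sums_unique2)
  qed
  with a show ?thesis unfolding H2_fun_def by blast
qed

context finite_codimension_composition
begin

text \<open>If the points \<lambda> approach a boundary point while F \<lambda> stays away from the boundary, then functions in
  the range of the composition operator stay bounded along \<lambda>, whereas nontrivial combinations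
  of powers of a function with a singularity at the boundary point do not.\<close>

lemma boundary_sequence_impossible:
  assumes x: "\<And>n. norm (x n) < 1" and x\<zeta>: "x \<longlonglongrightarrow> \<zeta>" and \<zeta>: "norm \<zeta> = 1"
    and Fx: "(\<lambda>n. F (x n)) \<longlonglongrightarrow> w" and w: "norm w < 1"
  shows False
proof -
  \<comment> \<open>Conjugation turns the bilinear sum in \<open>v\<close> into the inner product
    with \<zeta>, so that v(\<zeta>) = 1 - |\<zeta>|^2 = 0.\<close>
  define \<zeta>' where "\<zeta>' = (\<chi> i. cnj (\<zeta> $ i))"
  have \<zeta>': "norm \<zeta>' = 1" using \<zeta> by (simp add: \<zeta>'_def norm_vec_def)
  define v where "v z = 1 - (\<Sum>i\<in>UNIV. \<zeta>' $ i * z $ i)" for z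
  \<comment> \<open>The largest of the d + 1 exponents r, 2 r, ..., (d + 1) r is 1/4, the limit
    allowed by \<open>H2_fun_binomial\<close>.\<close>
  define r where "r = 1 / (4 * (real d + 1))"
  have r: "0 < r" by (simp add: r_def)
  define u where "u z = v z powr (- complex_of_real r)" for z
  have vne: "v z \<noteq> 0" if z: "norm z < 1" for z
  proof -
    have "cmod (\<Sum>i\<in>UNIV. \<zeta>' $ i * z $ i) \<le> (\<Sum>i\<in>UNIV. \<bar>cmod (\<zeta>' $ i)\<bar> * \<bar>cmod (z $ i)\<bar>)"
      by (rule sum_norm_le) (simp add: norm_mult)
    also have "\<dots> \<le> norm \<zeta>' * norm z" unfolding norm_vec_def by (rule L2_set_mult_ineq)
    finally have "cmod (\<Sum>i\<in>UNIV. \<zeta>' $ i * z $ i) < 1" using z \<zeta>' by simp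
    then show ?thesis by (auto simp: v_def)
  qed
  \<comment> \<open>Both sides use the same principal logarithm of \<open>v z\<close>, so all test
    functions are powers of the single function \<open>u\<close>.\<close>
  have pow: "v z powr (- complex_of_real (r * real (Suc k))) = u z ^ Suc k" if z: "norm z < 1" for z k
    using vne[OF z] by (simp add: u_def powr_def exp_of_nat_mult[symmetric] algebra_simps del: power_Suc)
  have H2: "H2_fun (\<lambda>z. v z powr (- complex_of_real (r * real (Suc k))))" if "k \<in> {..d}" for k
    unfolding v_def
  proof (rule H2_fun_binomial[OF _ _ \<zeta>'])
    have "real (Suc k) \<le> real d + 1" using that by simp
    then have "r * real (Suc k) \<le> r * (real d + 1)" using r by (intro mult_left_mono) simp_all
    also have "r * (real d + 1) = 1 / 4" by (simp add: r_def field_simps)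
    finally show "r * real (Suc k) \<le> 1 / 4" .
  qed (use r in simp)
  have fin: "finite {..d}" "d < card {..d}" by simp_all
  obtain t a where t: "\<exists>k\<in>{..d}. t k \<noteq> 0"
    and a: "square_summable a"
    and "\<forall>z. norm z < 1 \<longrightarrow>
      (\<Sum>k\<le>d. t k * v z powr (- complex_of_real (r * real (Suc k)))) = word_series a (F z)"
    using combination_in_range[of "{..d}" "\<lambda>k z. v z powr (- complex_of_real (r * real (Suc k)))", OF fin H2]
    by blast
  then have ta: "(\<Sum>k\<le>d. t k * v z powr (- complex_of_real (r * real (Suc k)))) = word_series a (F z)"
    if "norm z < 1" for z
    using that by blast
  \<comment> \<open>The index is shifted by one and the constant coefficient is 0, so a nonzero t
    yields a nonconstant polynomial in \<open>u\<close>, which tends to infinity along the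
    sequence.\<close>
  define c where "c k = (case k of 0 \<Rightarrow> 0 | Suc l \<Rightarrow> t l)" for k
  have poly: "(\<Sum>k\<le>Suc d. c k * u z ^ k) = word_series a (F z)" if z: "norm z < 1" for z
  proof -
    have "(\<Sum>k\<le>Suc d. c k * u z ^ k) = (\<Sum>k\<le>d. t k * u z ^ Suc k)"
      unfolding sum.atMost_Suc_shift by (simp add: c_def)
    also have "\<dots> = (\<Sum>k\<le>d. t k * v z powr (- complex_of_real (r * real (Suc k))))"
      by (simp only: pow[OF z])
    finally show ?thesis using ta[OF z] by simp
  qed
  have "(\<lambda>n. v (x n)) \<longlonglongrightarrow> v \<zeta>"
    unfolding v_def by (intro tendsto_intros x\<zeta>)
  moreover have "v \<zeta> = 0"
  proof -
    have "(\<Sum>i\<in>UNIV. \<zeta>' $ i * \<zeta> $ i) = (\<Sum>i\<in>UNIV. of_real ((cmod (\<zeta> $ i))\<^sup>2))"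
      unfolding complex_norm_square by (simp add: \<zeta>'_def mult.commute)
    also have "\<dots> = of_real ((norm \<zeta>)\<^sup>2)"
      unfolding norm_vec_def L2_set_def by (simp add: sum_nonneg del: of_real_power)
    finally show ?thesis by (simp add: v_def \<zeta>)
  qed
  ultimately have v0: "(\<lambda>n. v (x n)) \<longlonglongrightarrow> 0" by simp
  have "filterlim (\<lambda>n. cmod (v (x n))) (at_right 0) sequentially"
    unfolding filterlim_at using tendsto_norm[OF v0] vne[OF x] by simp
  moreover have "filterlim (\<lambda>y::real. y powr (- r)) at_top (at_right 0)"
    using r by real_asymp
  ultimately have "filterlim (\<lambda>n. cmod (v (x n)) powr (- r)) at_top sequentially"
    by (rule filterlim_compose[rotated])
  moreover have "cmod (u (x n)) = cmod (v (x n)) powr (- r)" for n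
    unfolding u_def by (subst norm_powr_real_powr') simp_all
  ultimately have u: "filterlim (\<lambda>n. u (x n)) at_infinity sequentially"
    by (intro filterlim_norm_at_top_imp_at_infinity) simp
  obtain R where R': "\<forall>i. 0 < R i \<and> cmod (w $ i) < R i" and R3: "norm (\<chi> i. complex_of_real (R i)) < 1"
    using polyradius_exists[OF w] by blast
  then have R: "0 < R i" "cmod (w $ i) < R i" for i by simp_all
  have wa: "wiener R a"
    by (rule wiener_free_coeffs[OF free_coeffs_square_summable[OF a] less_imp_le[OF R(1)] R3])
  \<comment> \<open>The values F(x n) eventually stay in the closed polydisc with radii R, which
    contains w in its interior and on which \<open>B\<close> bounds the series.\<close>
  define B where "B = (\<Sum>\<^sub>\<infinity>\<alpha>. cmod (a \<alpha>) * rad_mono R \<alpha>)"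
  have bounded: "eventually (\<lambda>n. cmod (word_series a (F (x n))) \<le> B) sequentially"
    using filterlim_iff[THEN iffD1, OF Fx, rule_format, OF eventually_in_polydisc[of w R, OF R(2)]]
    by eventually_elim (use norm_word_series_le[OF wa] in \<open>simp add: B_def\<close>)
  obtain k where k: "k \<le> d" "t k \<noteq> 0" using t by auto
  have "\<exists>k. k \<noteq> 0 \<and> k \<le> Suc d \<and> c k \<noteq> 0"
    using k by (intro exI[of _ "Suc k"]) (simp add: c_def)
  from polyfun_extremal[where c = c and B = "B + 1", OF this]
  have "eventually (\<lambda>z. B + 1 \<le> cmod (\<Sum>k\<le>Suc d. c k * z ^ k)) at_infinity" .
  from filterlim_iff[THEN iffD1, OF u, rule_format, OF this] bounded
  have "eventually (\<lambda>n. False) sequentially"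
  proof eventually_elim
    case (elim n)
    from elim(1) have "B + 1 \<le> cmod (word_series a (F (x n)))" unfolding poly[OF x] .
    with elim(2) show ?case by simp
  qed
  then show False by simp
qed

section \<open>Surjectivity and holomorphy of the inverse\<close>

text \<open>Preimages of points tending to w accumulate in the closed ball.
  \<open>boundary_sequence_impossible\<close> excludes a limit on the sphere, and at a limit inside
  the ball continuity gives a preimage of w.\<close>

lemma F_image_closed:
  assumes w: "norm w < 1" and cl: "w \<in> closure (F ` ball 0 1)"
  shows "w \<in> F ` ball 0 1"
proof -
  obtain y where y: "\<And>n. y n \<in> F ` ball 0 1" "y \<longlonglongrightarrow> w"
    using cl unfolding closure_sequential by blast
  then have "\<forall>n. \<exists>x. norm x < 1 \<and> y n = F x" by force
  then obtain x where x: "\<And>n. norm (x n) < 1" "\<And>n. y n = F (x n)" by metis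
  have "\<forall>n. x n \<in> cball 0 1" using x(1) by (simp add: less_imp_le)
  then obtain \<zeta> s where \<zeta>: "\<zeta> \<in> cball 0 1" and s: "strict_mono (s :: nat \<Rightarrow> nat)" and lim: "(x \<circ> s) \<longlonglongrightarrow> \<zeta>"
    using compact_cball[of 0 1] unfolding compact_def by blast
  have Fl: "(\<lambda>n. F ((x \<circ> s) n)) \<longlonglongrightarrow> w"
    using LIMSEQ_subseq_LIMSEQ[OF y(2) s] by (simp add: o_def x(2))
  have "norm \<zeta> < 1"
  proof (rule ccontr)
    assume "\<not> norm \<zeta> < 1"
    with \<zeta> have "norm \<zeta> = 1" by simp
    show False
      by (rule boundary_sequence_impossible[OF _ lim \<open>norm \<zeta> = 1\<close> Fl w]) (simp add: x(1))
  qed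
  then have "(\<lambda>n. F ((x \<circ> s) n)) \<longlonglongrightarrow> F \<zeta>"
    by (rule filterlim_compose[OF F_tendsto lim])
  then have "w = F \<zeta>" by (rule LIMSEQ_unique[OF Fl])
  with \<open>norm \<zeta> < 1\<close> show ?thesis by simp
qed

text \<open>Connectedness of the ball turns openness and relative closedness of the image into
  surjectivity.\<close>

lemma F_image: "F ` ball 0 1 = ball 0 1"
proof -
  have sub: "F ` ball 0 1 \<subseteq> ball 0 1"
    by (rule image_subsetI) (simp add: F_ball)
  have "F ` ball 0 1 \<subseteq> interior (F ` ball 0 1)"
  proof (rule image_subsetI)
    fix z :: "complex ^ 'n" assume "z \<in> ball 0 1"
    then show "F z \<in> interior (F ` ball 0 1)"
      by (intro F_open_at) (simp_all add: interior_open)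
  qed
  then have "interior (F ` ball 0 1) = F ` ball 0 1"
    by (rule subset_antisym[OF interior_subset])
  then have "open (F ` ball 0 1)" by (simp only: interior_eq)
  then have opn: "openin (top_of_set (ball 0 1)) (F ` ball 0 1)"
    by (rule open_subset[OF sub])
  have "F ` ball 0 1 = ball 0 1 \<inter> closure (F ` ball 0 1)"
  proof (rule subset_antisym)
    show "F ` ball 0 1 \<subseteq> ball 0 1 \<inter> closure (F ` ball 0 1)"
      by (rule Int_greatest[OF sub closure_subset])
    show "ball 0 1 \<inter> closure (F ` ball 0 1) \<subseteq> F ` ball 0 1"
    proof
      fix w assume "w \<in> ball 0 1 \<inter> closure (F ` ball 0 1)"
      then have "norm w < 1" "w \<in> closure (F ` ball 0 1)" by simp_all
      then show "w \<in> F ` ball 0 1" by (rule F_image_closed)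
    qed
  qed
  then have "closedin (top_of_set (ball 0 1)) (F ` ball 0 1)"
    unfolding closedin_closed by (intro exI[of _ "closure (F ` ball 0 1)"] conjI closed_closure)
  with opn have "F ` ball 0 1 = {} \<or> F ` ball 0 1 = ball 0 1"
    by (intro connected_clopen[THEN iffD1, OF connected_ball, rule_format] conjI)
  then show ?thesis by simp
qed

lemma F_holomorphic_automorphism: "holomorphic_automorphism (ball 0 1) F"
proof -
  have "holomorphic_map_on F (ball 0 1)"
    unfolding holomorphic_map_on_def
  proof
    fix z :: "complex ^ 'n" assume "z \<in> ball 0 1"
    then have "norm z < 1" by simp
    then obtain M M' :: "complex ^ 'n ^ 'n" where "(F has_derivative (\<lambda>v. M *v v)) (at z)"
      by (rule F_derivative)
    then show "\<exists>D. (F has_derivative D) (at z) \<and> (\<forall>c v. D (c *s v) = c *s D v)"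
      by (intro exI[of _ "(*v) M"]) (simp add: vector_scalar_commute)
  qed
  moreover have "holomorphic_map_on (inv_into (ball 0 1) F) (ball 0 1)"
    unfolding holomorphic_map_on_def
  proof
    fix z :: "complex ^ 'n" assume "z \<in> ball 0 1"
    then obtain x where x: "x \<in> ball 0 1" "z = F x" using F_image by blast
    then have "norm x < 1" by simp
    then obtain M M' :: "complex ^ 'n ^ 'n"
      where M: "(F has_derivative (\<lambda>v. M *v v)) (at x)" "M ** M' = mat 1"
      by (rule F_derivative)
    have "(inv_into (ball 0 1) F has_derivative (\<lambda>v. M' *v v)) (at (F x))"
    \<comment> \<open>With the global inverse at hand, continuity of F and its derivative at the
      single point x determine the derivative of the inverse as the complex matrix M'.\<close>
    proof (rule has_derivative_inverse_strong[OF open_ball x(1) F_continuous_on _ M(1)])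
      show "inv_into (ball 0 1) F (F y) = y" if "y \<in> ball 0 1" for y
        by (rule inv_into_f_f[OF F_inj that])
      show "(*v) M \<circ> (*v) M' = id"
        by (simp add: fun_eq_iff matrix_vector_mul_assoc M(2))
    qed
    then show "\<exists>D. (inv_into (ball 0 1) F has_derivative D) (at z) \<and> (\<forall>c v. D (c *s v) = c *s D v)"
      by (intro exI[of _ "(*v) M'"]) (simp add: vector_scalar_commute x(2))
  qed
  ultimately show ?thesis
    by (simp add: holomorphic_automorphism_def bij_betw_def F_inj F_image)
qed

end

theorem theorem4p4:
  fixes \<phi> :: "('n::finite \<Rightarrow> 'h::complex_hilbert \<Rightarrow>\<^sub>L 'h) \<Rightarrow> ('n \<Rightarrow> 'h \<Rightarrow>\<^sub>L 'h)"
  assumes separable: "\<exists>S :: 'h set. countable S \<and> closure S = UNIV"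
    and infinite_dimensional: "\<not> finite_dimensional_in scaleC (UNIV :: 'h set)"
    and self_map: "free_holomorphic_self_map \<phi>"
    and fredholm: "fredholm_on scale_fun H2_ball H2_norm (comp_op \<phi>)"
  shows "holomorphic_automorphism (ball 0 1) (scalar_rep \<phi>)"
proof (rule scalar_reduction[OF infinite_dimensional self_map fredholm])
  fix A and d :: nat and b
  assume "\<And>i. free_coeffs (A i)"
    and "\<And>z. norm z < 1 \<Longrightarrow> scalar_rep \<phi> z = (\<chi> i. word_series (A i) z)"
    and "\<And>z. norm z < 1 \<Longrightarrow> norm (scalar_rep \<phi> z) < 1"
    and "\<And>a. square_summable a \<Longrightarrow> \<exists>a' c. square_summable a' \<and>
          (\<forall>z. norm z < 1 \<longrightarrow> word_series a z = word_series a' (scalar_rep \<phi> z) + (\<Sum>j<d. c j * b j z))"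
  then interpret finite_codimension_composition "scalar_rep \<phi>" A d b
    by unfold_locales
  show ?thesis by (rule F_holomorphic_automorphism)
qed

end
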